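(* Let $\mathcal{F}$ be a 2-summable family of finite graded vi-lattices, and for each symmetry type XX let $\mathrm{XX}_n$ denote the number of nonisomorphic $n$-element lattices in $\mathcal{F}$ of type XX. Then for $n<8$ we have $\mathrm{CF}_n=\mathrm{CS}_n=\mathrm{CN}_n=0$, and for $n\ge 8$: \begin{align*} \mathrm{CF}_n &= \sum_{j=6}^{n-2}\Big(\mathrm{LF}_j\,(2\,\mathrm{MF}_k+\mathrm{MA}_k+\mathrm{MH}_k)+\mathrm{LS}_j\,(\mathrm{MF}_k+\mathrm{MA}_k)\Big),\\ \mathrm{CS}_n &= \sum_{j=6}^{n-2}\Big(\mathrm{LF}_j\,(2\,\mathrm{MC}_k+\mathrm{MX}_k)+\mathrm{LS}_j\,(\mathrm{MC}_k+\mathrm{MX}_k+\mathrm{MH}_k)\Big),\\ \mathrm{CN}_n &= \sum_{j=6}^{n-2}\Big(\mathrm{LF}_j\,(2\,\mathrm{TF}_k+\mathrm{TS}_k)+\mathrm{LS}_j\,(\mathrm{TF}_k+\mathrm{TS}_k)\Big), \end{align*} where $k=n-j+4$, $\mathrm{LF}_j=\mathrm{CF}_j+\mathrm{BF}_j+\mathrm{MF}_j+\mathrm{MA}_j$ and $\mathrm{LS}_j=\mathrm{CS}_j+\mathrm{BS}_j+\mathrm{MC}_j+\mathrm{MX}_j+\mathrm{MH}_j$.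
   Context: All lattices are finite. $a(L)$, $c(L)$: numbers of atoms and coatoms. Vertical 2-sum: for disjoint lattices $L,U$ of length at least 3, $L$ with exactly two coatoms $c_1,c_2$ and $U$ with exactly two atoms $a_1,a_2$, the two vertical 2-sums are obtained by removing the top of $L$ and the bottom of $U$ and identifying $(c_1,c_2)$ with $(a_1,a_2)$ or with $(a_2,a_1)$; $L$ and $U$ are its summands. A vi-lattice is a lattice that is not a vertical sum (top of one identified with bottom of the other) of two non-singleton lattices. A family $\mathcal{F}$ of graded vi-lattices is 2-summable if (C1) whenever $L,U\in\mathcal{F}$ and $S$ is one of their vertical 2-sums, $S\in\mathcal{F}$; and (C2) whenever $S\in\mathcal{F}$ is a vertical 2-sum of $L$ and $U$, then $L,U\in\mathcal{F}$. Two coatoms [atoms] of a lattice with exactly two coatoms [atoms] are symmetric if some automorphism swaps them, fixed otherwise. For a graded vi-lattice, the $k$-th level is the set of elements of rank $k$; a neck is a two-element level other than the atom level and the coatom level. Composition: graded vi-lattice containing a neck. Piece: graded vi-lattice with no neck, rank at least 3, and $a(L)=2$ or $c(L)=2$. Middle piece: $a=c=2$; bottom piece: $a\ge3$, $c=2$; top piece: $a=2$, $c\ge 3$. Middle piece types: MF (atoms and coatoms fixed), MA (atoms symmetric, coatoms fixed), MC (atoms fixed, coatoms symmetric), MX (has an automorphism swapping atoms and fixing coatoms, and another swapping coatoms and fixing atoms), MH (not MX, but has an automorphism swapping both atoms and coatoms). Bottom piece: BF (coatoms fixed), BS (coatoms symmetric). Top piece: TF (atoms fixed), TS (atoms symmetric).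 Composition: CF (two coatoms, fixed), CS (two coatoms, symmetric), CN (three or more coatoms). *)

theory Defs
  imports "HOL-Algebra.Lattice"
begin

section \<open>Finite lattices\<close>

text \<open>In \<^locale>\<open>partial_order\<close> and its extensions the field \<^const>\<open>eq\<close> is forced to be equality,
  so a lattice is given by its carrier and its order.  Boundedness only adds that the carrier is
  nonempty.\<close>

definition finite_lattice :: "'a gorder \<Rightarrow> bool" where
  "finite_lattice L \<longleftrightarrow> bounded_lattice L \<and> finite (carrier L)"

definition order_iso :: "'a gorder \<Rightarrow> 'b gorder \<Rightarrow> ('a \<Rightarrow> 'b) \<Rightarrow> bool" where
  "order_iso L M f \<longleftrightarrow> order_emb L M f \<and> bij_betw f (carrier L) (carrier M)"

definition isomorphic :: "'a gorder \<Rightarrow> 'b gorder \<Rightarrow> bool" where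
  "isomorphic L M \<longleftrightarrow> (\<exists>f. order_iso L M f)"

definition covers :: "'a gorder \<Rightarrow> 'a \<Rightarrow> 'a \<Rightarrow> bool" where
  "covers L y x \<longleftrightarrow> x \<in> carrier L \<and> y \<in> carrier L \<and> x \<sqsubset>\<^bsub>L\<^esub> y \<and>
     \<not> (\<exists>z\<in>carrier L. x \<sqsubset>\<^bsub>L\<^esub> z \<and> z \<sqsubset>\<^bsub>L\<^esub> y)"

definition atoms :: "'a gorder \<Rightarrow> 'a set" where
  "atoms L = {x. covers L x \<bottom>\<^bsub>L\<^esub>}"

definition coatoms :: "'a gorder \<Rightarrow> 'a set" where
  "coatoms L = {x. covers L \<top>\<^bsub>L\<^esub> x}"

definition is_chain :: "'a gorder \<Rightarrow> 'a set \<Rightarrow> bool" where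
  "is_chain L C \<longleftrightarrow> C \<subseteq> carrier L \<and> (\<forall>x\<in>C. \<forall>y\<in>C. x \<sqsubseteq>\<^bsub>L\<^esub> y \<or> y \<sqsubseteq>\<^bsub>L\<^esub> x)"

definition lattice_length :: "'a gorder \<Rightarrow> nat" where
  "lattice_length L = Max {card C - 1 | C. is_chain L C}"


section \<open>Vertical sums and vertical 2-sums\<close>

text \<open>The disjoint union of \<open>P\<close> and \<open>Q\<close> with each \<open>y\<close> in the domain of \<open>m\<close> identified with
  \<open>the (m y)\<close>; the order is generated by the orders of the two parts.\<close>

definition glue_map :: "('b \<rightharpoonup> 'a) \<Rightarrow> 'b \<Rightarrow> 'a + 'b" where
  "glue_map m y = (case m y of Some x \<Rightarrow> Inl x | None \<Rightarrow> Inr y)"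

definition glue :: "'a gorder \<Rightarrow> 'b gorder \<Rightarrow> ('b \<rightharpoonup> 'a) \<Rightarrow> ('a + 'b) gorder" where
  "glue P Q m =
     \<lparr> carrier = Inl ` carrier P \<union> glue_map m ` carrier Q,
       eq = (=),
       le = (\<lambda>u v. (u, v) \<in>
         ({(Inl x, Inl x') | x x'. x \<in> carrier P \<and> x' \<in> carrier P \<and> x \<sqsubseteq>\<^bsub>P\<^esub> x'} \<union>
          {(glue_map m y, glue_map m y') | y y'.
             y \<in> carrier Q \<and> y' \<in> carrier Q \<and> y \<sqsubseteq>\<^bsub>Q\<^esub> y'})\<^sup>+) \<rparr>"

definition remove :: "'a gorder \<Rightarrow> 'a \<Rightarrow> 'a gorder" where
  "remove L x = L\<lparr>carrier := carrier L - {x}\<rparr>"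

text \<open>Both sums are taken up to isomorphism, so no disjointness has to be required of the
  summands.\<close>

definition is_vertical_sum :: "'c gorder \<Rightarrow> 'a gorder \<Rightarrow> 'b gorder \<Rightarrow> bool" where
  "is_vertical_sum S L U \<longleftrightarrow>
     partial_order S \<and> finite_lattice L \<and> finite_lattice U \<and>
     isomorphic S (glue L U [\<bottom>\<^bsub>U\<^esub> \<mapsto> \<top>\<^bsub>L\<^esub>])"

text \<open>The two ways of identifying the coatoms of \<open>L\<close> with the atoms of \<open>U\<close> arise from the two
  enumerations of \<^term>\<open>atoms U\<close>.\<close>

definition is_vertical_2sum :: "'c gorder \<Rightarrow> 'a gorder \<Rightarrow> 'b gorder \<Rightarrow> bool" where
  "is_vertical_2sum S L U \<longleftrightarrow>
     partial_order S \<and> finite_lattice L \<and> finite_lattice U \<and>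
     lattice_length L \<ge> 3 \<and> lattice_length U \<ge> 3 \<and>
     (\<exists>c1 c2 a1 a2.
        coatoms L = {c1, c2} \<and> c1 \<noteq> c2 \<and> atoms U = {a1, a2} \<and> a1 \<noteq> a2 \<and>
        isomorphic S (glue (remove L \<top>\<^bsub>L\<^esub>) (remove U \<bottom>\<^bsub>U\<^esub>) [a1 \<mapsto> c1, a2 \<mapsto> c2]))"

text \<open>The summands of a vertical sum embed into it, so it is no restriction that \<open>L\<close> and \<open>U\<close> range
  over lattices on the type of \<open>S\<close>.\<close>

definition vi_lattice :: "'a gorder \<Rightarrow> bool" where
  "vi_lattice S \<longleftrightarrow> finite_lattice S \<and>
     \<not> (\<exists>(L :: 'a gorder) (U :: 'a gorder).
          card (carrier L) \<noteq> 1 \<and> card (carrier U) \<noteq> 1 \<and> is_vertical_sum S L U)"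


section \<open>Graded vi-lattices\<close>

definition rank_function :: "'a gorder \<Rightarrow> ('a \<Rightarrow> nat) \<Rightarrow> bool" where
  "rank_function L r \<longleftrightarrow> r \<bottom>\<^bsub>L\<^esub> = 0 \<and> (\<forall>x y. covers L y x \<longrightarrow> r y = r x + 1)"

definition graded :: "'a gorder \<Rightarrow> bool" where
  "graded L \<longleftrightarrow> (\<exists>r. rank_function L r)"

text \<open>On the carrier of a finite graded lattice the rank function is unique; elsewhere
  \<open>rank\<close> is arbitrary.\<close>

definition rank :: "'a gorder \<Rightarrow> 'a \<Rightarrow> nat" where
  "rank L = (SOME r. rank_function L r)"

definition level :: "'a gorder \<Rightarrow> nat \<Rightarrow> 'a set" where
  "level L k = {x \<in> carrier L. rank L x = k}"

definition graded_vi_lattice :: "'a gorder \<Rightarrow> bool" where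
  "graded_vi_lattice L \<longleftrightarrow> vi_lattice L \<and> graded L"

definition is_neck :: "'a gorder \<Rightarrow> 'a set \<Rightarrow> bool" where
  "is_neck L N \<longleftrightarrow> (\<exists>k. N = level L k) \<and> card N = 2 \<and> N \<noteq> atoms L \<and> N \<noteq> coatoms L"

definition two_summable :: "'a gorder set \<Rightarrow> bool" where
  "two_summable F \<longleftrightarrow>
     (\<forall>L\<in>F. graded_vi_lattice L) \<and>
     (\<forall>L\<in>F. \<forall>U\<in>F. \<forall>S :: 'a gorder. is_vertical_2sum S L U \<longrightarrow> S \<in> F) \<and>
     (\<forall>S\<in>F. \<forall>(L :: 'a gorder) (U :: 'a gorder). is_vertical_2sum S L U \<longrightarrow> L \<in> F \<and> U \<in> F)"


section \<open>Compositions, pieces and their symmetry types\<close>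

definition composition :: "'a gorder \<Rightarrow> bool" where
  "composition L \<longleftrightarrow> graded_vi_lattice L \<and> (\<exists>N. is_neck L N)"

definition piece :: "'a gorder \<Rightarrow> bool" where
  "piece L \<longleftrightarrow> graded_vi_lattice L \<and> \<not> (\<exists>N. is_neck L N) \<and> rank L \<top>\<^bsub>L\<^esub> \<ge> 3 \<and>
     (card (atoms L) = 2 \<or> card (coatoms L) = 2)"

definition middle_piece :: "'a gorder \<Rightarrow> bool" where
  "middle_piece L \<longleftrightarrow> piece L \<and> card (atoms L) = 2 \<and> card (coatoms L) = 2"

definition bottom_piece :: "'a gorder \<Rightarrow> bool" where
  "bottom_piece L \<longleftrightarrow> piece L \<and> card (atoms L) \<ge> 3 \<and> card (coatoms L) = 2"

definition top_piece :: "'a gorder \<Rightarrow> bool" where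
  "top_piece L \<longleftrightarrow> piece L \<and> card (atoms L) = 2 \<and> card (coatoms L) \<ge> 3"

abbreviation automorphism :: "'a gorder \<Rightarrow> ('a \<Rightarrow> 'a) \<Rightarrow> bool" where
  "automorphism L f \<equiv> order_iso L L f"

definition swaps :: "('a \<Rightarrow> 'a) \<Rightarrow> 'a set \<Rightarrow> bool" where
  "swaps f A \<longleftrightarrow> (\<exists>x y. x \<noteq> y \<and> A = {x, y} \<and> f x = y \<and> f y = x)"

definition leaves_fixed :: "('a \<Rightarrow> 'a) \<Rightarrow> 'a set \<Rightarrow> bool" where
  "leaves_fixed f A \<longleftrightarrow> (\<forall>x\<in>A. f x = x)"

definition atoms_symmetric :: "'a gorder \<Rightarrow> bool" where
  "atoms_symmetric L \<longleftrightarrow> card (atoms L) = 2 \<and> (\<exists>f. automorphism L f \<and> swaps f (atoms L))"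

definition atoms_fixed :: "'a gorder \<Rightarrow> bool" where
  "atoms_fixed L \<longleftrightarrow> card (atoms L) = 2 \<and> \<not> atoms_symmetric L"

definition coatoms_symmetric :: "'a gorder \<Rightarrow> bool" where
  "coatoms_symmetric L \<longleftrightarrow> card (coatoms L) = 2 \<and> (\<exists>f. automorphism L f \<and> swaps f (coatoms L))"

definition coatoms_fixed :: "'a gorder \<Rightarrow> bool" where
  "coatoms_fixed L \<longleftrightarrow> card (coatoms L) = 2 \<and> \<not> coatoms_symmetric L"

definition type_MX :: "'a gorder \<Rightarrow> bool" where
  "type_MX L \<longleftrightarrow> middle_piece L \<and>
     (\<exists>f. automorphism L f \<and> swaps f (atoms L) \<and> leaves_fixed f (coatoms L)) \<and>
     (\<exists>f. automorphism L f \<and> swaps f (coatoms L) \<and> leaves_fixed f (atoms L))"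

definition type_MH :: "'a gorder \<Rightarrow> bool" where
  "type_MH L \<longleftrightarrow> middle_piece L \<and> \<not> type_MX L \<and>
     (\<exists>f. automorphism L f \<and> swaps f (atoms L) \<and> swaps f (coatoms L))"

definition type_MF :: "'a gorder \<Rightarrow> bool" where
  "type_MF L \<longleftrightarrow> middle_piece L \<and> atoms_fixed L \<and> coatoms_fixed L"

definition type_MA :: "'a gorder \<Rightarrow> bool" where
  "type_MA L \<longleftrightarrow> middle_piece L \<and> atoms_symmetric L \<and> coatoms_fixed L"

definition type_MC :: "'a gorder \<Rightarrow> bool" where
  "type_MC L \<longleftrightarrow> middle_piece L \<and> atoms_fixed L \<and> coatoms_symmetric L"

definition type_BF :: "'a gorder \<Rightarrow> bool" where
  "type_BF L \<longleftrightarrow> bottom_piece L \<and> coatoms_fixed L"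

definition type_BS :: "'a gorder \<Rightarrow> bool" where
  "type_BS L \<longleftrightarrow> bottom_piece L \<and> coatoms_symmetric L"

definition type_TF :: "'a gorder \<Rightarrow> bool" where
  "type_TF L \<longleftrightarrow> top_piece L \<and> atoms_fixed L"

definition type_TS :: "'a gorder \<Rightarrow> bool" where
  "type_TS L \<longleftrightarrow> top_piece L \<and> atoms_symmetric L"

definition type_CF :: "'a gorder \<Rightarrow> bool" where
  "type_CF L \<longleftrightarrow> composition L \<and> coatoms_fixed L"

definition type_CS :: "'a gorder \<Rightarrow> bool" where
  "type_CS L \<longleftrightarrow> composition L \<and> coatoms_symmetric L"

definition type_CN :: "'a gorder \<Rightarrow> bool" where
  "type_CN L \<longleftrightarrow> composition L \<and> card (coatoms L) \<ge> 3"


section \<open>Numbers of nonisomorphic lattices\<close>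

definition num :: "'a gorder set \<Rightarrow> ('a gorder \<Rightarrow> bool) \<Rightarrow> nat \<Rightarrow> nat" where
  "num F T n = card ({L \<in> F. card (carrier L) = n \<and> T L} // {(L, M). isomorphic L M})"

definition LF :: "'a gorder set \<Rightarrow> nat \<Rightarrow> nat" where
  "LF F j = num F type_CF j + num F type_BF j + num F type_MF j + num F type_MA j"

definition LS :: "'a gorder set \<Rightarrow> nat \<Rightarrow> nat" where
  "LS F j = num F type_CS j + num F type_BS j + num F type_MC j + num F type_MX j
     + num F type_MH j"

end

(*
  A composition S has a topmost neck, at rank k say.  Keeping only the levels up to k and the top, or
  only the levels from k on and the bottom, gives lattices L and U of which S is a vertical 2-sum;
  here L has two coatoms and U has two atoms and no neck.  Since isomorphisms preserve ranks, L, U and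
  the matching of the coatoms of L with the atoms of U are determined by S up to automorphisms of L
  and U.  Hence, for fixed L and U, the two matchings give isomorphic sums iff the coatoms of L or the
  atoms of U are symmetric, and the coatoms of S are symmetric iff some automorphism of U swaps its
  coatoms and either fixes its atoms or can be compensated by an automorphism of L swapping the
  coatoms of L.  Counting pairs (L, U) according to these symmetries gives the recurrences.
*)

theory Submission
  imports Defs
begin

text \<open>Cutting at the topmost neck, not at an arbitrary one, makes the decomposition unique:
  the upper part is a single piece, and all other necks go to the lower part, which may again be a
  composition. Hence C-types occur in the recurrences on the side of L only. Three obstacles shape
  the argument. The order of \<open>glue\<close> is a transitive closure; it is replaced by an
  explicit order (\<open>amalgam\<close>) in which covers, ranks and isomorphisms can be computed. A
  sum must live on the type over which the family ranges; that type being infinite, a copy of the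
  finite sum fits into it. Finally, sums and summands are not shown to be graded by construction:
  (C1) and (C2) place them in the family, whose members are graded vi-lattices, and only then are
  their ranks used. The constants: two elements are deleted and two pairs identified, so |S| = |L| +
  |U| - 4 and \<open>k = n - j + 4\<close>; each summand has at least 6 elements, which gives the
  range of j and the threshold 8 = 6 + 6 - 4.\<close>

section \<open>Finite graded lattices\<close>

text \<open>With several orders interpreted at once, these rules turn every equality into subgoals about each of
  the orders and make the classical reasoner diverge.\<close>

declare (in weak_partial_order) weak_le_antisym [rule del] le_cong_l [rule del] le_cong_r [rule del]
  weak_refl [rule del]
declare (in partial_order) le_antisym [rule del]

lemma partial_orderI:
  assumes "eq S = (=)"
    and "\<And>x. x \<in> carrier S \<Longrightarrow> x \<sqsubseteq>\<^bsub>S\<^esub> x"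
    and "\<And>x y. x \<sqsubseteq>\<^bsub>S\<^esub> y \<Longrightarrow> y \<sqsubseteq>\<^bsub>S\<^esub> x \<Longrightarrow> x \<in> carrier S \<Longrightarrow> y \<in> carrier S \<Longrightarrow> x = y"
    and "\<And>x y z. x \<sqsubseteq>\<^bsub>S\<^esub> y \<Longrightarrow> y \<sqsubseteq>\<^bsub>S\<^esub> z \<Longrightarrow> x \<in> carrier S \<Longrightarrow> y \<in> carrier S \<Longrightarrow> z \<in> carrier S \<Longrightarrow>
      x \<sqsubseteq>\<^bsub>S\<^esub> z"
  shows "partial_order S"
proof (intro partial_order.intro weak_partial_order.intro)
  show "equivalence S"
    by (rule equivalence.intro) (simp_all add: assms(1))
  show "weak_partial_order_axioms S"
  proof (rule weak_partial_order_axioms.intro, unfold assms(1))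
    show "x \<sqsubseteq>\<^bsub>S\<^esub> x" if "x \<in> carrier S" for x
      using that by (rule assms(2))
    show "x = y" if "x \<sqsubseteq>\<^bsub>S\<^esub> y" "y \<sqsubseteq>\<^bsub>S\<^esub> x" "x \<in> carrier S" "y \<in> carrier S" for x y
      using that by (rule assms(3))
    show "x \<sqsubseteq>\<^bsub>S\<^esub> z" if "x \<sqsubseteq>\<^bsub>S\<^esub> y" "y \<sqsubseteq>\<^bsub>S\<^esub> z" "x \<in> carrier S" "y \<in> carrier S" "z \<in> carrier S"
      for x y z
      using that by (rule assms(4))
  qed simp
  show "partial_order_axioms S"
    by (rule partial_order_axioms.intro) (rule assms(1))
qed

section \<open>Covers, atoms and coatoms in a finite lattice\<close>

locale fin_lattice = bounded_lattice L for L :: "'a gorder" (structure) +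
  assumes finite_carrier [simp]: "finite (carrier L)"

lemma finite_lattice_iff: "finite_lattice L \<longleftrightarrow> fin_lattice L"
  by (simp add: finite_lattice_def fin_lattice_def fin_lattice_axioms_def)

context fin_lattice
begin

lemma covers_iff:
  "covers L y x \<longleftrightarrow> x \<in> carrier L \<and> y \<in> carrier L \<and> x \<sqsubseteq> y \<and> x \<noteq> y \<and>
     (\<forall>z\<in>carrier L. x \<sqsubseteq> z \<longrightarrow> z \<sqsubseteq> y \<longrightarrow> z = x \<or> z = y)"
  by (auto simp: covers_def lless_eq)

lemma ex_cover_above:
  assumes "x \<in> carrier L" "y \<in> carrier L" "x \<sqsubseteq> y" "x \<noteq> y"
  obtains z where "covers L z x" "z \<sqsubseteq> y"
proof -
  let ?A = "{z \<in> carrier L. x \<sqsubset> z \<and> z \<sqsubseteq> y}"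
  have "\<exists>m\<in>?A. \<forall>z\<in>?A. z \<noteq> m \<longrightarrow> \<not> z \<sqsubset> m"
  proof (rule Finite_Set.bex_min_element)
    show "asymp_on ?A (\<sqsubset>)"
      by (auto simp: asymp_on_def lless_eq dest: le_antisym)
    show "transp_on ?A (\<sqsubset>)"
      by (auto simp: transp_on_def lless_eq intro: le_trans dest: le_antisym)
  qed (use assms in \<open>auto simp: lless_eq\<close>)
  then obtain m where m: "m \<in> ?A" "\<forall>z\<in>?A. z \<noteq> m \<longrightarrow> \<not> z \<sqsubset> m"
    by blast
  have "covers L m x"
    unfolding covers_def using m assms by (auto simp: lless_eq dest: le_trans)
  with m show thesis
    using that by blast
qed

lemma ex_cover_below:
  assumes "x \<in> carrier L" "y \<in> carrier L" "x \<sqsubseteq> y" "x \<noteq> y"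
  obtains z where "covers L y z" "x \<sqsubseteq> z"
proof -
  let ?A = "{z \<in> carrier L. x \<sqsubseteq> z \<and> z \<sqsubset> y}"
  have "\<exists>m\<in>?A. \<forall>z\<in>?A. z \<noteq> m \<longrightarrow> \<not> m \<sqsubset> z"
  proof (rule Finite_Set.bex_max_element)
    show "asymp_on ?A (\<sqsubset>)"
      by (auto simp: asymp_on_def lless_eq dest: le_antisym)
    show "transp_on ?A (\<sqsubset>)"
      by (auto simp: transp_on_def lless_eq intro: le_trans dest: le_antisym)
  qed (use assms in \<open>auto simp: lless_eq\<close>)
  then obtain m where m: "m \<in> ?A" "\<forall>z\<in>?A. z \<noteq> m \<longrightarrow> \<not> m \<sqsubset> z"
    by blast
  have "covers L y m"
    unfolding covers_def using m assms by (auto simp: lless_eq dest: le_trans)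
  with m show thesis
    using that by blast
qed

lemma bottom_unique: "x \<in> carrier L \<Longrightarrow> x \<sqsubseteq> \<bottom> \<longleftrightarrow> x = \<bottom>"
  by (auto intro: le_antisym)

lemma top_unique: "x \<in> carrier L \<Longrightarrow> \<top> \<sqsubseteq> x \<longleftrightarrow> x = \<top>"
  by (auto intro: le_antisym)

lemma bottomI: "x \<in> carrier L \<Longrightarrow> (\<And>y. y \<in> carrier L \<Longrightarrow> x \<sqsubseteq> y) \<Longrightarrow> \<bottom> = x"
  by (metis bottom_closed bottom_lower le_antisym)

lemma topI: "x \<in> carrier L \<Longrightarrow> (\<And>y. y \<in> carrier L \<Longrightarrow> y \<sqsubseteq> x) \<Longrightarrow> \<top> = x"
  by (metis top_closed top_higher le_antisym)

lemma atom_iff: "a \<in> atoms L \<longleftrightarrow> a \<in> carrier L \<and> a \<noteq> \<bottom> \<and> (\<forall>z\<in>carrier L. z \<sqsubseteq> a \<longrightarrow> z = \<bottom> \<or> z = a)"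
  by (auto simp: atoms_def covers_iff)

lemma coatom_iff:
  "c \<in> coatoms L \<longleftrightarrow> c \<in> carrier L \<and> c \<noteq> \<top> \<and> (\<forall>z\<in>carrier L. c \<sqsubseteq> z \<longrightarrow> z = c \<or> z = \<top>)"
  by (auto simp: coatoms_def covers_iff)

lemma ex_atom_below:
  assumes "x \<in> carrier L" "x \<noteq> \<bottom>"
  obtains a where "a \<in> atoms L" "a \<sqsubseteq> x"
  using ex_cover_above[of "\<bottom>" x] assms by (auto simp: atoms_def)

lemma ex_coatom_above:
  assumes "x \<in> carrier L" "x \<noteq> \<top>"
  obtains c where "c \<in> coatoms L" "x \<sqsubseteq> c"
  using ex_cover_below[of x "\<top>"] assms by (auto simp: coatoms_def)

text \<open>Bottom, y, z and top form a chain of four elements. Ranks are avoided on purpose: the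
  lemma is applied to the two parts of a composition before these are known to be graded.\<close>

lemma chain_length:
  assumes "y \<in> carrier L" "z \<in> carrier L" "\<bottom> \<noteq> y" "y \<sqsubseteq> z" "y \<noteq> z" "z \<noteq> \<top>"
  shows "3 \<le> lattice_length L"
proof -
  let ?C = "{\<bottom>, y, z, \<top>}"
  have "z \<noteq> \<bottom>" "\<top> \<noteq> y" "\<top> \<noteq> \<bottom>"
    using assms bottom_unique[of y] top_unique[of z] bottom_unique[of z] top_higher[of z] by metis+
  then have "card ?C = 4"
    using assms by simp
  moreover have "is_chain L ?C"
    using assms by (auto simp: is_chain_def)
  ultimately have "3 \<in> {card C - 1 | C. is_chain L C}"
    by (intro CollectI exI[of _ ?C]) auto
  moreover have "finite {card C - 1 | C. is_chain L C}"
    by (rule finite_subset[of _ "(\<lambda>C. card C - 1) ` Pow (carrier L)"]) (auto simp: is_chain_def)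
  ultimately show ?thesis
    unfolding lattice_length_def by (intro Max_ge)
qed

lemma finite_atoms [simp]: "finite (atoms L)"
  by (rule finite_subset[OF _ finite_carrier]) (auto simp: atom_iff)

lemma finite_coatoms [simp]: "finite (coatoms L)"
  by (rule finite_subset[OF _ finite_carrier]) (auto simp: coatom_iff)

end

section \<open>Ranks and levels\<close>

locale graded_lattice = fin_lattice +
  assumes graded: "graded L"
begin

lemma rank_function_rank: "rank_function L (rank L)"
  unfolding rank_def using graded unfolding graded_def by (rule someI_ex)

lemma rank_bottom [simp]: "rank L \<bottom> = 0"
  using rank_function_rank by (simp add: rank_function_def)

lemma rank_covers: "covers L y x \<Longrightarrow> rank L y = rank L x + 1"
  using rank_function_rank by (simp add: rank_function_def)

text \<open>Stepping from x to a cover that is still below y raises the rank by one and shrinks the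
  set of elements above x, which is the induction measure.\<close>

lemma rank_less:
  assumes "x \<in> carrier L" "y \<in> carrier L" "x \<sqsubseteq> y" "x \<noteq> y"
  shows "rank L x < rank L y"
  using assms
proof (induction "card {z \<in> carrier L. x \<sqsubseteq> z}" arbitrary: x rule: less_induct)
  case less
  obtain z where z: "covers L z x" "z \<sqsubseteq> y"
    using ex_cover_above less.prems by metis
  then have zc: "z \<in> carrier L" "x \<sqsubseteq> z" "x \<noteq> z"
    by (auto simp: covers_iff)
  have rz: "rank L z = rank L x + 1"
    using z(1) by (rule rank_covers)
  show ?case
  proof (cases "z = y")
    case False
    have "{w \<in> carrier L. z \<sqsubseteq> w} \<subset> {w \<in> carrier L. x \<sqsubseteq> w}"
      using zc less.prems by (auto dest: le_trans le_antisym)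
    then have "card {w \<in> carrier L. z \<sqsubseteq> w} < card {w \<in> carrier L. x \<sqsubseteq> w}"
      by (intro psubset_card_mono) auto
    then show ?thesis
      using less.hyps[of z] less.prems z zc rz False by auto
  qed (use rz in auto)
qed

lemma rank_le: "x \<in> carrier L \<Longrightarrow> y \<in> carrier L \<Longrightarrow> x \<sqsubseteq> y \<Longrightarrow> rank L x \<le> rank L y"
  using rank_less[of x y] by fastforce

lemma rank_le_top: "x \<in> carrier L \<Longrightarrow> rank L x \<le> rank L \<top>"
  by (simp add: rank_le)

lemma eq_of_rank_eq:
  "x \<in> carrier L \<Longrightarrow> y \<in> carrier L \<Longrightarrow> x \<sqsubseteq> y \<Longrightarrow> rank L x = rank L y \<Longrightarrow> x = y"
  using rank_less[of x y] by fastforce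

lemma rank_eq_0_iff: "x \<in> carrier L \<Longrightarrow> rank L x = 0 \<longleftrightarrow> x = \<bottom>"
  by (metis bottom_closed bottom_lower eq_of_rank_eq rank_bottom)

lemma rank_eq_top_iff: "x \<in> carrier L \<Longrightarrow> rank L x = rank L \<top> \<longleftrightarrow> x = \<top>"
  by (metis top_closed top_higher eq_of_rank_eq)

text \<open>Climbing from x to y along covers raises the rank by one at a time, so no value is
  skipped. This is what makes a level separate the lattice: every comparison across it passes
  through it.\<close>

lemma ex_between:
  assumes "x \<in> carrier L" "y \<in> carrier L" "x \<sqsubseteq> y" "rank L x \<le> k" "k \<le> rank L y"
  obtains z where "z \<in> carrier L" "x \<sqsubseteq> z" "z \<sqsubseteq> y" "rank L z = k"
proof -
  have "\<exists>z\<in>carrier L. x \<sqsubseteq> z \<and> z \<sqsubseteq> y \<and> rank L z = k"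
    using assms(4,5)
  proof (induction k rule: dec_induct)
    case base
    then show ?case using assms by auto
  next
    case (step n)
    then obtain z where z: "z \<in> carrier L" "x \<sqsubseteq> z" "z \<sqsubseteq> y" "rank L z = n"
      by auto
    then have "z \<noteq> y" using step by auto
    then obtain w where "covers L w z" "w \<sqsubseteq> y"
      using ex_cover_above z assms by metis
    then show ?case
      using z rank_covers[of w z] assms(1) by (auto simp: covers_iff intro: le_trans)
  qed
  then show thesis using that by blast
qed

lemma covers_iff_rank:
  assumes "x \<in> carrier L" "y \<in> carrier L"
  shows "covers L y x \<longleftrightarrow> x \<sqsubseteq> y \<and> rank L y = rank L x + 1"
proof
  assume A: "x \<sqsubseteq> y \<and> rank L y = rank L x + 1"
  show "covers L y x"
    unfolding covers_iff
  proof (intro conjI ballI impI)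
    fix z assume "z \<in> carrier L" "x \<sqsubseteq> z" "z \<sqsubseteq> y"
    then show "z = x \<or> z = y"
      using A assms rank_less[of x z] rank_less[of z y] by fastforce
  qed (use assms A in auto)
qed (auto simp: covers_iff rank_covers)

lemma atoms_eq_level: "atoms L = level L 1"
  unfolding atoms_def level_def using covers_iff_rank[of "\<bottom>"]
  by (auto simp: covers_iff rank_covers)

lemma coatoms_eq_level:
  assumes "0 < rank L \<top>"
  shows "coatoms L = level L (rank L \<top> - 1)"
proof -
  have "covers L \<top> x \<longleftrightarrow> x \<in> carrier L \<and> rank L x = rank L \<top> - 1" for x
    using covers_iff_rank[of x "\<top>"] assms by (cases "x \<in> carrier L") (auto simp: covers_iff)
  then show ?thesis
    by (auto simp: coatoms_def level_def)
qed

lemma level_0: "level L 0 = {\<bottom>}"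
  by (auto simp: level_def rank_eq_0_iff)

lemma level_top: "level L (rank L \<top>) = {\<top>}"
  by (auto simp: level_def rank_eq_top_iff)

lemma level_above_top: "rank L \<top> < k \<Longrightarrow> level L k = {}"
  using rank_le_top by (force simp: level_def)

lemma finite_level [simp]: "finite (level L k)"
  by (simp add: level_def)

lemma rank_top_ge_3:
  assumes "y \<in> carrier L" "z \<in> carrier L" "\<bottom> \<noteq> y" "y \<sqsubseteq> z" "y \<noteq> z" "z \<noteq> \<top>"
  shows "3 \<le> rank L \<top>"
  using rank_less[of "\<bottom>" y] rank_less[of y z] rank_less[of z "\<top>"] assms by simp

lemma length_ge_3:
  assumes "3 \<le> rank L \<top>"
  shows "3 \<le> lattice_length L"
proof -
  obtain z where z: "z \<in> carrier L" "rank L z = 2"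
    using ex_between[of "\<bottom>" "\<top>" 2] assms by auto
  obtain y where y: "y \<in> carrier L" "y \<sqsubseteq> z" "rank L y = 1"
    using ex_between[of "\<bottom>" z 1] z by auto
  have "\<bottom> \<noteq> y" "y \<noteq> z" "z \<noteq> \<top>"
    using y z assms rank_bottom by fastforce+
  then show ?thesis
    using chain_length[of y z] y z by blast
qed

text \<open>Bottom, top, two atoms and two coatoms are six different elements, because the ranks 0,
  1, r - 1 and r differ for r at least 3. This is the lower limit of the summation index.\<close>

lemma card_carrier_ge_6:
  assumes "3 \<le> rank L \<top>" "2 \<le> card (atoms L)" "2 \<le> card (coatoms L)"
  shows "6 \<le> card (carrier L)"
proof -
  have r: "rank L x = 1" if "x \<in> atoms L" for x
    using that by (simp add: atoms_eq_level level_def)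
  have s: "rank L x = rank L \<top> - 1" if "x \<in> coatoms L" for x
    using that assms by (simp add: coatoms_eq_level level_def)
  have "atoms L \<inter> coatoms L = {}"
    using r s assms(1) by force
  moreover have "{\<bottom>, \<top>} \<inter> (atoms L \<union> coatoms L) = {}"
    using r[of "\<bottom>"] s[of "\<bottom>"] r[of "\<top>"] s[of "\<top>"] assms(1) by fastforce
  moreover have "\<bottom> \<noteq> \<top>"
    using assms(1) rank_bottom by fastforce
  ultimately have "card ({\<bottom>, \<top>} \<union> (atoms L \<union> coatoms L)) = 2 + (card (atoms L) + card (coatoms L))"
    by (simp add: card_Un_disjoint)
  moreover have "{\<bottom>, \<top>} \<union> (atoms L \<union> coatoms L) \<subseteq> carrier L"
    by (auto simp: atom_iff coatom_iff)
  ultimately show ?thesis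
    using assms card_mono[OF finite_carrier, of "{\<bottom>, \<top>} \<union> (atoms L \<union> coatoms L)"] by linarith
qed

end

text \<open>Necks are recorded by their ranks, so that the topmost one is a maximum. The bounds
  leave out the singleton levels of bottom and top as well as the levels of the atoms and of the
  coatoms.\<close>

definition necks :: "'a gorder \<Rightarrow> nat set" where
  "necks S = {k. 2 \<le> k \<and> k + 2 \<le> rank S \<top>\<^bsub>S\<^esub> \<and> card (level S k) = 2}"

definition cut :: "'a gorder \<Rightarrow> nat" where
  "cut S = Max (necks S)"

context graded_lattice
begin

text \<open>The excluded ranks are 0, 1, r - 1, r and everything above r: these levels are
  singletons, the atoms, the coatoms or empty. Conversely, an element of level k cannot lie in a
  level of another rank, which separates a neck from the atoms and coatoms.\<close>

lemma ex_neck_iff: "(\<exists>N. is_neck L N) \<longleftrightarrow> necks L \<noteq> {}"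
proof
  assume "\<exists>N. is_neck L N"
  then obtain k where k: "card (level L k) = 2" "level L k \<noteq> atoms L" "level L k \<noteq> coatoms L"
    by (auto simp: is_neck_def)
  have "k \<noteq> 0" "k \<noteq> rank L \<top>"
    using k level_0 level_top by auto
  moreover have "k \<le> rank L \<top>"
    using k level_above_top[of k] by fastforce
  moreover have "k \<noteq> 1"
    using k atoms_eq_level by auto
  moreover have "k \<noteq> rank L \<top> - 1"
    using k coatoms_eq_level calculation by auto
  ultimately have "k \<in> necks L"
    using k by (auto simp: necks_def)
  then show "necks L \<noteq> {}" by auto
next
  assume "necks L \<noteq> {}"
  then obtain k where k: "2 \<le> k" "k + 2 \<le> rank L \<top>" "card (level L k) = 2"
    by (auto simp: necks_def)
  then obtain x where "x \<in> level L k"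
    by fastforce
  then have "level L k \<noteq> atoms L" "level L k \<noteq> coatoms L"
    using k atoms_eq_level coatoms_eq_level by (auto simp: level_def)
  then show "\<exists>N. is_neck L N"
    using k by (auto simp: is_neck_def)
qed

lemma finite_necks [simp]: "finite (necks L)"
  by (rule finite_subset[of _ "{..rank L \<top>}"]) (auto simp: necks_def)

end

section \<open>Isomorphisms\<close>

lemma order_iso_le: "order_iso L M f \<Longrightarrow> x \<in> carrier L \<Longrightarrow> y \<in> carrier L \<Longrightarrow> f x \<sqsubseteq>\<^bsub>M\<^esub> f y \<longleftrightarrow> x \<sqsubseteq>\<^bsub>L\<^esub> y"
  by (simp add: order_iso_def order_emb_def)

lemma order_iso_bij: "order_iso L M f \<Longrightarrow> bij_betw f (carrier L) (carrier M)"
  by (simp add: order_iso_def)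

lemma order_iso_closed: "order_iso L M f \<Longrightarrow> x \<in> carrier L \<Longrightarrow> f x \<in> carrier M"
  using bij_betwE[OF order_iso_bij] by blast

lemma order_iso_eq_iff:
  "order_iso L M f \<Longrightarrow> x \<in> carrier L \<Longrightarrow> y \<in> carrier L \<Longrightarrow> f x = f y \<longleftrightarrow> x = y"
  using inj_on_eq_iff[OF bij_betw_imp_inj_on[OF order_iso_bij]] .

lemma order_iso_id: "weak_partial_order L \<Longrightarrow> order_iso L L id"
  by (simp add: order_iso_def order_emb_def)

lemma order_iso_weak_partial_order:
  "order_iso L M f \<Longrightarrow> weak_partial_order L" "order_iso L M f \<Longrightarrow> weak_partial_order M"
  unfolding order_iso_def order_emb_def by blast+

lemma order_isoI:
  assumes "weak_partial_order L" "weak_partial_order M" "bij_betw f (carrier L) (carrier M)"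
    "\<And>x y. x \<in> carrier L \<Longrightarrow> y \<in> carrier L \<Longrightarrow> f x \<sqsubseteq>\<^bsub>M\<^esub> f y \<longleftrightarrow> x \<sqsubseteq>\<^bsub>L\<^esub> y"
  shows "order_iso L M f"
  unfolding order_iso_def order_emb_def using assms by blast

lemma order_iso_comp:
  assumes "order_iso L M f" "order_iso M N g"
  shows "order_iso L N (g \<circ> f)"
proof (rule order_isoI)
  show "bij_betw (g \<circ> f) (carrier L) (carrier N)"
    by (rule bij_betw_trans[OF order_iso_bij[OF assms(1)] order_iso_bij[OF assms(2)]])
next
  fix x y assume "x \<in> carrier L" "y \<in> carrier L"
  then show "(g \<circ> f) x \<sqsubseteq>\<^bsub>N\<^esub> (g \<circ> f) y \<longleftrightarrow> x \<sqsubseteq>\<^bsub>L\<^esub> y"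
    by (simp add: order_iso_le[OF assms(1)] order_iso_le[OF assms(2)] order_iso_closed[OF assms(1)])
qed (use order_iso_weak_partial_order assms in blast)+

abbreviation iso_inv :: "'a gorder \<Rightarrow> ('a \<Rightarrow> 'b) \<Rightarrow> 'b \<Rightarrow> 'a" where
  "iso_inv L f \<equiv> inv_into (carrier L) f"

lemma iso_inv_left: "order_iso L M f \<Longrightarrow> x \<in> carrier L \<Longrightarrow> iso_inv L f (f x) = x"
  by (rule bij_betw_inv_into_left[OF order_iso_bij])

lemma iso_inv_right: "order_iso L M f \<Longrightarrow> y \<in> carrier M \<Longrightarrow> f (iso_inv L f y) = y"
  by (rule bij_betw_inv_into_right[OF order_iso_bij])

lemma iso_inv_closed: "order_iso L M f \<Longrightarrow> y \<in> carrier M \<Longrightarrow> iso_inv L f y \<in> carrier L"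
  using bij_betwE[OF bij_betw_inv_into[OF order_iso_bij]] by blast

lemma order_iso_inv:
  assumes "order_iso L M f"
  shows "order_iso M L (iso_inv L f)"
proof (rule order_isoI)
  show "bij_betw (iso_inv L f) (carrier M) (carrier L)"
    by (rule bij_betw_inv_into[OF order_iso_bij[OF assms]])
next
  fix x y assume xy: "x \<in> carrier M" "y \<in> carrier M"
  show "iso_inv L f x \<sqsubseteq>\<^bsub>L\<^esub> iso_inv L f y \<longleftrightarrow> x \<sqsubseteq>\<^bsub>M\<^esub> y"
    using order_iso_le[OF assms iso_inv_closed[OF assms xy(1)] iso_inv_closed[OF assms xy(2)]]
    unfolding iso_inv_right[OF assms xy(1)] iso_inv_right[OF assms xy(2)] by (rule sym)
qed (rule order_iso_weak_partial_order[OF assms])+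

lemma isomorphic_refl: "weak_partial_order L \<Longrightarrow> isomorphic L L"
  unfolding isomorphic_def using order_iso_id by blast

lemma isomorphic_sym: "isomorphic L M \<Longrightarrow> isomorphic M L"
  unfolding isomorphic_def using order_iso_inv by blast

lemma isomorphic_trans: "isomorphic L M \<Longrightarrow> isomorphic M N \<Longrightarrow> isomorphic L N"
  unfolding isomorphic_def using order_iso_comp by blast

lemma isomorphic_cong: "isomorphic L M \<Longrightarrow> isomorphic L N \<longleftrightarrow> isomorphic M N"
  by (rule iffI) (erule (1) isomorphic_trans[OF isomorphic_sym], erule (1) isomorphic_trans)

lemma isomorphic_card: "isomorphic L M \<Longrightarrow> card (carrier L) = card (carrier M)"
  unfolding isomorphic_def using order_iso_bij bij_betw_same_card by blast

section \<open>What isomorphisms preserve\<close>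

locale lattice_iso = L: fin_lattice L + M: fin_lattice M
  for L :: "'a gorder" and M :: "'b gorder" +
  fixes f
  assumes iso: "order_iso L M f"
begin

lemmas f_le = order_iso_le[OF iso]
lemmas f_closed = order_iso_closed[OF iso]
lemmas f_eq_iff = order_iso_eq_iff[OF iso]

lemma f_surj: "y \<in> carrier M \<Longrightarrow> \<exists>x\<in>carrier L. y = f x"
  using order_iso_bij[OF iso] by (auto simp: bij_betw_def)

lemma f_bottom: "f \<bottom>\<^bsub>L\<^esub> = \<bottom>\<^bsub>M\<^esub>"
  by (metis M.bottomI L.bottom_closed L.bottom_lower f_closed f_le f_surj)

lemma f_top: "f \<top>\<^bsub>L\<^esub> = \<top>\<^bsub>M\<^esub>"
  by (metis M.topI L.top_closed L.top_higher f_closed f_le f_surj)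

lemma f_covers:
  assumes "x \<in> carrier L" "y \<in> carrier L"
  shows "covers M (f y) (f x) \<longleftrightarrow> covers L y x"
proof -
  have "f ` carrier L = carrier M"
    using order_iso_bij[OF iso] by (simp add: bij_betw_def)
  then have "(\<forall>z\<in>carrier M. P z) \<longleftrightarrow> (\<forall>z\<in>carrier L. P (f z))" for P
    by (metis (no_types, lifting) imageE image_eqI)
  then show ?thesis
    unfolding L.covers_iff M.covers_iff using assms by (simp add: f_le f_eq_iff f_closed)
qed

lemma f_atoms: "atoms M = f ` atoms L"
proof (rule Set.set_eqI)
  fix y
  show "y \<in> atoms M \<longleftrightarrow> y \<in> f ` atoms L"
  proof (cases "y \<in> carrier M")
    case True
    then obtain x where x: "x \<in> carrier L" "y = f x"
      using f_surj by blast
    have "y \<in> atoms M \<longleftrightarrow> x \<in> atoms L"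
      unfolding atoms_def x f_bottom[symmetric] using x(1) by (simp add: f_covers)
    moreover have "f x \<in> f ` atoms L \<longleftrightarrow> x \<in> atoms L"
      using x(1) by (auto simp: image_iff L.atom_iff f_eq_iff)
    ultimately show ?thesis
      using x(2) by simp
  qed (use f_closed in \<open>auto simp: L.atom_iff M.atom_iff\<close>)
qed

lemma f_coatoms: "coatoms M = f ` coatoms L"
proof (rule Set.set_eqI)
  fix y
  show "y \<in> coatoms M \<longleftrightarrow> y \<in> f ` coatoms L"
  proof (cases "y \<in> carrier M")
    case True
    then obtain x where x: "x \<in> carrier L" "y = f x"
      using f_surj by blast
    have "y \<in> coatoms M \<longleftrightarrow> x \<in> coatoms L"
      unfolding coatoms_def x f_top[symmetric] using x(1) by (simp add: f_covers)
    moreover have "f x \<in> f ` coatoms L \<longleftrightarrow> x \<in> coatoms L"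
      using x(1) by (auto simp: image_iff L.coatom_iff f_eq_iff)
    ultimately show ?thesis
      using x(2) by simp
  qed (use f_closed in \<open>auto simp: L.coatom_iff M.coatom_iff\<close>)
qed

lemma f_inj: "A \<subseteq> carrier L \<Longrightarrow> inj_on f A"
  by (meson iso order_iso_bij bij_betw_imp_inj_on inj_on_subset)

lemma card_atoms: "card (atoms M) = card (atoms L)"
  unfolding f_atoms by (intro card_image f_inj) (auto simp: L.atom_iff)

lemma card_coatoms: "card (coatoms M) = card (coatoms L)"
  unfolding f_coatoms by (intro card_image f_inj) (auto simp: L.coatom_iff)

end

lemma lattice_isoI: "fin_lattice L \<Longrightarrow> fin_lattice M \<Longrightarrow> order_iso L M f \<Longrightarrow> lattice_iso L M f"
  by (simp add: lattice_iso_def lattice_iso_axioms_def)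

text \<open>Both parts stay on the type of S and keep its order. So (C2) applies to them, and the
  embeddings into S as well as the matching along level k are identity maps.\<close>

definition low_at :: "'a gorder \<Rightarrow> nat \<Rightarrow> 'a gorder" where
  "low_at S k = S\<lparr>carrier := {x \<in> carrier S. rank S x \<le> k \<or> x = \<top>\<^bsub>S\<^esub>}\<rparr>"

definition up_at :: "'a gorder \<Rightarrow> nat \<Rightarrow> 'a gorder" where
  "up_at S k = S\<lparr>carrier := {x \<in> carrier S. k \<le> rank S x \<or> x = \<bottom>\<^bsub>S\<^esub>}\<rparr>"

abbreviation low :: "'a gorder \<Rightarrow> 'a gorder" where "low S \<equiv> low_at S (cut S)"
abbreviation up :: "'a gorder \<Rightarrow> 'a gorder" where "up S \<equiv> up_at S (cut S)"

lemma low_at_simps [simp]: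
  "carrier (low_at S k) = {x \<in> carrier S. rank S x \<le> k \<or> x = \<top>\<^bsub>S\<^esub>}"
  "le (low_at S k) = le S" "eq (low_at S k) = eq S"
  by (simp_all add: low_at_def)

lemma up_at_simps [simp]:
  "carrier (up_at S k) = {x \<in> carrier S. k \<le> rank S x \<or> x = \<bottom>\<^bsub>S\<^esub>}"
  "le (up_at S k) = le S" "eq (up_at S k) = eq S"
  by (simp_all add: up_at_def)

locale graded_iso = lattice_iso + L: graded_lattice L + M: graded_lattice M
begin

text \<open>Induction along lower covers, which isomorphisms preserve together with the
  bottom.\<close>

lemma f_rank:
  assumes "x \<in> carrier L"
  shows "rank M (f x) = rank L x"
  using assms
proof (induction "rank L x" arbitrary: x rule: less_induct)
  case less
  show ?case
  proof (cases "x = \<bottom>\<^bsub>L\<^esub>")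
    case False
    then obtain z where z: "covers L x z"
      using L.ex_cover_below[of "\<bottom>\<^bsub>L\<^esub>" x] less.prems by auto
    then have "z \<in> carrier L" by (simp add: L.covers_iff)
    then show ?thesis
      using less.hyps[of z] L.rank_covers[OF z] M.rank_covers[of "f x" "f z"] z less.prems
      by (simp add: f_covers)
  qed (simp add: f_bottom)
qed

lemma f_level: "level M k = f ` level L k"
  using f_surj f_closed f_rank by (fastforce simp: level_def)

lemma rank_top: "rank M \<top>\<^bsub>M\<^esub> = rank L \<top>\<^bsub>L\<^esub>"
  by (metis f_top f_rank L.top_closed)

lemma necks_eq: "necks M = necks L"
proof -
  have "card (level M k) = card (level L k)" for k
    unfolding f_level by (intro card_image f_inj) (auto simp: level_def)
  then show ?thesis by (simp add: necks_def rank_top)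
qed

end

section \<open>Automorphisms acting on two atoms or two coatoms\<close>

lemma automorphism_coatoms:
  assumes "fin_lattice L" "automorphism L f" "c \<in> coatoms L"
  shows "f c \<in> coatoms L"
proof -
  interpret lattice_iso L L f using assms by (simp add: lattice_iso_def lattice_iso_axioms_def)
  show ?thesis using f_coatoms assms by blast
qed

lemma automorphism_atoms:
  assumes "fin_lattice L" "automorphism L f" "a \<in> atoms L"
  shows "f a \<in> atoms L"
proof -
  interpret lattice_iso L L f using assms by (simp add: lattice_iso_def lattice_iso_axioms_def)
  show ?thesis using f_atoms assms by blast
qed

text \<open>A permutation of two elements is the transposition or the identity. All later case
  distinctions between symmetric and fixed pairs rest on this dichotomy.\<close>

lemma swaps_or_fixes:
  assumes "card A = 2" "f ` A \<subseteq> A" "inj_on f A"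
  shows "swaps f A \<or> leaves_fixed f A"
proof -
  obtain x y where xy: "A = {x, y}" "x \<noteq> y"
    using assms(1) by (meson card_2_iff)
  have "f x \<noteq> f y" "f x \<in> {x, y}" "f y \<in> {x, y}"
    using assms xy by (auto simp: inj_on_def)
  then show ?thesis
    using xy unfolding swaps_def leaves_fixed_def by auto
qed

lemma swapsI: "card A = 2 \<Longrightarrow> \<forall>x\<in>A. f x \<in> A \<and> f x \<noteq> x \<Longrightarrow> swaps f A"
  by (auto simp: card_2_iff swaps_def)

lemma swapsD: "swaps f A \<Longrightarrow> x \<in> A \<Longrightarrow> y \<in> A \<Longrightarrow> x \<noteq> y \<Longrightarrow> f x = y"
  by (auto simp: swaps_def)

lemma swaps_moves: "swaps f A \<Longrightarrow> x \<in> A \<Longrightarrow> f x \<in> A \<and> f x \<noteq> x"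
  by (auto simp: swaps_def)

lemma swaps_card: "swaps f A \<Longrightarrow> card A = 2"
  by (auto simp: swaps_def)

lemma swaps_comp_fixes: "swaps f A \<Longrightarrow> leaves_fixed g A \<Longrightarrow> swaps (f \<circ> g) A"
  unfolding swaps_def leaves_fixed_def by fastforce

lemma swaps_comp_swaps: "swaps f A \<Longrightarrow> swaps g A \<Longrightarrow> leaves_fixed (f \<circ> g) A"
  unfolding swaps_def leaves_fixed_def by (auto simp: doubleton_eq_iff)

section \<open>Restrictions and gluings\<close>

context fin_lattice
begin

lemma ex_lub:
  assumes "x \<in> carrier L" "y \<in> carrier L"
  shows "\<exists>s\<in>carrier L. x \<sqsubseteq> s \<and> y \<sqsubseteq> s \<and> (\<forall>z\<in>carrier L. x \<sqsubseteq> z \<longrightarrow> y \<sqsubseteq> z \<longrightarrow> s \<sqsubseteq> z)"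
proof -
  obtain s where "least L s (Upper L {x, y})"
    using sup_of_two_exists assms by blast
  then show ?thesis
    using assms by (intro bexI[of _ s]) (auto simp: least_def Upper_def)
qed

lemma ex_glb:
  assumes "x \<in> carrier L" "y \<in> carrier L"
  shows "\<exists>s\<in>carrier L. s \<sqsubseteq> x \<and> s \<sqsubseteq> y \<and> (\<forall>z\<in>carrier L. z \<sqsubseteq> x \<longrightarrow> z \<sqsubseteq> y \<longrightarrow> z \<sqsubseteq> s)"
proof -
  obtain s where "greatest L s (Lower L {x, y})"
    using inf_of_two_exists assms by blast
  then show ?thesis
    using assms by (intro bexI[of _ s]) (auto simp: greatest_def Lower_def)
qed

text \<open>Joins and meets are required within A only and may differ from those of L: in
  \<open>low_at\<close>, for instance, a join of rank above k turns into the top.\<close>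

lemma restrict:
  assumes A: "A \<subseteq> carrier L"
    and b: "b \<in> A" "\<And>x. x \<in> A \<Longrightarrow> b \<sqsubseteq> x"
    and t: "t \<in> A" "\<And>x. x \<in> A \<Longrightarrow> x \<sqsubseteq> t"
    and lub: "\<And>x y. x \<in> A \<Longrightarrow> y \<in> A \<Longrightarrow>
      \<exists>s\<in>A. x \<sqsubseteq> s \<and> y \<sqsubseteq> s \<and> (\<forall>z\<in>A. x \<sqsubseteq> z \<longrightarrow> y \<sqsubseteq> z \<longrightarrow> s \<sqsubseteq> z)"
    and glb: "\<And>x y. x \<in> A \<Longrightarrow> y \<in> A \<Longrightarrow>
      \<exists>s\<in>A. s \<sqsubseteq> x \<and> s \<sqsubseteq> y \<and> (\<forall>z\<in>A. z \<sqsubseteq> x \<longrightarrow> z \<sqsubseteq> y \<longrightarrow> z \<sqsubseteq> s)"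
  shows "fin_lattice (L\<lparr>carrier := A\<rparr>) \<and>
    \<bottom>\<^bsub>L\<lparr>carrier := A\<rparr>\<^esub> = b \<and> \<top>\<^bsub>L\<lparr>carrier := A\<rparr>\<^esub> = t"
proof (intro conjI)
  let ?M = "L\<lparr>carrier := A\<rparr>"
  interpret M: weak_partial_order ?M
    by (rule weak_partial_order_subset) (use A weak_partial_order_axioms in auto)
  show fin: "fin_lattice ?M"
  proof unfold_locales
    show "(.=\<^bsub>?M\<^esub>) = (=)"
      by (simp add: eq_is_equal)
    show "\<exists>s. least ?M s (Upper ?M {x, y})" if "x \<in> carrier ?M" "y \<in> carrier ?M" for x y
      using lub[of x y] that unfolding least_def Upper_def by auto
    show "\<exists>s. greatest ?M s (Lower ?M {x, y})" if "x \<in> carrier ?M" "y \<in> carrier ?M" for x y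
      using glb[of x y] that unfolding greatest_def Lower_def by auto
    show "\<exists>x. least ?M x (carrier ?M)"
      using b by (auto simp: least_def)
    show "\<exists>x. greatest ?M x (carrier ?M)"
      using t by (auto simp: greatest_def)
    show "finite (carrier ?M)"
      using A by (simp add: finite_subset)
  qed
  show "\<bottom>\<^bsub>?M\<^esub> = b"
    using b by (intro fin_lattice.bottomI[OF fin]) auto
  show "\<top>\<^bsub>?M\<^esub> = t"
    using t by (intro fin_lattice.topI[OF fin]) auto
qed

end

text \<open>A criterion for being isomorphic to \<open>glue P Q m\<close> that avoids the transitive
  closure: P and Q are embedded in S and cover it, and each comparison between the two parts passes
  through an identified pair. It serves vertical sums and vertical 2-sums alike.\<close>

locale gluing = P: partial_order P + Q: partial_order Q + S: partial_order S
  for P :: "'a gorder" and Q :: "'b gorder" and S :: "'c gorder" +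
  fixes m :: "'b \<rightharpoonup> 'a" and p :: "'a \<Rightarrow> 'c" and q :: "'b \<Rightarrow> 'c"
  assumes m: "y \<in> carrier Q \<Longrightarrow> m y = Some x \<Longrightarrow> x \<in> carrier P \<and> p x = q y"
    and carrier_S: "carrier S = p ` carrier P \<union> q ` carrier Q"
    and p_le: "x \<in> carrier P \<Longrightarrow> x' \<in> carrier P \<Longrightarrow> p x \<sqsubseteq>\<^bsub>S\<^esub> p x' \<longleftrightarrow> x \<sqsubseteq>\<^bsub>P\<^esub> x'"
    and q_le: "y \<in> carrier Q \<Longrightarrow> y' \<in> carrier Q \<Longrightarrow> q y \<sqsubseteq>\<^bsub>S\<^esub> q y' \<longleftrightarrow> y \<sqsubseteq>\<^bsub>Q\<^esub> y'"
    and pq_le: "x \<in> carrier P \<Longrightarrow> y \<in> carrier Q \<Longrightarrow> p x \<sqsubseteq>\<^bsub>S\<^esub> q y \<Longrightarrow>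
      \<exists>z\<in>carrier Q. \<exists>w. m z = Some w \<and> x \<sqsubseteq>\<^bsub>P\<^esub> w \<and> z \<sqsubseteq>\<^bsub>Q\<^esub> y"
    and qp_le: "x \<in> carrier P \<Longrightarrow> y \<in> carrier Q \<Longrightarrow> q y \<sqsubseteq>\<^bsub>S\<^esub> p x \<Longrightarrow>
      \<exists>z\<in>carrier Q. \<exists>w. m z = Some w \<and> y \<sqsubseteq>\<^bsub>Q\<^esub> z \<and> w \<sqsubseteq>\<^bsub>P\<^esub> x"
begin

definition \<phi> :: "'a + 'b \<Rightarrow> 'c" where "\<phi> = case_sum p q"

lemma \<phi>_Inl [simp]: "\<phi> (Inl x) = p x"
  by (simp add: \<phi>_def)

lemma \<phi>_glue_map: "y \<in> carrier Q \<Longrightarrow> \<phi> (glue_map m y) = q y"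
  by (cases "m y") (auto simp: \<phi>_def glue_map_def m)

definition gen :: "(('a + 'b) \<times> ('a + 'b)) set" where
  "gen = {(Inl x, Inl x') | x x'. x \<in> carrier P \<and> x' \<in> carrier P \<and> x \<sqsubseteq>\<^bsub>P\<^esub> x'} \<union>
    {(glue_map m y, glue_map m y') | y y'. y \<in> carrier Q \<and> y' \<in> carrier Q \<and> y \<sqsubseteq>\<^bsub>Q\<^esub> y'}"

lemma le_glue: "u \<sqsubseteq>\<^bsub>glue P Q m\<^esub> v \<longleftrightarrow> (u, v) \<in> gen\<^sup>+"
  by (simp add: glue_def gen_def)

lemma carrier_glue: "carrier (glue P Q m) = Inl ` carrier P \<union> glue_map m ` carrier Q"
  by (simp add: glue_def)

lemma \<phi>_carrier: "\<phi> ` carrier (glue P Q m) = carrier S"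
  unfolding carrier_glue carrier_S by (simp add: image_Un image_image \<phi>_glue_map)

lemma \<phi>_gen: "(u, v) \<in> gen \<Longrightarrow> \<phi> u \<in> carrier S \<and> \<phi> v \<in> carrier S \<and> \<phi> u \<sqsubseteq>\<^bsub>S\<^esub> \<phi> v"
  unfolding gen_def by (auto simp: \<phi>_glue_map p_le q_le carrier_S)

lemma \<phi>_le:
  assumes "(u, v) \<in> gen\<^sup>+"
  shows "\<phi> u \<in> carrier S \<and> \<phi> v \<in> carrier S \<and> \<phi> u \<sqsubseteq>\<^bsub>S\<^esub> \<phi> v"
  using assms
proof (induction rule: trancl_induct)
  case (step v w)
  then show ?case using \<phi>_gen[of v w] by (auto intro: S.le_trans)
qed (use \<phi>_gen in auto)

text \<open>Each comparison in S is the composite of at most two generating steps, one in each part,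
  that meet in an identified element. The converse is \<open>\<phi>_le\<close>: generators hold in
  S, and S is transitive.\<close>

lemma glue_le_iff:
  assumes "u \<in> carrier (glue P Q m)" "v \<in> carrier (glue P Q m)"
  shows "u \<sqsubseteq>\<^bsub>glue P Q m\<^esub> v \<longleftrightarrow> \<phi> u \<sqsubseteq>\<^bsub>S\<^esub> \<phi> v"
proof
  assume le: "\<phi> u \<sqsubseteq>\<^bsub>S\<^esub> \<phi> v"
  have genP: "(Inl x, Inl x') \<in> gen" if "x \<in> carrier P" "x' \<in> carrier P" "x \<sqsubseteq>\<^bsub>P\<^esub> x'" for x x'
    using that by (auto simp: gen_def)
  have genQ: "(glue_map m y, glue_map m y') \<in> gen" if "y \<in> carrier Q" "y' \<in> carrier Q" "y \<sqsubseteq>\<^bsub>Q\<^esub> y'" for y y'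
    using that by (auto simp: gen_def)
  have gm: "glue_map m z = Inl w" if "m z = Some w" for z w
    using that by (simp add: glue_map_def)
  from assms consider
    (PP) x x' where "u = Inl x" "v = Inl x'" "x \<in> carrier P" "x' \<in> carrier P"
    | (PQ) x y where "u = Inl x" "v = glue_map m y" "x \<in> carrier P" "y \<in> carrier Q"
    | (QP) x y where "u = glue_map m y" "v = Inl x" "x \<in> carrier P" "y \<in> carrier Q"
    | (QQ) y y' where "u = glue_map m y" "v = glue_map m y'" "y \<in> carrier Q" "y' \<in> carrier Q"
    unfolding carrier_glue by blast
  then have "(u, v) \<in> gen\<^sup>+"
  proof cases
    case PP
    then show ?thesis using le genP p_le by auto
  next
    case QQ
    then show ?thesis using le genQ q_le by (auto simp: \<phi>_glue_map)
  next
    case PQ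
    then obtain z w where "z \<in> carrier Q" "m z = Some w" "x \<sqsubseteq>\<^bsub>P\<^esub> w" "z \<sqsubseteq>\<^bsub>Q\<^esub> y"
      using le pq_le[of x y] by (auto simp: \<phi>_glue_map)
    then show ?thesis
      using PQ genP[of x w] genQ[of z y] gm[of z w] m[of z w] trancl_into_trancl[of u "Inl w"] by auto
  next
    case QP
    then obtain z w where "z \<in> carrier Q" "m z = Some w" "y \<sqsubseteq>\<^bsub>Q\<^esub> z" "w \<sqsubseteq>\<^bsub>P\<^esub> x"
      using le qp_le[of x y] by (auto simp: \<phi>_glue_map)
    then show ?thesis
      using QP genP[of w x] genQ[of y z] gm[of z w] m[of z w] trancl_into_trancl[of u "Inl w"] by auto
  qed
  then show "u \<sqsubseteq>\<^bsub>glue P Q m\<^esub> v" by (simp add: le_glue)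
qed (simp add: le_glue \<phi>_le)

text \<open>Read as two opposite comparisons, the equation passes through two identified pairs;
  these squeeze x and y from both sides, and antisymmetry makes them coincide with (y, x). Hence
  nothing is identified in S beyond what \<open>m\<close> prescribes, and \<open>\<phi>\<close> is
  injective.\<close>

lemma p_eq_q:
  assumes x: "x \<in> carrier P" and y: "y \<in> carrier Q" and eq: "p x = q y"
  shows "m y = Some x"
proof -
  have "p x \<in> carrier S" using x carrier_S by blast
  then have "p x \<sqsubseteq>\<^bsub>S\<^esub> q y" "q y \<sqsubseteq>\<^bsub>S\<^esub> p x"
    unfolding eq[symmetric] by auto
  then obtain z w z' w' where
    z: "z \<in> carrier Q" "m z = Some w" "x \<sqsubseteq>\<^bsub>P\<^esub> w" "z \<sqsubseteq>\<^bsub>Q\<^esub> y" and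
    z': "z' \<in> carrier Q" "m z' = Some w'" "y \<sqsubseteq>\<^bsub>Q\<^esub> z'" "w' \<sqsubseteq>\<^bsub>P\<^esub> x"
    using pq_le[OF x y] qp_le[OF x y] by blast
  note w = m[OF z(1,2)] m[OF z'(1,2)]
  have "z \<sqsubseteq>\<^bsub>Q\<^esub> z'" using z z' y Q.le_trans by blast
  then have "w \<sqsubseteq>\<^bsub>P\<^esub> w'" using w z z' q_le p_le by metis
  then have "w \<sqsubseteq>\<^bsub>P\<^esub> x" "x \<sqsubseteq>\<^bsub>P\<^esub> w'" using w z z' x P.le_trans by blast+
  then have "x = w" "x = w'" using w z z' x P.le_antisym by blast+
  then have "q z = q z'" using w by simp
  then have "z' \<sqsubseteq>\<^bsub>Q\<^esub> z"
    using q_le[of z' z] z(1) z'(1) carrier_S S.le_refl[of "q z"] by auto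
  then have "y \<sqsubseteq>\<^bsub>Q\<^esub> z" using z z' y Q.le_trans by blast
  then have "y = z" using z y Q.le_antisym by blast
  then show ?thesis using z \<open>x = w\<close> by simp
qed

lemma p_inj: "inj_on p (carrier P)"
proof (rule inj_onI)
  fix x x' assume x: "x \<in> carrier P" "x' \<in> carrier P" "p x = p x'"
  then have "p x \<in> carrier S" using carrier_S by blast
  then show "x = x'"
    using x p_le[of x x'] p_le[of x' x] P.le_antisym[of x x'] by simp
qed

lemma q_inj: "inj_on q (carrier Q)"
proof (rule inj_onI)
  fix x x' assume x: "x \<in> carrier Q" "x' \<in> carrier Q" "q x = q x'"
  then have "q x \<in> carrier S" using carrier_S by blast
  then show "x = x'"
    using x q_le[of x x'] q_le[of x' x] Q.le_antisym[of x x'] by simp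
qed

lemma \<phi>_inj: "inj_on \<phi> (carrier (glue P Q m))"
proof (rule inj_onI)
  fix u v assume uv: "u \<in> carrier (glue P Q m)" "v \<in> carrier (glue P Q m)" "\<phi> u = \<phi> v"
  have mixed: "glue_map m y = Inl x" if "x \<in> carrier P" "y \<in> carrier Q" "p x = q y" for x y
    using p_eq_q[OF that] by (simp add: glue_map_def)
  from uv show "u = v"
    unfolding carrier_glue using p_inj q_inj mixed
    by (auto simp: \<phi>_glue_map inj_on_eq_iff)
qed

lemma isomorphic_glue: "isomorphic S (glue P Q m)"
proof -
  have closed: "\<phi> u \<in> carrier S" if "u \<in> carrier (glue P Q m)" for u
    using that \<phi>_carrier by blast
  have "weak_partial_order (glue P Q m)"
  proof unfold_locales
    fix u v assume uv: "u \<sqsubseteq>\<^bsub>glue P Q m\<^esub> v" "v \<sqsubseteq>\<^bsub>glue P Q m\<^esub> u"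
      "u \<in> carrier (glue P Q m)" "v \<in> carrier (glue P Q m)"
    then have "\<phi> u = \<phi> v"
      by (simp add: glue_le_iff S.le_antisym closed)
    then have "u = v"
      using \<phi>_inj uv by (simp add: inj_on_eq_iff)
    then show "u .=\<^bsub>glue P Q m\<^esub> v" by (simp add: glue_def)
  next
    fix u v w
    assume "u \<sqsubseteq>\<^bsub>glue P Q m\<^esub> v" "v \<sqsubseteq>\<^bsub>glue P Q m\<^esub> w"
    then show "u \<sqsubseteq>\<^bsub>glue P Q m\<^esub> w"
      by (simp add: le_glue)
  next
    fix u assume "u \<in> carrier (glue P Q m)"
    then show "u \<sqsubseteq>\<^bsub>glue P Q m\<^esub> u"
      by (simp add: glue_le_iff closed)
  qed (auto simp: glue_def)
  then have "order_iso (glue P Q m) S \<phi>"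
    using \<phi>_inj \<phi>_carrier glue_le_iff
    by (intro order_isoI) (auto simp: bij_betw_def S.weak_partial_order_axioms)
  then show ?thesis
    using isomorphic_def isomorphic_sym by blast
qed

end

text \<open>L is the vertical sum of the ideal below e and the filter above e, which together
  exhaust L by comparability. Both have at least two elements since e is neither bottom nor
  top.\<close>

lemma (in fin_lattice) not_vi_lattice:
  assumes e: "e \<in> carrier L" "e \<noteq> \<bottom>" "e \<noteq> \<top>"
    and comparable: "\<And>x. x \<in> carrier L \<Longrightarrow> x \<sqsubseteq> e \<or> e \<sqsubseteq> x"
  shows "\<not> vi_lattice L"
proof -
  define A where "A = {x \<in> carrier L. x \<sqsubseteq> e}"
  define B where "B = {x \<in> carrier L. e \<sqsubseteq> x}"
  let ?A = "L\<lparr>carrier := A\<rparr>" and ?B = "L\<lparr>carrier := B\<rparr>"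
  have A: "fin_lattice ?A \<and> \<bottom>\<^bsub>?A\<^esub> = \<bottom> \<and> \<top>\<^bsub>?A\<^esub> = e"
  proof (rule restrict[where b = "\<bottom>" and t = e])
    fix x y assume xy: "x \<in> A" "y \<in> A"
    then have c: "x \<in> carrier L" "y \<in> carrier L" by (auto simp: A_def)
    obtain s where s: "s \<in> carrier L" "x \<sqsubseteq> s" "y \<sqsubseteq> s"
      "\<forall>z\<in>carrier L. x \<sqsubseteq> z \<longrightarrow> y \<sqsubseteq> z \<longrightarrow> s \<sqsubseteq> z"
      using ex_lub[OF c] by blast
    then have "s \<in> A" using xy e by (auto simp: A_def)
    then show "\<exists>s\<in>A. x \<sqsubseteq> s \<and> y \<sqsubseteq> s \<and> (\<forall>z\<in>A. x \<sqsubseteq> z \<longrightarrow> y \<sqsubseteq> z \<longrightarrow> s \<sqsubseteq> z)"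
      using s by (auto simp: A_def)
    obtain t where t: "t \<in> carrier L" "t \<sqsubseteq> x" "t \<sqsubseteq> y"
      "\<forall>z\<in>carrier L. z \<sqsubseteq> x \<longrightarrow> z \<sqsubseteq> y \<longrightarrow> z \<sqsubseteq> t"
      using ex_glb[OF c] by blast
    then have "t \<in> A" using xy c e by (auto simp: A_def intro: le_trans)
    then show "\<exists>s\<in>A. s \<sqsubseteq> x \<and> s \<sqsubseteq> y \<and> (\<forall>z\<in>A. z \<sqsubseteq> x \<longrightarrow> z \<sqsubseteq> y \<longrightarrow> z \<sqsubseteq> s)"
      using t by (auto simp: A_def)
  qed (use e in \<open>auto simp: A_def\<close>)
  have B: "fin_lattice ?B \<and> \<bottom>\<^bsub>?B\<^esub> = e \<and> \<top>\<^bsub>?B\<^esub> = \<top>"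
  proof (rule restrict[where b = e and t = "\<top>"])
    fix x y assume xy: "x \<in> B" "y \<in> B"
    then have c: "x \<in> carrier L" "y \<in> carrier L" by (auto simp: B_def)
    obtain s where s: "s \<in> carrier L" "x \<sqsubseteq> s" "y \<sqsubseteq> s"
      "\<forall>z\<in>carrier L. x \<sqsubseteq> z \<longrightarrow> y \<sqsubseteq> z \<longrightarrow> s \<sqsubseteq> z"
      using ex_lub[OF c] by blast
    then have "s \<in> B" using xy c e by (auto simp: B_def intro: le_trans)
    then show "\<exists>s\<in>B. x \<sqsubseteq> s \<and> y \<sqsubseteq> s \<and> (\<forall>z\<in>B. x \<sqsubseteq> z \<longrightarrow> y \<sqsubseteq> z \<longrightarrow> s \<sqsubseteq> z)"
      using s by (auto simp: B_def)
    obtain t where t: "t \<in> carrier L" "t \<sqsubseteq> x" "t \<sqsubseteq> y"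
      "\<forall>z\<in>carrier L. z \<sqsubseteq> x \<longrightarrow> z \<sqsubseteq> y \<longrightarrow> z \<sqsubseteq> t"
      using ex_glb[OF c] by blast
    then have "t \<in> B" using xy e by (auto simp: B_def)
    then show "\<exists>s\<in>B. s \<sqsubseteq> x \<and> s \<sqsubseteq> y \<and> (\<forall>z\<in>B. z \<sqsubseteq> x \<longrightarrow> z \<sqsubseteq> y \<longrightarrow> z \<sqsubseteq> s)"
      using t by (auto simp: B_def)
  qed (use e in \<open>auto simp: B_def\<close>)
  interpret A: fin_lattice ?A using A by blast
  interpret B: fin_lattice ?B using B by blast
  interpret gluing ?A ?B L "[e \<mapsto> e]" id id
  proof unfold_locales
    show "carrier L = id ` carrier ?A \<union> id ` carrier ?B"
      using comparable by (auto simp: A_def B_def)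
  next
    fix x y assume "x \<in> carrier ?A" "y \<in> carrier ?B"
    then have "x \<sqsubseteq> e" "e \<sqsubseteq> y" "e \<in> B" "x \<in> carrier L" "y \<in> carrier L"
      using e by (auto simp: A_def B_def)
    then show "\<exists>z\<in>carrier ?B. \<exists>w. [e \<mapsto> e] z = Some w \<and> x \<sqsubseteq>\<^bsub>?A\<^esub> w \<and> z \<sqsubseteq>\<^bsub>?B\<^esub> y"
      "id y \<sqsubseteq> id x \<Longrightarrow> \<exists>z\<in>carrier ?B. \<exists>w. [e \<mapsto> e] z = Some w \<and> y \<sqsubseteq>\<^bsub>?B\<^esub> z \<and> w \<sqsubseteq>\<^bsub>?A\<^esub> x"
      using e by (auto intro: le_trans)
  qed (use e in \<open>auto simp: A_def split: if_splits\<close>)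
  have "is_vertical_sum L ?A ?B"
    using A B partial_order_axioms isomorphic_glue by (simp add: is_vertical_sum_def finite_lattice_iff)
  moreover have "{\<bottom>, e} \<subseteq> carrier ?A" "{e, \<top>} \<subseteq> carrier ?B"
    using e by (auto simp: A_def B_def)
  then have "card {\<bottom>, e} \<le> card (carrier ?A)" "card {e, \<top>} \<le> card (carrier ?B)"
    using card_mono[OF A.finite_carrier] card_mono[OF B.finite_carrier] by blast+
  then have "card (carrier ?A) \<noteq> 1" "card (carrier ?B) \<noteq> 1"
    using e by auto
  ultimately show ?thesis
    unfolding vi_lattice_def by blast
qed

section \<open>Vi-lattices have at least two atoms and two coatoms\<close>

lemma graded_vi_lattice_graded_lattice: "graded_vi_lattice L \<Longrightarrow> graded_lattice L"
  by (simp add: graded_vi_lattice_def vi_lattice_def finite_lattice_iff graded_lattice_def graded_lattice_axioms_def)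

context graded_lattice
begin

text \<open>Every element other than the bottom lies above an atom, so a sole atom would be
  comparable with everything; the rank bound keeps it different from the top, and the lattice would
  split there as a vertical sum.\<close>

lemma vi_card_atoms:
  assumes "vi_lattice L" "2 \<le> rank L \<top>"
  shows "2 \<le> card (atoms L)"
proof (rule ccontr)
  assume "\<not> 2 \<le> card (atoms L)"
  moreover have "\<top> \<noteq> \<bottom>" using assms(2) by auto
  then obtain a where a: "a \<in> atoms L"
    using ex_atom_below[of "\<top>"] by auto
  then have "card (atoms L) \<noteq> 0"
    by auto
  ultimately have "card (atoms L) = 1"
    by linarith
  then have eq: "atoms L = {a}"
    using a by (auto simp: card_1_singleton_iff)
  have "rank L a = 1" using a by (simp add: atoms_eq_level level_def)
  then have "a \<noteq> \<top>" using assms(2) by auto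
  moreover have "x \<sqsubseteq> a \<or> a \<sqsubseteq> x" if "x \<in> carrier L" for x
  proof (cases "x = \<bottom>")
    case False
    then obtain b where "b \<in> atoms L" "b \<sqsubseteq> x"
      using ex_atom_below[of x] \<open>x \<in> carrier L\<close> by auto
    then show ?thesis using eq by simp
  qed (use a in \<open>auto simp: atom_iff\<close>)
  ultimately show False
    using not_vi_lattice[of a] assms a by (simp add: atom_iff)
qed

lemma vi_card_coatoms:
  assumes "vi_lattice L" "2 \<le> rank L \<top>"
  shows "2 \<le> card (coatoms L)"
proof (rule ccontr)
  assume "\<not> 2 \<le> card (coatoms L)"
  moreover have ne: "\<bottom> \<noteq> \<top>" using assms(2) rank_bottom by fastforce
  then obtain a where a: "a \<in> coatoms L"
    using ex_coatom_above[of "\<bottom>"] by auto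
  then have "card (coatoms L) \<noteq> 0"
    by auto
  ultimately have "card (coatoms L) = 1"
    by linarith
  then have eq: "coatoms L = {a}"
    using a by (auto simp: card_1_singleton_iff)
  have "rank L a = rank L \<top> - 1" using a assms(2) by (simp add: coatoms_eq_level level_def)
  then have "a \<noteq> \<bottom>" using assms(2) by auto
  moreover have "x \<sqsubseteq> a \<or> a \<sqsubseteq> x" if "x \<in> carrier L" for x
  proof (cases "x = \<top>")
    case False
    then obtain b where "b \<in> coatoms L" "x \<sqsubseteq> b"
      using ex_coatom_above[of x] \<open>x \<in> carrier L\<close> by auto
    then show ?thesis using eq by simp
  qed (use a in \<open>auto simp: coatom_iff\<close>)
  ultimately show False
    using not_vi_lattice[of a] assms a by (simp add: coatom_iff)
qed

end

section \<open>Amalgams along coatoms and atoms\<close>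

text \<open>\<open>S\<close> is \<open>L\<close> without top and \<open>U\<close> without bottom, embedded by \<open>p\<close> and \<open>q\<close> and identified along the
  matching \<open>\<mu>\<close>; the order is given explicitly instead of by a transitive closure.\<close>

locale amalgam = L: fin_lattice L + U: fin_lattice U + S: partial_order S
  for L :: "'a gorder" and U :: "'b gorder" and S :: "'c gorder" +
  fixes \<mu> :: "'a \<Rightarrow> 'b" and p :: "'a \<Rightarrow> 'c" and q :: "'b \<Rightarrow> 'c"
  assumes \<mu>: "bij_betw \<mu> (coatoms L) (atoms U)"
    and carrier_S: "carrier S = p ` (carrier L - {\<top>\<^bsub>L\<^esub>}) \<union> q ` (carrier U - {\<bottom>\<^bsub>U\<^esub>})"
    and p_le: "x \<in> carrier L - {\<top>\<^bsub>L\<^esub>} \<Longrightarrow> x' \<in> carrier L - {\<top>\<^bsub>L\<^esub>} \<Longrightarrow> p x \<sqsubseteq>\<^bsub>S\<^esub> p x' \<longleftrightarrow> x \<sqsubseteq>\<^bsub>L\<^esub> x'"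
    and q_le: "y \<in> carrier U - {\<bottom>\<^bsub>U\<^esub>} \<Longrightarrow> y' \<in> carrier U - {\<bottom>\<^bsub>U\<^esub>} \<Longrightarrow> q y \<sqsubseteq>\<^bsub>S\<^esub> q y' \<longleftrightarrow> y \<sqsubseteq>\<^bsub>U\<^esub> y'"
    and pq_le: "x \<in> carrier L - {\<top>\<^bsub>L\<^esub>} \<Longrightarrow> y \<in> carrier U - {\<bottom>\<^bsub>U\<^esub>} \<Longrightarrow>
      p x \<sqsubseteq>\<^bsub>S\<^esub> q y \<longleftrightarrow> (\<exists>c\<in>coatoms L. x \<sqsubseteq>\<^bsub>L\<^esub> c \<and> \<mu> c \<sqsubseteq>\<^bsub>U\<^esub> y)"
    and qp_le: "x \<in> carrier L - {\<top>\<^bsub>L\<^esub>} \<Longrightarrow> y \<in> carrier U - {\<bottom>\<^bsub>U\<^esub>} \<Longrightarrow>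
      q y \<sqsubseteq>\<^bsub>S\<^esub> p x \<longleftrightarrow> x \<in> coatoms L \<and> y = \<mu> x"
begin

lemma p_closed: "x \<in> carrier L - {\<top>\<^bsub>L\<^esub>} \<Longrightarrow> p x \<in> carrier S"
  using carrier_S by blast

lemma q_closed: "y \<in> carrier U - {\<bottom>\<^bsub>U\<^esub>} \<Longrightarrow> q y \<in> carrier S"
  using carrier_S by blast

lemma coatom_closed: "c \<in> coatoms L \<Longrightarrow> c \<in> carrier L - {\<top>\<^bsub>L\<^esub>}"
  by (auto simp: L.coatom_iff)

lemma atom_closed: "a \<in> atoms U \<Longrightarrow> a \<in> carrier U - {\<bottom>\<^bsub>U\<^esub>}"
  by (auto simp: U.atom_iff)

lemma \<mu>_atom: "c \<in> coatoms L \<Longrightarrow> \<mu> c \<in> atoms U"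
  using bij_betwE[OF \<mu>] by blast

lemma atom_\<mu>: "a \<in> atoms U \<Longrightarrow> \<exists>c\<in>coatoms L. a = \<mu> c"
  using bij_betw_imp_surj_on[OF \<mu>] by blast

text \<open>The identification is not assumed as an equation: \<open>pq_le\<close> and
  \<open>qp_le\<close> put the two elements below each other.\<close>

lemma p_coatom: "c \<in> coatoms L \<Longrightarrow> p c = q (\<mu> c)"
proof -
  assume c: "c \<in> coatoms L"
  note cl = coatom_closed[OF c] atom_closed[OF \<mu>_atom[OF c]]
  have "p c \<sqsubseteq>\<^bsub>S\<^esub> q (\<mu> c)"
    using c cl by (auto simp: pq_le intro!: bexI[of _ c])
  moreover have "q (\<mu> c) \<sqsubseteq>\<^bsub>S\<^esub> p c"
    using c cl qp_le by blast
  ultimately show ?thesis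
    using cl p_closed q_closed S.le_antisym by blast
qed

lemma p_eq_iff:
  assumes "x \<in> carrier L - {\<top>\<^bsub>L\<^esub>}" "x' \<in> carrier L - {\<top>\<^bsub>L\<^esub>}"
  shows "p x = p x' \<longleftrightarrow> x = x'"
  using p_le[OF assms] p_le[OF assms(2,1)] S.le_refl[OF p_closed[OF assms(1)]] L.le_antisym[of x x'] assms
  by auto

lemma q_eq_iff:
  assumes "x \<in> carrier U - {\<bottom>\<^bsub>U\<^esub>}" "x' \<in> carrier U - {\<bottom>\<^bsub>U\<^esub>}"
  shows "q x = q x' \<longleftrightarrow> x = x'"
  using q_le[OF assms] q_le[OF assms(2,1)] S.le_refl[OF q_closed[OF assms(1)]] U.le_antisym[of x x'] assms
  by auto

lemma p_eq_q_iff: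
  assumes "x \<in> carrier L - {\<top>\<^bsub>L\<^esub>}" "y \<in> carrier U - {\<bottom>\<^bsub>U\<^esub>}"
  shows "p x = q y \<longleftrightarrow> x \<in> coatoms L \<and> y = \<mu> x"
  using qp_le[OF assms] p_coatom S.le_refl[OF p_closed[OF assms(1)]] by auto

lemma vertical_2sum:
  assumes "card (coatoms L) = 2" "3 \<le> lattice_length L" "3 \<le> lattice_length U"
  shows "is_vertical_2sum S L U"
proof -
  obtain c1 c2 where c: "coatoms L = {c1, c2}" "c1 \<noteq> c2"
    using assms(1) by (meson card_2_iff)
  have a: "atoms U = {\<mu> c1, \<mu> c2}"
    using bij_betw_imp_surj_on[OF \<mu>] c by auto
  have ne: "\<mu> c1 \<noteq> \<mu> c2"
    using \<mu> c by (auto simp: bij_betw_def)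
  \<comment> \<open>The gluing map goes from atoms to coatoms, hence it is the inverse of the
    matching.\<close>
  let ?m = "[\<mu> c1 \<mapsto> c1, \<mu> c2 \<mapsto> c2]"
  have m: "?m z = Some w \<longleftrightarrow> w \<in> coatoms L \<and> z = \<mu> w" for z w
    using c ne by auto
  let ?P = "remove L \<top>\<^bsub>L\<^esub>" and ?Q = "remove U \<bottom>\<^bsub>U\<^esub>"
  have simps: "carrier ?P = carrier L - {\<top>\<^bsub>L\<^esub>}" "le ?P = le L" "eq ?P = (=)"
    "carrier ?Q = carrier U - {\<bottom>\<^bsub>U\<^esub>}" "le ?Q = le U" "eq ?Q = (=)"
    by (simp_all add: remove_def L.eq_is_equal U.eq_is_equal)
  have po: "weak_partial_order ?P" "weak_partial_order ?Q"
    unfolding remove_def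
    by (rule weak_partial_order_subset; blast intro: L.weak_partial_order_axioms U.weak_partial_order_axioms)+
  interpret gluing ?P ?Q S ?m p q
  proof (intro gluing.intro gluing_axioms.intro, unfold simps)
    show "partial_order ?P" "partial_order ?Q"
      using po by (auto intro!: partial_order.intro partial_order_axioms.intro simp: simps)
    show "partial_order S" by (rule S.partial_order_axioms)
    show "carrier S = p ` (carrier L - {\<top>\<^bsub>L\<^esub>}) \<union> q ` (carrier U - {\<bottom>\<^bsub>U\<^esub>})"
      by (rule carrier_S)
    show "x \<in> carrier L - {\<top>\<^bsub>L\<^esub>} \<and> p x = q y" if "?m y = Some x" for x y
      using that unfolding m using coatom_closed p_coatom by blast
    show "\<exists>z\<in>carrier U - {\<bottom>\<^bsub>U\<^esub>}. \<exists>w. ?m z = Some w \<and> x \<sqsubseteq>\<^bsub>L\<^esub> w \<and> z \<sqsubseteq>\<^bsub>U\<^esub> y"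
      if "x \<in> carrier L - {\<top>\<^bsub>L\<^esub>}" "y \<in> carrier U - {\<bottom>\<^bsub>U\<^esub>}" "p x \<sqsubseteq>\<^bsub>S\<^esub> q y" for x y
    proof -
      obtain w where "w \<in> coatoms L" "x \<sqsubseteq>\<^bsub>L\<^esub> w" "\<mu> w \<sqsubseteq>\<^bsub>U\<^esub> y"
        using pq_le[OF \<open>x \<in> _\<close> \<open>y \<in> _\<close>] \<open>p x \<sqsubseteq>\<^bsub>S\<^esub> q y\<close> by blast
      then show ?thesis
        unfolding m using atom_closed[OF \<mu>_atom, of w] by blast
    qed
    show "\<exists>z\<in>carrier U - {\<bottom>\<^bsub>U\<^esub>}. \<exists>w. ?m z = Some w \<and> y \<sqsubseteq>\<^bsub>U\<^esub> z \<and> w \<sqsubseteq>\<^bsub>L\<^esub> x"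
      if "x \<in> carrier L - {\<top>\<^bsub>L\<^esub>}" "y \<in> carrier U - {\<bottom>\<^bsub>U\<^esub>}" "q y \<sqsubseteq>\<^bsub>S\<^esub> p x" for x y
      unfolding m using that qp_le[OF that(1,2)] by (intro bexI[of _ y] exI[of _ x]) auto
  qed (use p_le q_le in blast)+
  show ?thesis
    unfolding is_vertical_2sum_def finite_lattice_iff
    using S.partial_order_axioms L.fin_lattice_axioms U.fin_lattice_axioms assms c a ne isomorphic_glue
    by blast
qed

end

text \<open>Gradedness is assumed for S as well, because in the application it comes from membership
  in the family. The rank bounds make bottom, coatoms and top of L three different ranks, and
  likewise bottom, atoms and top of U, unless coatoms and atoms of the same lattice
  coincide.\<close>

locale graded_amalgam = amalgam + L: graded_lattice L + U: graded_lattice U + S: graded_lattice S +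
  assumes rank_L: "2 \<le> rank L \<top>\<^bsub>L\<^esub>" and rank_U: "2 \<le> rank U \<top>\<^bsub>U\<^esub>"
begin

text \<open>The rank in S of the identified elements. It depends on L alone, so two amalgams of the
  same L and U share it.\<close>

definition k where "k = rank L \<top>\<^bsub>L\<^esub> - 1"

lemma bottom_L: "\<bottom>\<^bsub>L\<^esub> \<in> carrier L - {\<top>\<^bsub>L\<^esub>}"
  using rank_L L.rank_bottom L.bottom_closed by force

lemma top_U: "\<top>\<^bsub>U\<^esub> \<in> carrier U - {\<bottom>\<^bsub>U\<^esub>}"
  using rank_U U.rank_bottom U.top_closed by force

lemma rank_coatom: "c \<in> coatoms L \<Longrightarrow> rank L c = k"
  using rank_L by (simp add: L.coatoms_eq_level level_def k_def)

lemma coatom_of_rank: "x \<in> carrier L \<Longrightarrow> rank L x = k \<Longrightarrow> x \<in> coatoms L"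
  using rank_L by (simp add: L.coatoms_eq_level level_def k_def)

lemma atom_of_rank: "x \<in> carrier U \<Longrightarrow> rank U x = 1 \<Longrightarrow> x \<in> atoms U"
  by (simp add: U.atoms_eq_level level_def)

lemma p_bottom: "\<bottom>\<^bsub>S\<^esub> = p \<bottom>\<^bsub>L\<^esub>"
proof (rule S.bottomI)
  fix z assume "z \<in> carrier S"
  then consider x where "x \<in> carrier L - {\<top>\<^bsub>L\<^esub>}" "z = p x" | y where "y \<in> carrier U - {\<bottom>\<^bsub>U\<^esub>}" "z = q y"
    using carrier_S by blast
  then show "p \<bottom>\<^bsub>L\<^esub> \<sqsubseteq>\<^bsub>S\<^esub> z"
  proof cases
    case 1
    then show ?thesis using bottom_L by (simp add: p_le)
  next
    case 2
    then obtain a where "a \<in> atoms U" "a \<sqsubseteq>\<^bsub>U\<^esub> y"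
      using U.ex_atom_below[of y] by auto
    then show ?thesis
      using 2 pq_le[OF bottom_L, of y] atom_\<mu>[of a] coatom_closed by fastforce
  qed
qed (rule p_closed[OF bottom_L])

lemma q_top: "\<top>\<^bsub>S\<^esub> = q \<top>\<^bsub>U\<^esub>"
proof (rule S.topI)
  fix z assume "z \<in> carrier S"
  then consider x where "x \<in> carrier L - {\<top>\<^bsub>L\<^esub>}" "z = p x" | y where "y \<in> carrier U - {\<bottom>\<^bsub>U\<^esub>}" "z = q y"
    using carrier_S by blast
  then show "z \<sqsubseteq>\<^bsub>S\<^esub> q \<top>\<^bsub>U\<^esub>"
  proof cases
    case 2
    then show ?thesis using top_U by (simp add: q_le)
  next
    case 1
    then obtain c where "c \<in> coatoms L" "x \<sqsubseteq>\<^bsub>L\<^esub> c"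
      using L.ex_coatom_above[of x] by auto
    then show ?thesis
      using 1 pq_le[OF _ top_U, of x] \<mu>_atom[of c] atom_closed by fastforce
  qed
qed (rule q_closed[OF top_U])

text \<open>An element of the upper part below \<open>p x'\<close> is by \<open>qp_le\<close>
  identified with x' and hence equal to \<open>p x'\<close>, so U contributes nothing strictly in
  between. Covers in U survive in S for the dual reason.\<close>

lemma p_covers:
  assumes "covers L x' x" "x' \<noteq> \<top>\<^bsub>L\<^esub>"
  shows "covers S (p x') (p x)"
proof -
  have x: "x \<in> carrier L - {\<top>\<^bsub>L\<^esub>}" "x' \<in> carrier L - {\<top>\<^bsub>L\<^esub>}" "x \<sqsubseteq>\<^bsub>L\<^esub> x'" "x \<noteq> x'"
    and between: "\<And>z. z \<in> carrier L \<Longrightarrow> x \<sqsubseteq>\<^bsub>L\<^esub> z \<Longrightarrow> z \<sqsubseteq>\<^bsub>L\<^esub> x' \<Longrightarrow> z = x \<or> z = x'"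
    using assms by (auto simp: L.covers_iff L.top_unique)
  have "z = p x \<or> z = p x'" if z: "z \<in> carrier S" "p x \<sqsubseteq>\<^bsub>S\<^esub> z" "z \<sqsubseteq>\<^bsub>S\<^esub> p x'" for z
  proof -
    from z(1) consider w where "w \<in> carrier L - {\<top>\<^bsub>L\<^esub>}" "z = p w"
      | y where "y \<in> carrier U - {\<bottom>\<^bsub>U\<^esub>}" "z = q y"
      using carrier_S by blast
    then show ?thesis
    proof cases
      case 1
      then show ?thesis using z x between[of w] by (auto simp: p_le)
    next
      case 2
      then show ?thesis using z qp_le[OF x(2), of y] p_coatom by auto
    qed
  qed
  then show ?thesis
    using x by (simp add: S.covers_iff p_closed p_le p_eq_iff)
qed

lemma q_covers:
  assumes "covers U x' x" "x \<noteq> \<bottom>\<^bsub>U\<^esub>"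
  shows "covers S (q x') (q x)"
proof -
  have x: "x \<in> carrier U - {\<bottom>\<^bsub>U\<^esub>}" "x' \<in> carrier U - {\<bottom>\<^bsub>U\<^esub>}" "x \<sqsubseteq>\<^bsub>U\<^esub> x'" "x \<noteq> x'"
    and between: "\<And>z. z \<in> carrier U \<Longrightarrow> x \<sqsubseteq>\<^bsub>U\<^esub> z \<Longrightarrow> z \<sqsubseteq>\<^bsub>U\<^esub> x' \<Longrightarrow> z = x \<or> z = x'"
    using assms by (auto simp: U.covers_iff U.bottom_unique)
  have "z = q x \<or> z = q x'" if z: "z \<in> carrier S" "q x \<sqsubseteq>\<^bsub>S\<^esub> z" "z \<sqsubseteq>\<^bsub>S\<^esub> q x'" for z
  proof -
    from z(1) consider w where "w \<in> carrier L - {\<top>\<^bsub>L\<^esub>}" "z = p w"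
      | y where "y \<in> carrier U - {\<bottom>\<^bsub>U\<^esub>}" "z = q y"
      using carrier_S by blast
    then show ?thesis
    proof cases
      case 1
      then show ?thesis using z qp_le[of w x] x p_coatom by auto
    next
      case 2
      then show ?thesis using z x between[of y] by (auto simp: q_le)
    qed
  qed
  then show ?thesis
    using x by (simp add: S.covers_iff q_closed q_le q_eq_iff)
qed

lemma rank_p:
  assumes "x \<in> carrier L - {\<top>\<^bsub>L\<^esub>}"
  shows "rank S (p x) = rank L x"
  using assms
proof (induction "rank L x" arbitrary: x rule: less_induct)
  case less
  show ?case
  proof (cases "x = \<bottom>\<^bsub>L\<^esub>")
    case False
    then obtain z where z: "covers L x z"
      using L.ex_cover_below[of "\<bottom>\<^bsub>L\<^esub>" x] less.prems by auto
    then have "z \<in> carrier L - {\<top>\<^bsub>L\<^esub>}"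
      using less.prems L.top_unique by (auto simp: L.covers_iff)
    then show ?thesis
      using less.hyps[of z] L.rank_covers[OF z] S.rank_covers[OF p_covers[OF z]] less.prems
      by simp
  next
    case True
    then show ?thesis using p_bottom S.rank_bottom by simp
  qed
qed

text \<open>Atoms of U have rank 1 in U and rank k in S, so all ranks of U are shifted by k - 1; the
  equation is arranged to avoid subtraction of natural numbers.\<close>

lemma rank_q_Suc:
  assumes "y \<in> carrier U - {\<bottom>\<^bsub>U\<^esub>}"
  shows "rank S (q y) + 1 = rank U y + k"
  using assms
proof (induction "rank U y" arbitrary: y rule: less_induct)
  case less
  obtain z where z: "covers U y z"
    using U.ex_cover_below[of "\<bottom>\<^bsub>U\<^esub>" y] less.prems by auto
  show ?case
  proof (cases "z = \<bottom>\<^bsub>U\<^esub>")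
    case False
    then show ?thesis
      using less.hyps[of z] U.rank_covers[OF z] S.rank_covers[OF q_covers[OF z]] z
      by (simp add: U.covers_iff)
  next
    \<comment> \<open>The induction starts at the atoms of U, whose rank in S is known from the
      coatoms of L that they are identified with.\<close>
    case True
    then have "y \<in> atoms U" using z by (simp add: atoms_def)
    then obtain c where "c \<in> coatoms L" "y = \<mu> c" using atom_\<mu> by blast
    then show ?thesis
      using p_coatom rank_p[OF coatom_closed] rank_coatom U.rank_covers[OF z] True by fastforce
  qed
qed

lemma k_pos: "1 \<le> k"
  using rank_L by (simp add: k_def)

lemma rank_p_le: "x \<in> carrier L - {\<top>\<^bsub>L\<^esub>} \<Longrightarrow> rank L x \<le> k"
  using L.rank_less[of x "\<top>\<^bsub>L\<^esub>"] rank_L unfolding k_def by fastforce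

lemma rank_U_pos: "y \<in> carrier U - {\<bottom>\<^bsub>U\<^esub>} \<Longrightarrow> 1 \<le> rank U y"
  using U.rank_eq_0_iff[of y] by auto

lemma rank_top_S: "rank S \<top>\<^bsub>S\<^esub> + 1 = rank U \<top>\<^bsub>U\<^esub> + k"
  unfolding q_top by (rule rank_q_Suc[OF top_U])

lemma level_U: "1 \<le> j \<Longrightarrow> level U j \<subseteq> carrier U - {\<bottom>\<^bsub>U\<^esub>}"
  by (auto simp: level_def)

lemma level_above:
  assumes "1 \<le> j"
  shows "level S (k + j - 1) = q ` level U j"
proof (intro equalityI subsetI)
  fix z assume z: "z \<in> level S (k + j - 1)"
  then have "z \<in> carrier S" by (simp add: level_def)
  then consider x where "x \<in> carrier L - {\<top>\<^bsub>L\<^esub>}" "z = p x" | y where "y \<in> carrier U - {\<bottom>\<^bsub>U\<^esub>}" "z = q y"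
    using carrier_S by blast
  then show "z \<in> q ` level U j"
  proof cases
    \<comment> \<open>An element of L reaches this level only as a coatom at j = 1, and is then also
      the image of an atom of U.\<close>
    case 1
    then have "rank L x = k" "j = 1"
      using z rank_p rank_p_le[of x] assms by (auto simp: level_def)
    then show ?thesis
      using 1 coatom_of_rank[of x] \<mu>_atom[of x] p_coatom[of x] by (auto simp: U.atoms_eq_level)
  next
    case 2
    then show ?thesis
      using z rank_q_Suc[of y] assms by (auto simp: level_def)
  qed
next
  fix z assume "z \<in> q ` level U j"
  then obtain y where "y \<in> level U j" "z = q y" by blast
  then have "z = q y" "y \<in> carrier U - {\<bottom>\<^bsub>U\<^esub>}" "rank U y = j"
    using level_U[OF assms] by (auto simp: level_def)
  then show "z \<in> level S (k + j - 1)"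
    using rank_q_Suc[of y] q_closed by (auto simp: level_def)
qed

lemma q_inj: "A \<subseteq> carrier U - {\<bottom>\<^bsub>U\<^esub>} \<Longrightarrow> inj_on q A"
  by (intro inj_onI) (use q_eq_iff in blast)

lemma card_level_above: "1 \<le> j \<Longrightarrow> card (level S (k + j - 1)) = card (level U j)"
  unfolding level_above by (intro card_image q_inj level_U)

lemma coatoms_S: "coatoms S = q ` coatoms U"
proof -
  have "rank S \<top>\<^bsub>S\<^esub> - 1 = k + (rank U \<top>\<^bsub>U\<^esub> - 1) - 1" "0 < rank S \<top>\<^bsub>S\<^esub>" "0 < rank U \<top>\<^bsub>U\<^esub>"
    using rank_top_S k_pos rank_U by linarith+
  then show ?thesis
    using level_above[of "rank U \<top>\<^bsub>U\<^esub> - 1"] rank_U by (simp add: U.coatoms_eq_level S.coatoms_eq_level)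
qed

lemma coatoms_U: "coatoms U \<subseteq> carrier U - {\<bottom>\<^bsub>U\<^esub>}"
  using rank_U level_U[of "rank U \<top>\<^bsub>U\<^esub> - 1"] by (simp add: U.coatoms_eq_level)

lemma card_coatoms_S: "card (coatoms S) = card (coatoms U)"
  unfolding coatoms_S by (intro card_image q_inj coatoms_U)

text \<open>Levels and the rank of the top are shifted by the same k - 1, so the upper bound in
  \<open>necks\<close> is preserved. The value j = 1 is left out: the atoms of U are no neck of U,
  but their level may become one of S.\<close>

lemma necks_above: "2 \<le> j \<Longrightarrow> k + j - 1 \<in> necks S \<longleftrightarrow> j \<in> necks U"
  using card_level_above[of j] rank_top_S k_pos by (auto simp: necks_def)

lemma k_neck:
  assumes "card (coatoms L) = 2" "3 \<le> rank L \<top>\<^bsub>L\<^esub>" "3 \<le> rank U \<top>\<^bsub>U\<^esub>"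
  shows "k \<in> necks S"
  using card_level_above[of 1] rank_top_S assms bij_betw_same_card[OF \<mu>]
  by (auto simp: necks_def U.atoms_eq_level k_def)

text \<open>A neck of S above level k would be a neck of U. This is where the absence of necks in U
  makes S determine the place at which it was glued.\<close>

lemma cut_S:
  assumes "card (coatoms L) = 2" "3 \<le> rank L \<top>\<^bsub>L\<^esub>" "3 \<le> rank U \<top>\<^bsub>U\<^esub>" "necks U = {}"
  shows "cut S = k"
  unfolding cut_def
proof (rule Max_eqI)
  show "k \<in> necks S" using k_neck assms by blast
  show "j \<le> k" if "j \<in> necks S" for j
  proof (rule ccontr)
    assume "\<not> j \<le> k"
    \<comment> \<open>This index inverts the shift from j to k + j - 1.\<close>
    then have "2 \<le> j - k + 1" "k + (j - k + 1) - 1 = j" by auto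
    then show False using necks_above[of "j - k + 1"] that assms by auto
  qed
qed simp

text \<open>L is recovered from S and k. The map p covers exactly the ranks up to k, since an
  element of U of such a rank is an atom and thus identified with a coatom of L; only the deleted
  top has to be restored.\<close>

lemma iso_low: "order_iso L (low_at S k) (\<lambda>x. if x = \<top>\<^bsub>L\<^esub> then \<top>\<^bsub>S\<^esub> else p x)"
proof (rule order_isoI)
  let ?f = "\<lambda>x. if x = \<top>\<^bsub>L\<^esub> then \<top>\<^bsub>S\<^esub> else p x"
  show "weak_partial_order L" by (rule L.weak_partial_order_axioms)
  show "weak_partial_order (low_at S k)"
    unfolding low_at_def
    by (rule weak_partial_order_subset) (auto intro: S.weak_partial_order_axioms)
  have less_top: "rank S (p x) < rank S \<top>\<^bsub>S\<^esub>" if "x \<in> carrier L - {\<top>\<^bsub>L\<^esub>}" for x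
    using rank_p[OF that] rank_p_le[OF that] rank_top_S rank_U by linarith
  then have ne_top: "p x \<noteq> \<top>\<^bsub>S\<^esub>" if "x \<in> carrier L - {\<top>\<^bsub>L\<^esub>}" for x
    using that by fastforce
  show "bij_betw ?f (carrier L) (carrier (low_at S k))"
  proof (rule bij_betw_imageI)
    show "inj_on ?f (carrier L)"
      using ne_top by (intro inj_onI) (auto simp: p_eq_iff split: if_splits)
    show "?f ` carrier L = carrier (low_at S k)"
    proof (intro equalityI subsetI)
      fix z assume "z \<in> ?f ` carrier L"
      then show "z \<in> carrier (low_at S k)"
        using p_closed rank_p rank_p_le by auto
    next
      fix z assume z: "z \<in> carrier (low_at S k)"
      show "z \<in> ?f ` carrier L"
      proof (cases "z = \<top>\<^bsub>S\<^esub>")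
        case True
        then show ?thesis by (intro image_eqI[of _ _ "\<top>\<^bsub>L\<^esub>"]) auto
      next
        case False
        then have zS: "z \<in> carrier S" "rank S z \<le> k" using z by auto
        then consider x where "x \<in> carrier L - {\<top>\<^bsub>L\<^esub>}" "z = p x"
          | y where "y \<in> carrier U - {\<bottom>\<^bsub>U\<^esub>}" "z = q y"
          using carrier_S by blast
        then have "\<exists>x\<in>carrier L - {\<top>\<^bsub>L\<^esub>}. z = p x"
        proof cases
          case 2
          then have "rank U y = 1"
            using zS rank_q_Suc[of y] rank_U_pos[of y] by auto
          then obtain c where "c \<in> coatoms L" "y = \<mu> c"
            using 2 atom_of_rank[of y] atom_\<mu> by blast
          then show ?thesis using 2 p_coatom coatom_closed by metis
        qed blast
        then show ?thesis by (auto simp: image_iff)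
      qed
    qed
  qed
  fix x y assume xy: "x \<in> carrier L" "y \<in> carrier L"
  show "?f x \<sqsubseteq>\<^bsub>low_at S k\<^esub> ?f y \<longleftrightarrow> x \<sqsubseteq>\<^bsub>L\<^esub> y"
    using xy ne_top by (auto simp: p_le p_closed L.top_unique S.top_unique)
qed

lemma iso_up: "order_iso U (up_at S k) (\<lambda>x. if x = \<bottom>\<^bsub>U\<^esub> then \<bottom>\<^bsub>S\<^esub> else q x)"
proof (rule order_isoI)
  let ?f = "\<lambda>x. if x = \<bottom>\<^bsub>U\<^esub> then \<bottom>\<^bsub>S\<^esub> else q x"
  show "weak_partial_order U" by (rule U.weak_partial_order_axioms)
  show "weak_partial_order (up_at S k)"
    unfolding up_at_def
    by (rule weak_partial_order_subset) (auto intro: S.weak_partial_order_axioms)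
  have rank: "k \<le> rank S (q x)" if "x \<in> carrier U - {\<bottom>\<^bsub>U\<^esub>}" for x
    using rank_q_Suc[OF that] rank_U_pos[OF that] by linarith
  then have ne_bottom: "q x \<noteq> \<bottom>\<^bsub>S\<^esub>" if "x \<in> carrier U - {\<bottom>\<^bsub>U\<^esub>}" for x
    using that k_pos S.rank_bottom by fastforce
  show "bij_betw ?f (carrier U) (carrier (up_at S k))"
  proof (rule bij_betw_imageI)
    show "inj_on ?f (carrier U)"
      using ne_bottom by (intro inj_onI) (auto simp: q_eq_iff split: if_splits)
    show "?f ` carrier U = carrier (up_at S k)"
    proof (intro equalityI subsetI)
      fix z assume "z \<in> ?f ` carrier U"
      then show "z \<in> carrier (up_at S k)"
        using q_closed rank by auto
    next
      fix z assume z: "z \<in> carrier (up_at S k)"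
      show "z \<in> ?f ` carrier U"
      proof (cases "z = \<bottom>\<^bsub>S\<^esub>")
        case True
        then show ?thesis by (intro image_eqI[of _ _ "\<bottom>\<^bsub>U\<^esub>"]) auto
      next
        case False
        then have zS: "z \<in> carrier S" "k \<le> rank S z" using z by auto
        then consider x where "x \<in> carrier L - {\<top>\<^bsub>L\<^esub>}" "z = p x"
          | y where "y \<in> carrier U - {\<bottom>\<^bsub>U\<^esub>}" "z = q y"
          using carrier_S by blast
        then have "\<exists>x\<in>carrier U - {\<bottom>\<^bsub>U\<^esub>}. z = q x"
        proof cases
          case 1
          then have "rank L x = k"
            using zS rank_p[of x] rank_p_le[of x] by auto
          then have "x \<in> coatoms L"
            using 1 coatom_of_rank[of x] by blast
          then show ?thesis using 1 p_coatom \<mu>_atom atom_closed by metis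
        qed blast
        then show ?thesis by (auto simp: image_iff)
      qed
    qed
  qed
  fix x y assume xy: "x \<in> carrier U" "y \<in> carrier U"
  show "?f x \<sqsubseteq>\<^bsub>up_at S k\<^esub> ?f y \<longleftrightarrow> x \<sqsubseteq>\<^bsub>U\<^esub> y"
    using xy ne_bottom by (auto simp: q_le q_closed U.bottom_unique S.bottom_unique)
qed

end

text \<open>(C1) speaks only of sums on the type of the summands. The obvious carrier is a finite
  subset of a sum type, and infinity of the type leaves room for a copy of it. Only a partial order
  has to be built; that it is a graded lattice will follow from (C1).\<close>

lemma ex_amalgam:
  fixes L U :: "'a gorder"
  assumes inf: "infinite (UNIV :: 'a set)"
    and L: "fin_lattice L" and U: "fin_lattice U"
    and \<mu>: "bij_betw \<mu> (coatoms L) (atoms U)"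
  obtains S :: "'a gorder" and p q where "amalgam L U S \<mu> p q"
proof -
  interpret L: fin_lattice L by (rule L)
  interpret U: fin_lattice U by (rule U)
  let ?L = "carrier L - {\<top>\<^bsub>L\<^esub>}" and ?U = "carrier U - {\<bottom>\<^bsub>U\<^esub>}"
  \<comment> \<open>The atoms of U are left out, each identified element being represented by its
    coatom of L.\<close>
  let ?V = "?U - atoms U"
  let ?A = "Inl ` ?L \<union> Inr ` ?V"
  have "finite ?A" by simp
  \<comment> \<open>A subset of the right size, into which the carrier is moved by
    \<open>\<iota>\<close>.\<close>
  obtain B :: "'a set" where "finite B" "card B = card ?A"
    using infinite_arbitrarily_large[OF inf] by metis
  then obtain \<iota> where "bij_betw \<iota> ?A B"
    using finite_same_card_bij[of ?A B] \<open>finite ?A\<close> by metis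
  then have \<iota>: "inj_on \<iota> ?A" by (simp add: bij_betw_def)
  define le0 :: "'a + 'a \<Rightarrow> 'a + 'a \<Rightarrow> bool" where
    "le0 u v = (case (u, v) of
        (Inl x, Inl x') \<Rightarrow> x \<sqsubseteq>\<^bsub>L\<^esub> x'
      | (Inl x, Inr y) \<Rightarrow> (\<exists>c\<in>coatoms L. x \<sqsubseteq>\<^bsub>L\<^esub> c \<and> \<mu> c \<sqsubseteq>\<^bsub>U\<^esub> y)
      | (Inr y, Inl x) \<Rightarrow> False
      | (Inr y, Inr y') \<Rightarrow> y \<sqsubseteq>\<^bsub>U\<^esub> y')" for u v
  have le0 [simp]:
    "le0 (Inl x) (Inl x') \<longleftrightarrow> x \<sqsubseteq>\<^bsub>L\<^esub> x'"
    "le0 (Inl x) (Inr y) \<longleftrightarrow> (\<exists>c\<in>coatoms L. x \<sqsubseteq>\<^bsub>L\<^esub> c \<and> \<mu> c \<sqsubseteq>\<^bsub>U\<^esub> y)"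
    "le0 (Inr y) (Inl x) \<longleftrightarrow> False"
    "le0 (Inr y) (Inr y') \<longleftrightarrow> y \<sqsubseteq>\<^bsub>U\<^esub> y'" for x x' y y'
    by (simp_all add: le0_def)
  define S :: "'a gorder" where
    "S = \<lparr>carrier = \<iota> ` ?A, eq = (=), le = (\<lambda>a b. le0 (inv_into ?A \<iota> a) (inv_into ?A \<iota> b))\<rparr>"
  have inv: "inv_into ?A \<iota> (\<iota> u) = u" if "u \<in> ?A" for u
    using \<iota> that by (rule inv_into_f_f)
  have S: "carrier S = \<iota> ` ?A" "eq S = (=)"
    by (simp_all add: S_def)
  have le: "\<iota> u \<sqsubseteq>\<^bsub>S\<^esub> \<iota> v \<longleftrightarrow> le0 u v" if "u \<in> ?A" "v \<in> ?A" for u v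
    using that by (simp only: S_def gorder.simps inv)
  have coatom: "c \<in> carrier L" "c \<noteq> \<top>\<^bsub>L\<^esub>" "\<mu> c \<in> atoms U" "\<mu> c \<in> carrier U" "\<mu> c \<noteq> \<bottom>\<^bsub>U\<^esub>"
    if "c \<in> coatoms L" for c
    using that bij_betwE[OF \<mu>] by (auto simp: L.coatom_iff U.atom_iff)
  \<comment> \<open>A chain can change from L to U once and never back. The coatom that witnesses
    the change also serves for the composite comparison.\<close>
  have le0_trans: "le0 u w" if uvw: "u \<in> ?A" "v \<in> ?A" "w \<in> ?A" "le0 u v" "le0 v w" for u v w
  proof -
    have L: "x \<in> carrier L" if "Inl x \<in> ?A" for x
      using that by auto
    have R: "y \<in> carrier U" if "Inr y \<in> ?A" for y
      using that by auto
    show ?thesis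
    proof (cases u)
      case u: (Inl x)
      show ?thesis
      proof (cases v)
        case v: (Inl y)
        have xy: "x \<sqsubseteq>\<^bsub>L\<^esub> y" "x \<in> carrier L" "y \<in> carrier L"
          using uvw(4) L[of x] L[of y] uvw(1,2) unfolding u v by simp_all
        show ?thesis
        proof (cases w)
          case w: (Inl z)
          then show ?thesis
            using uvw(3,5) xy L[of z] L.le_trans[of x y z] unfolding u v by simp
        next
          case w: (Inr z)
          then obtain d where d: "d \<in> coatoms L" "y \<sqsubseteq>\<^bsub>L\<^esub> d" "\<mu> d \<sqsubseteq>\<^bsub>U\<^esub> z"
            using uvw(5) unfolding v by auto
          then have "x \<sqsubseteq>\<^bsub>L\<^esub> d" using xy coatom(1) L.le_trans[of x y d] by simp
          then show ?thesis unfolding u w using d by auto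
        qed
      next
        case v: (Inr y)
        then obtain d where d: "d \<in> coatoms L" "x \<sqsubseteq>\<^bsub>L\<^esub> d" "\<mu> d \<sqsubseteq>\<^bsub>U\<^esub> y"
          using uvw(4) unfolding u by auto
        obtain z where w: "w = Inr z" "y \<sqsubseteq>\<^bsub>U\<^esub> z"
          using uvw(5) unfolding v by (cases w) auto
        then have "\<mu> d \<sqsubseteq>\<^bsub>U\<^esub> z"
          using d uvw(2,3) R[of y] R[of z] coatom(4) U.le_trans[of "\<mu> d" y z] unfolding v by simp
        then show ?thesis unfolding u w using d by auto
      qed
    next
      case u: (Inr x)
      then obtain y z where "v = Inr y" "x \<sqsubseteq>\<^bsub>U\<^esub> y" "w = Inr z" "y \<sqsubseteq>\<^bsub>U\<^esub> z"
        using uvw(4,5) by (cases v; cases w) auto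
      then show ?thesis
        using uvw(1-3) R[of x] R[of y] R[of z] U.le_trans[of x y z] unfolding u by simp
    qed
  qed
  have poS: "partial_order S"
  proof (rule partial_orderI)
    show "x \<sqsubseteq>\<^bsub>S\<^esub> x" if asm: "x \<in> carrier S" for x
    proof -
      obtain u where "u \<in> ?A" "x = \<iota> u"
        using asm unfolding S(1) by blast
      then show ?thesis using le[of u u] by auto
    qed
    show "x = y" if asm: "x \<sqsubseteq>\<^bsub>S\<^esub> y" "y \<sqsubseteq>\<^bsub>S\<^esub> x" "x \<in> carrier S" "y \<in> carrier S" for x y
    proof -
      obtain u v where uv: "u \<in> ?A" "v \<in> ?A" "x = \<iota> u" "y = \<iota> v"
        using asm(3,4) unfolding S(1) by blast
      then have "le0 u v" "le0 v u" using asm le by auto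
      then have "u = v"
        using uv by (cases u; cases v) (auto intro: L.le_antisym U.le_antisym)
      then show ?thesis using uv by simp
    qed
    show "x \<sqsubseteq>\<^bsub>S\<^esub> z" if asm: "x \<sqsubseteq>\<^bsub>S\<^esub> y" "y \<sqsubseteq>\<^bsub>S\<^esub> z"
      "x \<in> carrier S" "y \<in> carrier S" "z \<in> carrier S" for x y z
    proof -
      obtain u v w where uv: "u \<in> ?A" "v \<in> ?A" "w \<in> ?A" "x = \<iota> u" "y = \<iota> v" "z = \<iota> w"
        using asm(3-5) unfolding S(1) by blast
      then have "le0 u v" "le0 v w" using asm le by auto
      then show ?thesis using uv le0_trans[of u v w] le by auto
    qed
  qed (rule S)
  define p where "p x = \<iota> (Inl x)" for x
  \<comment> \<open>An atom is sent to the representative on the side of L, by the inverse of the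
    matching.\<close>
  define q where "q y = (if y \<in> atoms U then \<iota> (Inl (inv_into (coatoms L) \<mu> y)) else \<iota> (Inr y))" for y
  have q_atom: "q (\<mu> c) = \<iota> (Inl c)" if "c \<in> coatoms L" for c
    using that coatom[OF that] \<mu> by (simp add: q_def bij_betw_inv_into_left)
  have q_Inr: "q y = \<iota> (Inr y)" if "y \<in> ?V" for y
    using that by (simp add: q_def)
  have U_cases: "(\<exists>c\<in>coatoms L. y = \<mu> c) \<or> y \<in> ?V" if "y \<in> ?U" for y
    using that bij_betw_imp_surj_on[OF \<mu>] by blast
  have InA: "Inl x \<in> ?A" if "x \<in> ?L" for x using that by blast
  have InB: "Inr y \<in> ?A" if "y \<in> ?V" for y using that by blast
  have InC: "Inl c \<in> ?A" if "c \<in> coatoms L" for c using that coatom InA by blast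
  have antichain: "c \<sqsubseteq>\<^bsub>L\<^esub> x \<longleftrightarrow> x = c" if "c \<in> coatoms L" "x \<in> ?L" for c x
    using that by (auto simp: L.coatom_iff)
  have atom_le: "y \<sqsubseteq>\<^bsub>U\<^esub> \<mu> c \<longleftrightarrow> y = \<mu> c" if "c \<in> coatoms L" "y \<in> ?U" for c y
    using that coatom(3)[OF that(1)] by (auto simp: U.atom_iff)
  have \<mu>_eq: "\<mu> c = \<mu> c' \<longleftrightarrow> c = c'" if "c \<in> coatoms L" "c' \<in> coatoms L" for c c'
    using that \<mu> by (auto simp: bij_betw_def inj_on_eq_iff)
  have atom_not_V: "\<mu> c \<notin> ?V" if "c \<in> coatoms L" for c
    using coatom(3)[OF that] by blast
  have "amalgam L U S \<mu> p q"
  proof (intro amalgam.intro amalgam_axioms.intro L U poS \<mu>)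
    show "carrier S = p ` ?L \<union> q ` ?U"
    proof (intro equalityI subsetI)
      fix z assume "z \<in> carrier S"
      then show "z \<in> p ` ?L \<union> q ` ?U"
      proof -
        obtain u where u: "u \<in> ?A" "z = \<iota> u"
          using \<open>z \<in> carrier S\<close> unfolding S(1) by blast
        show ?thesis
        proof (cases u)
          case (Inl x)
          then have "x \<in> ?L" "z = p x" using u by (auto simp: p_def)
          then show ?thesis by blast
        next
          case (Inr y)
          then have "y \<in> ?V" using u by auto
          then have "y \<in> ?U" "z = q y" using q_Inr[of y] u Inr by auto
          then show ?thesis by blast
        qed
      qed
    next
      fix z assume "z \<in> p ` ?L \<union> q ` ?U"
      then consider x where "x \<in> ?L" "z = p x" | y where "y \<in> ?U" "z = q y" by blast
      then show "z \<in> carrier S"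
      proof cases
        case 1
        then show ?thesis unfolding S p_def using InA by blast
      next
        case 2
        then show ?thesis
          unfolding S using U_cases[OF 2(1)] q_atom q_Inr InB InC by auto
      qed
    qed
  next
    fix x x' assume "x \<in> ?L" "x' \<in> ?L"
    then show "p x \<sqsubseteq>\<^bsub>S\<^esub> p x' \<longleftrightarrow> x \<sqsubseteq>\<^bsub>L\<^esub> x'"
      unfolding p_def using le[OF InA InA] by simp
  next
    fix y y' assume y: "y \<in> ?U" "y' \<in> ?U"
    from U_cases[OF y(1)] U_cases[OF y(2)]
    consider c c' where "c \<in> coatoms L" "y = \<mu> c" "c' \<in> coatoms L" "y' = \<mu> c'"
      | c where "c \<in> coatoms L" "y = \<mu> c" "y' \<in> ?V"
      | c' where "y \<in> ?V" "c' \<in> coatoms L" "y' = \<mu> c'"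
      | "y \<in> ?V" "y' \<in> ?V"
      by blast
    then show "q y \<sqsubseteq>\<^bsub>S\<^esub> q y' \<longleftrightarrow> y \<sqsubseteq>\<^bsub>U\<^esub> y'"
    proof cases
      case 1
      then have "q y \<sqsubseteq>\<^bsub>S\<^esub> q y' \<longleftrightarrow> c \<sqsubseteq>\<^bsub>L\<^esub> c'"
        using le[OF InC InC, of c c'] q_atom by simp
      also have "\<dots> \<longleftrightarrow> c' = c"
        using 1 antichain[of c c'] coatom by blast
      also have "\<dots> \<longleftrightarrow> y \<sqsubseteq>\<^bsub>U\<^esub> y'"
        using 1 atom_le[of c' y] \<mu>_eq y by auto
      finally show ?thesis .
    next
      case 2
      then have "q y \<sqsubseteq>\<^bsub>S\<^esub> q y' \<longleftrightarrow> (\<exists>d\<in>coatoms L. c \<sqsubseteq>\<^bsub>L\<^esub> d \<and> \<mu> d \<sqsubseteq>\<^bsub>U\<^esub> y')"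
        using le[OF InC InB, of c y'] q_atom q_Inr by simp
      also have "\<dots> \<longleftrightarrow> y \<sqsubseteq>\<^bsub>U\<^esub> y'"
        using 2 antichain[OF 2(1)] coatom by blast
      finally show ?thesis .
    next
      case 3
      then have "\<not> q y \<sqsubseteq>\<^bsub>S\<^esub> q y'"
        using le[OF InB InC, of y c'] q_atom q_Inr by simp
      moreover have "\<not> y \<sqsubseteq>\<^bsub>U\<^esub> y'"
        using 3 atom_le[of c' y] y atom_not_V by blast
      ultimately show ?thesis by simp
    next
      case 4
      then show ?thesis using le[OF InB InB, of y y'] q_Inr by simp
    qed
  next
    fix x y assume xy: "x \<in> ?L" "y \<in> ?U"
    from U_cases[OF xy(2)] consider c where "c \<in> coatoms L" "y = \<mu> c" | "y \<in> ?V" by blast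
    note cases = this
    from cases show "p x \<sqsubseteq>\<^bsub>S\<^esub> q y \<longleftrightarrow> (\<exists>c\<in>coatoms L. x \<sqsubseteq>\<^bsub>L\<^esub> c \<and> \<mu> c \<sqsubseteq>\<^bsub>U\<^esub> y)"
    proof cases
      case 1
      have "p x \<sqsubseteq>\<^bsub>S\<^esub> q y \<longleftrightarrow> x \<sqsubseteq>\<^bsub>L\<^esub> c"
        using 1 le[OF InA InC, of x c] xy q_atom by (simp add: p_def)
      \<comment> \<open>Here y is the atom matched with c, and an atom of U below it must equal it;
        so c is the only possible witness.\<close>
      also have "\<dots> \<longleftrightarrow> (\<exists>d\<in>coatoms L. x \<sqsubseteq>\<^bsub>L\<^esub> d \<and> \<mu> d \<sqsubseteq>\<^bsub>U\<^esub> y)"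
        using 1 atom_le[OF 1(1)] coatom \<mu>_eq by (metis Diff_iff singletonD)
      finally show ?thesis .
    next
      case 2
      then show ?thesis
        using le[OF InA InB, of x y] xy q_Inr by (simp add: p_def)
    qed
    from cases show "q y \<sqsubseteq>\<^bsub>S\<^esub> p x \<longleftrightarrow> x \<in> coatoms L \<and> y = \<mu> x"
    proof cases
      case 1
      have "q y \<sqsubseteq>\<^bsub>S\<^esub> p x \<longleftrightarrow> c \<sqsubseteq>\<^bsub>L\<^esub> x"
        using 1 le[OF InC InA, of c x] xy q_atom by (simp add: p_def)
      also have "\<dots> \<longleftrightarrow> x \<in> coatoms L \<and> y = \<mu> x"
        using 1 antichain[OF 1(1) xy(1)] \<mu>_eq by auto
      finally show ?thesis .
    next
      case 2
      then show ?thesis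
        using le[OF InB InA, of y x] xy q_Inr atom_not_V[of x] by (auto simp: p_def)
    qed
  qed
  then show thesis using that by blast
qed

section \<open>Cutting a graded lattice at a level\<close>

context graded_lattice
begin

text \<open>Meets stay in the lower part, because ranks only drop. If a join has rank above k, the
  top is the only upper bound left, and it takes over as the join.\<close>

lemma fin_lattice_low:
  "fin_lattice (low_at L k) \<and> \<bottom>\<^bsub>low_at L k\<^esub> = \<bottom> \<and> \<top>\<^bsub>low_at L k\<^esub> = \<top>"
  unfolding low_at_def
proof (rule restrict)
  let ?A = "{x \<in> carrier L. rank L x \<le> k \<or> x = \<top>}"
  fix x y assume xy: "x \<in> ?A" "y \<in> ?A"
  obtain s where s: "s \<in> carrier L" "x \<sqsubseteq> s" "y \<sqsubseteq> s"
    "\<forall>z\<in>carrier L. x \<sqsubseteq> z \<longrightarrow> y \<sqsubseteq> z \<longrightarrow> s \<sqsubseteq> z"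
    using ex_lub[of x y] xy by blast
  show "\<exists>s\<in>?A. x \<sqsubseteq> s \<and> y \<sqsubseteq> s \<and> (\<forall>z\<in>?A. x \<sqsubseteq> z \<longrightarrow> y \<sqsubseteq> z \<longrightarrow> s \<sqsubseteq> z)"
  proof (cases "rank L s \<le> k")
    case True
    then show ?thesis using s by blast
  next
    case False
    have "z = \<top>" if "z \<in> ?A" "x \<sqsubseteq> z" "y \<sqsubseteq> z" for z
      using that s rank_le[of s z] False by auto
    then show ?thesis using xy by (intro bexI[of _ "\<top>"]) auto
  qed
  obtain t where t: "t \<in> carrier L" "t \<sqsubseteq> x" "t \<sqsubseteq> y"
    "\<forall>z\<in>carrier L. z \<sqsubseteq> x \<longrightarrow> z \<sqsubseteq> y \<longrightarrow> z \<sqsubseteq> t"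
    using ex_glb[of x y] xy by blast
  have "t \<in> ?A"
  proof (cases "x = \<top> \<and> y = \<top>")
    case True
    then have "\<top> \<sqsubseteq> t" using t(4) by simp
    then show ?thesis using t(1) top_unique by simp
  next
    case False
    then show ?thesis
      using t xy rank_le[of t x] rank_le[of t y] by auto
  qed
  then show "\<exists>s\<in>?A. s \<sqsubseteq> x \<and> s \<sqsubseteq> y \<and> (\<forall>z\<in>?A. z \<sqsubseteq> x \<longrightarrow> z \<sqsubseteq> y \<longrightarrow> z \<sqsubseteq> s)"
    using t by blast
qed auto

text \<open>The dual construction; the bound on k is what keeps the top in the upper part.\<close>

lemma fin_lattice_up:
  "fin_lattice (up_at L k) \<and> \<bottom>\<^bsub>up_at L k\<^esub> = \<bottom> \<and> \<top>\<^bsub>up_at L k\<^esub> = \<top>" if "k \<le> rank L \<top>"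
  unfolding up_at_def
proof (rule restrict)
  let ?A = "{x \<in> carrier L. k \<le> rank L x \<or> x = \<bottom>}"
  fix x y assume xy: "x \<in> ?A" "y \<in> ?A"
  obtain t where t: "t \<in> carrier L" "t \<sqsubseteq> x" "t \<sqsubseteq> y"
    "\<forall>z\<in>carrier L. z \<sqsubseteq> x \<longrightarrow> z \<sqsubseteq> y \<longrightarrow> z \<sqsubseteq> t"
    using ex_glb[of x y] xy by blast
  show "\<exists>s\<in>?A. s \<sqsubseteq> x \<and> s \<sqsubseteq> y \<and> (\<forall>z\<in>?A. z \<sqsubseteq> x \<longrightarrow> z \<sqsubseteq> y \<longrightarrow> z \<sqsubseteq> s)"
  proof (cases "k \<le> rank L t")
    case True
    then show ?thesis using t by blast
  next
    case False
    have "z = \<bottom>" if "z \<in> ?A" "z \<sqsubseteq> x" "z \<sqsubseteq> y" for z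
      using that t rank_le[of z t] False by auto
    then show ?thesis using xy by (intro bexI[of _ "\<bottom>"]) auto
  qed
  obtain s where s: "s \<in> carrier L" "x \<sqsubseteq> s" "y \<sqsubseteq> s"
    "\<forall>z\<in>carrier L. x \<sqsubseteq> z \<longrightarrow> y \<sqsubseteq> z \<longrightarrow> s \<sqsubseteq> z"
    using ex_lub[of x y] xy by blast
  have "s \<in> ?A"
  proof (cases "x = \<bottom> \<and> y = \<bottom>")
    case True
    then have "s \<sqsubseteq> \<bottom>" using s(4) by simp
    then show ?thesis using s(1) bottom_unique by simp
  next
    case False
    then show ?thesis
      using s xy rank_le[of x s] rank_le[of y s] by auto
  qed
  then show "\<exists>s\<in>?A. x \<sqsubseteq> s \<and> y \<sqsubseteq> s \<and> (\<forall>z\<in>?A. x \<sqsubseteq> z \<longrightarrow> y \<sqsubseteq> z \<longrightarrow> s \<sqsubseteq> z)"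
    using s by blast
qed (use that in auto)

text \<open>By \<open>ex_between\<close>, an element of rank less than k lies below one of rank k,
  so exactly the elements of level k are maximal below the top.\<close>

lemma coatoms_low: "k < rank L \<top> \<Longrightarrow> coatoms (low_at L k) = level L k"
proof -
  assume k: "k < rank L \<top>"
  interpret M: fin_lattice "low_at L k" using fin_lattice_low by blast
  have top: "\<top>\<^bsub>low_at L k\<^esub> = \<top>" using fin_lattice_low by blast
  show ?thesis
  proof (intro equalityI subsetI)
    fix c assume "c \<in> coatoms (low_at L k)"
    then have c: "c \<in> carrier L" "rank L c \<le> k" "c \<noteq> \<top>"
      "\<forall>z. z \<in> carrier L \<and> (rank L z \<le> k \<or> z = \<top>) \<longrightarrow> c \<sqsubseteq> z \<longrightarrow> z = c \<or> z = \<top>"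
      by (auto simp: M.coatom_iff top)
    obtain z where "z \<in> carrier L" "c \<sqsubseteq> z" "rank L z = k"
      using ex_between[of c "\<top>" k] c k by auto
    then show "c \<in> level L k"
      using c k by (auto simp: level_def)
  next
    fix c assume "c \<in> level L k"
    then have c: "c \<in> carrier L" "rank L c = k" by (auto simp: level_def)
    show "c \<in> coatoms (low_at L k)"
      unfolding M.coatom_iff top using c k rank_less[of c] by fastforce
  qed
qed

lemma atoms_up: "0 < k \<Longrightarrow> k \<le> rank L \<top> \<Longrightarrow> atoms (up_at L k) = level L k"
proof -
  assume k: "0 < k" "k \<le> rank L \<top>"
  interpret M: fin_lattice "up_at L k" using fin_lattice_up[OF k(2)] by blast
  have bot: "\<bottom>\<^bsub>up_at L k\<^esub> = \<bottom>" using fin_lattice_up[OF k(2)] by blast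
  show ?thesis
  proof (intro equalityI subsetI)
    fix c assume "c \<in> atoms (up_at L k)"
    then have c: "c \<in> carrier L" "k \<le> rank L c" "c \<noteq> \<bottom>"
      "\<forall>z. z \<in> carrier L \<and> (k \<le> rank L z \<or> z = \<bottom>) \<longrightarrow> z \<sqsubseteq> c \<longrightarrow> z = \<bottom> \<or> z = c"
      by (auto simp: M.atom_iff bot)
    obtain z where "z \<in> carrier L" "z \<sqsubseteq> c" "rank L z = k"
      using ex_between[of "\<bottom>" c k] c k by auto
    then show "c \<in> level L k"
      using c k by (auto simp: level_def)
  next
    fix c assume "c \<in> level L k"
    then have c: "c \<in> carrier L" "rank L c = k" by (auto simp: level_def)
    show "c \<in> atoms (up_at L k)"
      unfolding M.atom_iff bot using c k rank_less[of _ c] by fastforce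
  qed
qed

text \<open>The two parts overlap in level k, so the matching is the identity. An upward comparison
  across the level passes through it by \<open>ex_between\<close>; a downward one forces equal
  ranks, hence equality.\<close>

lemma amalgam_low_up:
  assumes k: "0 < k" "k < rank L \<top>"
  shows "amalgam (low_at L k) (up_at L k) L id id id"
proof -
  have low: "fin_lattice (low_at L k)" "\<bottom>\<^bsub>low_at L k\<^esub> = \<bottom>" "\<top>\<^bsub>low_at L k\<^esub> = \<top>"
    using fin_lattice_low by auto
  have up: "fin_lattice (up_at L k)" "\<bottom>\<^bsub>up_at L k\<^esub> = \<bottom>" "\<top>\<^bsub>up_at L k\<^esub> = \<top>"
    using fin_lattice_up k by auto
  have ca: "coatoms (low_at L k) = level L k" "atoms (up_at L k) = level L k"
    using coatoms_low atoms_up k by auto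
  have lowc: "x \<in> carrier L \<and> rank L x \<le> k" if "x \<in> carrier (low_at L k) - {\<top>}" for x
    using that by auto
  have upc: "x \<in> carrier L \<and> k \<le> rank L x" if "x \<in> carrier (up_at L k) - {\<bottom>}" for x
    using that by auto
  show ?thesis
  proof (intro amalgam.intro amalgam_axioms.intro low(1) up(1) partial_order_axioms, unfold ca low up)
    show "bij_betw id (level L k) (level L k)" by simp
    have "\<bottom> \<noteq> \<top>" using k rank_bottom by fastforce
    then show "carrier L = id ` (carrier (low_at L k) - {\<top>}) \<union> id ` (carrier (up_at L k) - {\<bottom>})"
      using k by (auto simp: rank_eq_0_iff)
    show "id x \<sqsubseteq> id y \<longleftrightarrow> (\<exists>c\<in>level L k. x \<sqsubseteq>\<^bsub>low_at L k\<^esub> c \<and> id c \<sqsubseteq>\<^bsub>up_at L k\<^esub> y)"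
      if xy: "x \<in> carrier (low_at L k) - {\<top>}" "y \<in> carrier (up_at L k) - {\<bottom>}" for x y
    proof
      assume "id x \<sqsubseteq> id y"
      then obtain z where "z \<in> carrier L" "x \<sqsubseteq> z" "z \<sqsubseteq> y" "rank L z = k"
        using ex_between[of x y k] lowc[OF xy(1)] upc[OF xy(2)] by auto
      then show "\<exists>c\<in>level L k. x \<sqsubseteq>\<^bsub>low_at L k\<^esub> c \<and> id c \<sqsubseteq>\<^bsub>up_at L k\<^esub> y"
        by (auto simp: level_def)
    qed (use lowc[OF xy(1)] upc[OF xy(2)] in \<open>auto simp: level_def intro: le_trans\<close>)
    show "id y \<sqsubseteq> id x \<longleftrightarrow> x \<in> level L k \<and> y = id x"
      if xy: "x \<in> carrier (low_at L k) - {\<top>}" "y \<in> carrier (up_at L k) - {\<bottom>}" for x y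
      using lowc[OF xy(1)] upc[OF xy(2)] rank_le[of y x] eq_of_rank_eq[of y x] by (auto simp: level_def)
  qed auto
qed

end

section \<open>Isomorphisms of amalgams\<close>

context amalgam
begin

lemma cases_S:
  assumes "z \<in> carrier S"
  obtains (p) x where "x \<in> carrier L - {\<top>\<^bsub>L\<^esub>}" "z = p x" | (q) y where "y \<in> carrier U - {\<bottom>\<^bsub>U\<^esub>}" "z = q y"
  using assms carrier_S by blast

lemma inj_p: "inj_on p (carrier L - {\<top>\<^bsub>L\<^esub>})"
  by (rule inj_onI) (simp only: p_eq_iff)

lemma inj_q: "inj_on q (carrier U - {\<bottom>\<^bsub>U\<^esub>})"
  by (rule inj_onI) (simp only: q_eq_iff)

text \<open>The top of L and the bottom of U are dropped, and the identified elements are counted in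
  both summands. With two coatoms the total loss is 4, the 4 in
  \<open>k = n - j + 4\<close>.\<close>

lemma card_carrier_S:
  "card (carrier S) + card (coatoms L) + 2 = card (carrier L) + card (carrier U)"
proof -
  let ?P = "p ` (carrier L - {\<top>\<^bsub>L\<^esub>})" and ?Q = "q ` (carrier U - {\<bottom>\<^bsub>U\<^esub>})"
  have "?P \<inter> ?Q = p ` coatoms L"
  proof (intro equalityI subsetI)
    fix z assume "z \<in> ?P \<inter> ?Q"
    then obtain x y where "x \<in> carrier L - {\<top>\<^bsub>L\<^esub>}" "y \<in> carrier U - {\<bottom>\<^bsub>U\<^esub>}" "z = p x" "z = q y"
      by blast
    then show "z \<in> p ` coatoms L" using p_eq_q_iff[of x y] by auto
  next
    fix z assume "z \<in> p ` coatoms L"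
    then obtain c where c: "c \<in> coatoms L" "z = p c" by blast
    then show "z \<in> ?P \<inter> ?Q"
      using coatom_closed[OF c(1)] p_coatom[OF c(1)] atom_closed[OF \<mu>_atom[OF c(1)]] by blast
  qed
  moreover have "card (p ` coatoms L) = card (coatoms L)"
    using coatom_closed by (intro card_image inj_on_subset[OF inj_p]) blast
  moreover have "card (carrier S) + card (?P \<inter> ?Q) = card ?P + card ?Q"
    unfolding carrier_S by (intro card_Un_Int[symmetric]) simp_all
  moreover have "card ?P + 1 = card (carrier L)"
    unfolding card_image[OF inj_p] using card_Suc_Diff1[of "carrier L" "\<top>\<^bsub>L\<^esub>"] by simp
  moreover have "card ?Q + 1 = card (carrier U)"
    unfolding card_image[OF inj_q] using card_Suc_Diff1[of "carrier U" "\<bottom>\<^bsub>U\<^esub>"] by simp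
  ultimately show ?thesis by simp
qed

lemma card_coatoms_L: "card (coatoms L) = card (atoms U)"
  using bij_betw_same_card[OF \<mu>] .

text \<open>The means of replacing summands by isomorphic ones. With automorphisms for f and g it
  shows which changes of the matching leave the same S. Bijectivity of the new matching is not asked
  for, as it follows by counting.\<close>

lemma pullback:
  assumes f: "order_iso L' L f" and g: "order_iso U' U g"
    and L': "fin_lattice L'" and U': "fin_lattice U'"
    and \<mu>': "\<And>c. c \<in> coatoms L' \<Longrightarrow> \<mu>' c \<in> atoms U' \<and> g (\<mu>' c) = \<mu> (f c)"
  shows "amalgam L' U' S \<mu>' (p \<circ> f) (q \<circ> g)"
proof -
  interpret f: lattice_iso L' L f
    by (rule lattice_isoI[OF L' L.fin_lattice_axioms f])
  interpret g: lattice_iso U' U g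
    by (rule lattice_isoI[OF U' U.fin_lattice_axioms g])
  have f_minus: "f ` (carrier L' - {\<top>\<^bsub>L'\<^esub>}) = carrier L - {\<top>\<^bsub>L\<^esub>}"
    using order_iso_bij[OF f] f.f_top inj_on_image_set_diff[of f "carrier L'" "carrier L'" "{\<top>\<^bsub>L'\<^esub>}"]
    by (auto simp: bij_betw_def)
  have g_minus: "g ` (carrier U' - {\<bottom>\<^bsub>U'\<^esub>}) = carrier U - {\<bottom>\<^bsub>U\<^esub>}"
    using order_iso_bij[OF g] g.f_bottom inj_on_image_set_diff[of g "carrier U'" "carrier U'" "{\<bottom>\<^bsub>U'\<^esub>}"]
    by (auto simp: bij_betw_def)
  have f_closed: "f x \<in> carrier L - {\<top>\<^bsub>L\<^esub>}" if "x \<in> carrier L' - {\<top>\<^bsub>L'\<^esub>}" for x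
    using that f_minus by blast
  have g_closed: "g x \<in> carrier U - {\<bottom>\<^bsub>U\<^esub>}" if "x \<in> carrier U' - {\<bottom>\<^bsub>U'\<^esub>}" for x
    using that g_minus by blast
  have coatom: "c \<in> carrier L'" if "c \<in> coatoms L'" for c
    using that by (simp add: f.L.coatom_iff)
  have atom: "a \<in> carrier U'" if "a \<in> atoms U'" for a
    using that by (simp add: g.L.atom_iff)
  have \<mu>'_inj: "inj_on \<mu>' (coatoms L')"
  proof (rule inj_onI)
    fix c d assume cd: "c \<in> coatoms L'" "d \<in> coatoms L'" "\<mu>' c = \<mu>' d"
    then have "\<mu> (f c) = \<mu> (f d)" using \<mu>' by metis
    moreover have "f c \<in> coatoms L" "f d \<in> coatoms L" using cd f.f_coatoms by auto
    ultimately have "f c = f d" using \<mu> by (auto simp: bij_betw_def inj_on_eq_iff)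
    then show "c = d" using cd coatom f.f_eq_iff by blast
  qed
  \<comment> \<open>The image of the injective matching already has as many elements as there are
    atoms.\<close>
  have "\<mu>' ` coatoms L' = atoms U'"
  proof (rule card_subset_eq)
    show "finite (atoms U')" by simp
    show "\<mu>' ` coatoms L' \<subseteq> atoms U'" using \<mu>' by blast
    show "card (\<mu>' ` coatoms L') = card (atoms U')"
      using card_image[OF \<mu>'_inj] f.card_coatoms g.card_atoms card_coatoms_L by simp
  qed
  then have bij: "bij_betw \<mu>' (coatoms L') (atoms U')"
    using \<mu>'_inj by (simp add: bij_betw_def)
  have f_coatom: "f x \<in> coatoms L \<longleftrightarrow> x \<in> coatoms L'" if "x \<in> carrier L'" for x
    using that coatom f.f_coatoms f.f_eq_iff by auto
  show ?thesis
  proof (intro amalgam.intro amalgam_axioms.intro L' U' S.partial_order_axioms bij)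
    show "carrier S = (p \<circ> f) ` (carrier L' - {\<top>\<^bsub>L'\<^esub>}) \<union> (q \<circ> g) ` (carrier U' - {\<bottom>\<^bsub>U'\<^esub>})"
      unfolding image_comp[symmetric] f_minus g_minus by (rule carrier_S)
  next
    fix x x' assume "x \<in> carrier L' - {\<top>\<^bsub>L'\<^esub>}" "x' \<in> carrier L' - {\<top>\<^bsub>L'\<^esub>}"
    then show "(p \<circ> f) x \<sqsubseteq>\<^bsub>S\<^esub> (p \<circ> f) x' \<longleftrightarrow> x \<sqsubseteq>\<^bsub>L'\<^esub> x'"
      using p_le[OF f_closed f_closed] f.f_le by simp
  next
    fix y y' assume "y \<in> carrier U' - {\<bottom>\<^bsub>U'\<^esub>}" "y' \<in> carrier U' - {\<bottom>\<^bsub>U'\<^esub>}"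
    then show "(q \<circ> g) y \<sqsubseteq>\<^bsub>S\<^esub> (q \<circ> g) y' \<longleftrightarrow> y \<sqsubseteq>\<^bsub>U'\<^esub> y'"
      using q_le[OF g_closed g_closed] g.f_le by simp
  next
    fix x y assume xy: "x \<in> carrier L' - {\<top>\<^bsub>L'\<^esub>}" "y \<in> carrier U' - {\<bottom>\<^bsub>U'\<^esub>}"
    have "(p \<circ> f) x \<sqsubseteq>\<^bsub>S\<^esub> (q \<circ> g) y \<longleftrightarrow> (\<exists>c\<in>f ` coatoms L'. f x \<sqsubseteq>\<^bsub>L\<^esub> c \<and> \<mu> c \<sqsubseteq>\<^bsub>U\<^esub> g y)"
      using pq_le[OF f_closed[OF xy(1)] g_closed[OF xy(2)]] f.f_coatoms by simp
    also have "\<dots> \<longleftrightarrow> (\<exists>c\<in>coatoms L'. f x \<sqsubseteq>\<^bsub>L\<^esub> f c \<and> g (\<mu>' c) \<sqsubseteq>\<^bsub>U\<^esub> g y)"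
      using \<mu>' by auto
    also have "\<dots> \<longleftrightarrow> (\<exists>c\<in>coatoms L'. x \<sqsubseteq>\<^bsub>L'\<^esub> c \<and> \<mu>' c \<sqsubseteq>\<^bsub>U'\<^esub> y)"
    proof (rule bex_cong[OF refl])
      fix c assume c: "c \<in> coatoms L'"
      show "f x \<sqsubseteq>\<^bsub>L\<^esub> f c \<and> g (\<mu>' c) \<sqsubseteq>\<^bsub>U\<^esub> g y \<longleftrightarrow> x \<sqsubseteq>\<^bsub>L'\<^esub> c \<and> \<mu>' c \<sqsubseteq>\<^bsub>U'\<^esub> y"
        using f.f_le[of x c] g.f_le[of "\<mu>' c" y] xy coatom[OF c] atom[of "\<mu>' c"] \<mu>'[OF c] by simp
    qed
    finally show "(p \<circ> f) x \<sqsubseteq>\<^bsub>S\<^esub> (q \<circ> g) y \<longleftrightarrow> (\<exists>c\<in>coatoms L'. x \<sqsubseteq>\<^bsub>L'\<^esub> c \<and> \<mu>' c \<sqsubseteq>\<^bsub>U'\<^esub> y)" .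
    have "(q \<circ> g) y \<sqsubseteq>\<^bsub>S\<^esub> (p \<circ> f) x \<longleftrightarrow> x \<in> coatoms L' \<and> g y = \<mu> (f x)"
      using qp_le[OF f_closed[OF xy(1)] g_closed[OF xy(2)]] f_coatom xy by simp
    also have "\<dots> \<longleftrightarrow> x \<in> coatoms L' \<and> y = \<mu>' x"
      using xy \<mu>'[of x] g.f_eq_iff[of y "\<mu>' x"] atom[of "\<mu>' x"] by auto
    finally show "(q \<circ> g) y \<sqsubseteq>\<^bsub>S\<^esub> (p \<circ> f) x \<longleftrightarrow> x \<in> coatoms L' \<and> y = \<mu>' x" .
  qed
qed

text \<open>Besides moving S to an isomorphic copy, this yields from an automorphism of S a second
  decomposition of the same S, to which \<open>rigid\<close> can be applied.\<close>

lemma pushforward: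
  assumes h: "order_iso S S' h" and S': "partial_order S'"
  shows "amalgam L U S' \<mu> (h \<circ> p) (h \<circ> q)"
proof (intro amalgam.intro amalgam_axioms.intro L.fin_lattice_axioms U.fin_lattice_axioms S' \<mu>)
  show "carrier S' = (h \<circ> p) ` (carrier L - {\<top>\<^bsub>L\<^esub>}) \<union> (h \<circ> q) ` (carrier U - {\<bottom>\<^bsub>U\<^esub>})"
    unfolding image_comp[symmetric] image_Un[symmetric] carrier_S[symmetric]
    using order_iso_bij[OF h] by (simp add: bij_betw_def)
next
  fix x x' assume x: "x \<in> carrier L - {\<top>\<^bsub>L\<^esub>}" "x' \<in> carrier L - {\<top>\<^bsub>L\<^esub>}"
  show "(h \<circ> p) x \<sqsubseteq>\<^bsub>S'\<^esub> (h \<circ> p) x' \<longleftrightarrow> x \<sqsubseteq>\<^bsub>L\<^esub> x'"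
    using order_iso_le[OF h p_closed[OF x(1)] p_closed[OF x(2)]] p_le[OF x] by simp
next
  fix y y' assume y: "y \<in> carrier U - {\<bottom>\<^bsub>U\<^esub>}" "y' \<in> carrier U - {\<bottom>\<^bsub>U\<^esub>}"
  show "(h \<circ> q) y \<sqsubseteq>\<^bsub>S'\<^esub> (h \<circ> q) y' \<longleftrightarrow> y \<sqsubseteq>\<^bsub>U\<^esub> y'"
    using order_iso_le[OF h q_closed[OF y(1)] q_closed[OF y(2)]] q_le[OF y] by simp
next
  fix x y assume xy: "x \<in> carrier L - {\<top>\<^bsub>L\<^esub>}" "y \<in> carrier U - {\<bottom>\<^bsub>U\<^esub>}"
  show "(h \<circ> p) x \<sqsubseteq>\<^bsub>S'\<^esub> (h \<circ> q) y \<longleftrightarrow> (\<exists>c\<in>coatoms L. x \<sqsubseteq>\<^bsub>L\<^esub> c \<and> \<mu> c \<sqsubseteq>\<^bsub>U\<^esub> y)"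
    using order_iso_le[OF h p_closed[OF xy(1)] q_closed[OF xy(2)]] pq_le[OF xy] by simp
  show "(h \<circ> q) y \<sqsubseteq>\<^bsub>S'\<^esub> (h \<circ> p) x \<longleftrightarrow> x \<in> coatoms L \<and> y = \<mu> x"
    using order_iso_le[OF h q_closed[OF xy(2)] p_closed[OF xy(1)]] qp_le[OF xy] by simp
qed

text \<open>All four kinds of comparison in an amalgam are expressed through L, U and the matching,
  so renaming the elements of one amalgam as those of the other preserves the order.\<close>

lemma unique:
  assumes "amalgam L U S' \<mu> p' q'"
  shows "\<exists>h. order_iso S S' h \<and> (\<forall>x\<in>carrier L - {\<top>\<^bsub>L\<^esub>}. h (p x) = p' x) \<and>
    (\<forall>y\<in>carrier U - {\<bottom>\<^bsub>U\<^esub>}. h (q y) = q' y)"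
proof -
  interpret B: amalgam L U S' \<mu> p' q' by (rule assms)
  let ?L = "carrier L - {\<top>\<^bsub>L\<^esub>}" and ?U = "carrier U - {\<bottom>\<^bsub>U\<^esub>}"
  define h where "h z = (if z \<in> p ` ?L then p' (inv_into ?L p z) else q' (inv_into ?U q z))" for z
  have hp: "h (p x) = p' x" if "x \<in> ?L" for x
    using that inv_into_f_f[OF inj_p that] by (simp add: h_def)
  have hq: "h (q y) = q' y" if y: "y \<in> ?U" for y
  proof (cases "q y \<in> p ` ?L")
    \<comment> \<open>An element of the overlap has two names. The value assigned through p is also
      the one for q, because S' identifies the same pairs.\<close>
    case True
    then obtain x where x: "x \<in> ?L" "p x = q y" by (metis imageE)
    then have "x \<in> coatoms L" "y = \<mu> x" using p_eq_q_iff[OF x(1) y] by auto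
    then show ?thesis using hp[OF x(1)] x B.p_coatom by simp
  next
    case False
    then show ?thesis using inv_into_f_f[OF inj_q y] by (simp add: h_def)
  qed
  have h_le: "h u \<sqsubseteq>\<^bsub>S'\<^esub> h v \<longleftrightarrow> u \<sqsubseteq>\<^bsub>S\<^esub> v" if u: "u \<in> carrier S" and v: "v \<in> carrier S" for u v
    using u
  proof (cases u rule: cases_S)
    case u: (p x)
    show ?thesis using v
    proof (cases v rule: cases_S)
      case (p x')
      then show ?thesis using u p_le[of x x'] B.p_le[of x x'] hp by simp
    next
      case (q y)
      then show ?thesis using u pq_le[of x y] B.pq_le[of x y] hp hq by simp
    qed
  next
    case u: (q y)
    show ?thesis using v
    proof (cases v rule: cases_S)
      case (p x)
      then show ?thesis using u qp_le[of x y] B.qp_le[of x y] hp hq by simp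
    next
      case (q y')
      then show ?thesis using u q_le[of y y'] B.q_le[of y y'] hq by simp
    qed
  qed
  have h_image: "h ` carrier S = carrier S'"
  proof -
    have "h ` p ` ?L = p' ` ?L" unfolding image_image by (rule image_cong[OF refl hp])
    moreover have "h ` q ` ?U = q' ` ?U" unfolding image_image by (rule image_cong[OF refl hq])
    ultimately show ?thesis
      unfolding carrier_S B.carrier_S image_Un by simp
  qed
  have "inj_on h (carrier S)"
  proof (rule inj_onI)
    fix u v assume uv: "u \<in> carrier S" "v \<in> carrier S" "h u = h v"
    then have "h u \<in> carrier S'" using h_image by blast
    then have "u \<sqsubseteq>\<^bsub>S\<^esub> v" "v \<sqsubseteq>\<^bsub>S\<^esub> u"
      using h_le[OF uv(1,2)] h_le[OF uv(2,1)] uv(3) B.S.le_refl[of "h u"] by auto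
    then show "u = v" using uv S.le_antisym by blast
  qed
  then have "bij_betw h (carrier S) (carrier S')"
    using h_image by (simp add: bij_betw_def)
  then have "order_iso S S' h"
    by (intro order_isoI h_le S.weak_partial_order_axioms B.S.weak_partial_order_axioms)
  then show ?thesis using hp hq by blast
qed

text \<open>Values of the matching outside the coatoms are irrelevant; this later reduces arbitrary
  matchings to two fixed ones.\<close>

lemma reindex:
  assumes "\<And>c. c \<in> coatoms L \<Longrightarrow> \<mu>' c = \<mu> c"
  shows "amalgam L U S \<mu>' p q"
proof -
  have "amalgam L U S \<mu>' (p \<circ> id) (q \<circ> id)"
    by (rule pullback[OF order_iso_id order_iso_id L.fin_lattice_axioms U.fin_lattice_axioms])
      (simp_all add: assms \<mu>_atom L.weak_partial_order_axioms U.weak_partial_order_axioms)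
  then show ?thesis by simp
qed

end

text \<open>Both decompositions have the same k, so each identifies L with \<open>low_at S k\<close>
  and U with \<open>up_at S k\<close>. Going forth by one and back by the other gives automorphisms
  of L and U, and these agree on the overlap, where both describe the same elements of S.\<close>

lemma (in graded_amalgam) rigid:
  assumes "graded_amalgam L U S \<mu>' p' q'"
  shows "\<exists>\<alpha> \<beta>. automorphism L \<alpha> \<and> automorphism U \<beta> \<and>
    (\<forall>y\<in>carrier U - {\<bottom>\<^bsub>U\<^esub>}. q y = q' (\<beta> y)) \<and> (\<forall>c\<in>coatoms L. \<beta> (\<mu> c) = \<mu>' (\<alpha> c))"
proof -
  interpret B: graded_amalgam L U S \<mu>' p' q' by (rule assms)
  let ?f = "\<lambda>x. if x = \<top>\<^bsub>L\<^esub> then \<top>\<^bsub>S\<^esub> else p x" and ?f' = "\<lambda>x. if x = \<top>\<^bsub>L\<^esub> then \<top>\<^bsub>S\<^esub> else p' x"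
  let ?g = "\<lambda>x. if x = \<bottom>\<^bsub>U\<^esub> then \<bottom>\<^bsub>S\<^esub> else q x" and ?g' = "\<lambda>x. if x = \<bottom>\<^bsub>U\<^esub> then \<bottom>\<^bsub>S\<^esub> else q' x"
  note f' = B.iso_low and g' = B.iso_up
  define \<alpha> where "\<alpha> = iso_inv L ?f' \<circ> ?f"
  define \<beta> where "\<beta> = iso_inv U ?g' \<circ> ?g"
  have \<alpha>: "automorphism L \<alpha>"
    unfolding \<alpha>_def by (rule order_iso_comp[OF iso_low order_iso_inv[OF f']])
  have \<beta>: "automorphism U \<beta>"
    unfolding \<beta>_def by (rule order_iso_comp[OF iso_up order_iso_inv[OF g']])
  have f\<alpha>: "?f' (\<alpha> x) = ?f x" if "x \<in> carrier L" for x
    unfolding \<alpha>_def o_apply using iso_inv_right[OF f' order_iso_closed[OF iso_low that]] .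
  have g\<beta>: "?g' (\<beta> x) = ?g x" if "x \<in> carrier U" for x
    unfolding \<beta>_def o_apply using iso_inv_right[OF g' order_iso_closed[OF iso_up that]] .
  interpret \<alpha>: lattice_iso L L \<alpha>
    by (rule lattice_isoI[OF L.fin_lattice_axioms L.fin_lattice_axioms \<alpha>])
  interpret \<beta>: lattice_iso U U \<beta>
    by (rule lattice_isoI[OF U.fin_lattice_axioms U.fin_lattice_axioms \<beta>])
  have \<alpha>_closed: "\<alpha> x \<in> carrier L - {\<top>\<^bsub>L\<^esub>}" if "x \<in> carrier L - {\<top>\<^bsub>L\<^esub>}" for x
    using that \<alpha>.f_closed[of x] \<alpha>.f_eq_iff[of x "\<top>\<^bsub>L\<^esub>"] \<alpha>.f_top by auto
  have \<beta>_closed: "\<beta> x \<in> carrier U - {\<bottom>\<^bsub>U\<^esub>}" if "x \<in> carrier U - {\<bottom>\<^bsub>U\<^esub>}" for x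
    using that \<beta>.f_closed[of x] \<beta>.f_eq_iff[of x "\<bottom>\<^bsub>U\<^esub>"] \<beta>.f_bottom by auto
  have p\<alpha>: "p x = p' (\<alpha> x)" if "x \<in> carrier L - {\<top>\<^bsub>L\<^esub>}" for x
    using f\<alpha>[of x] that \<alpha>_closed[OF that] by auto
  have q\<beta>: "q y = q' (\<beta> y)" if "y \<in> carrier U - {\<bottom>\<^bsub>U\<^esub>}" for y
    using g\<beta>[of y] that \<beta>_closed[OF that] by auto
  have "\<beta> (\<mu> c) = \<mu>' (\<alpha> c)" if c: "c \<in> coatoms L" for c
  proof -
    have "q' (\<beta> (\<mu> c)) = q (\<mu> c)" using q\<beta>[OF atom_closed[OF \<mu>_atom[OF c]]] by simp
    also have "\<dots> = p c" using p_coatom[OF c] by simp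
    also have "\<dots> = p' (\<alpha> c)" using p\<alpha>[OF coatom_closed[OF c]] .
    finally show ?thesis
      using B.p_eq_q_iff[OF \<alpha>_closed[OF coatom_closed[OF c]] \<beta>_closed[OF atom_closed[OF \<mu>_atom[OF c]]]]
      by simp
  qed
  then show ?thesis using \<alpha> \<beta> q\<beta> by blast
qed

text \<open>No matching occurs here: both sums of L and U therefore have the same symmetry of
  coatoms.\<close>

definition inherits_symmetry :: "'a gorder \<Rightarrow> 'b gorder \<Rightarrow> bool" where
  "inherits_symmetry L U \<longleftrightarrow> (\<exists>\<beta>. automorphism U \<beta> \<and> swaps \<beta> (coatoms U) \<and>
     (leaves_fixed \<beta> (atoms U) \<or> coatoms_symmetric L))"

lemma coatoms_swaps_or_fixes:
  assumes "fin_lattice L" "card (coatoms L) = 2" "automorphism L f"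
  shows "swaps f (coatoms L) \<or> leaves_fixed f (coatoms L)"
proof (rule swaps_or_fixes[OF assms(2)])
  interpret fin_lattice L by (rule assms(1))
  show "f ` coatoms L \<subseteq> coatoms L" by (intro image_subsetI automorphism_coatoms[OF assms(1,3)])
  show "inj_on f (coatoms L)"
    by (rule inj_on_subset[OF bij_betw_imp_inj_on[OF order_iso_bij[OF assms(3)]]]) (auto simp: coatom_iff)
qed

lemma atoms_swaps_or_fixes:
  assumes "fin_lattice L" "card (atoms L) = 2" "automorphism L f"
  shows "swaps f (atoms L) \<or> leaves_fixed f (atoms L)"
proof (rule swaps_or_fixes[OF assms(2)])
  interpret fin_lattice L by (rule assms(1))
  show "f ` atoms L \<subseteq> atoms L" by (intro image_subsetI automorphism_atoms[OF assms(1,3)])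
  show "inj_on f (atoms L)"
    by (rule inj_on_subset[OF bij_betw_imp_inj_on[OF order_iso_bij[OF assms(3)]]]) (auto simp: atom_iff)
qed

context graded_amalgam
begin

text \<open>Composing the embeddings with an automorphism h gives a second decomposition of S along
  the same matching, from which \<open>rigid\<close> reads off \<open>\<alpha>\<close> and
  \<open>\<beta>\<close>. Conversely, a compatible pair gives a second decomposition by
  \<open>pullback\<close>, and \<open>unique\<close> turns it into an automorphism.\<close>

lemma automorphism_S_iff:
  "(\<exists>h. automorphism S h \<and> swaps h (coatoms S)) \<longleftrightarrow>
   (\<exists>\<alpha> \<beta>. automorphism L \<alpha> \<and> automorphism U \<beta> \<and> (\<forall>c\<in>coatoms L. \<beta> (\<mu> c) = \<mu> (\<alpha> c)) \<and> swaps \<beta> (coatoms U))"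
proof
  assume "\<exists>h. automorphism S h \<and> swaps h (coatoms S)"
  then obtain h where h: "automorphism S h" "swaps h (coatoms S)" by blast
  interpret H: graded_amalgam L U S \<mu> "h \<circ> p" "h \<circ> q"
    using pushforward[OF h(1) S.partial_order_axioms] graded_amalgam_axioms
    by (simp add: graded_amalgam_def)
  obtain \<alpha> \<beta> where \<alpha>\<beta>: "automorphism L \<alpha>" "automorphism U \<beta>"
    "\<forall>y\<in>carrier U - {\<bottom>\<^bsub>U\<^esub>}. (h \<circ> q) y = q (\<beta> y)"
    "\<forall>c\<in>coatoms L. \<beta> (\<mu> c) = \<mu> (\<alpha> c)"
    using H.rigid[OF graded_amalgam_axioms] by blast
  have "card (coatoms U) = 2"
    using h(2) card_coatoms_S by (auto simp: swaps_def)
  \<comment> \<open>The coatoms of S are the images of those of U, so a coatom fixed by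
    \<open>\<beta>\<close> would make h fix its image.\<close>
  moreover have "\<beta> u \<in> coatoms U \<and> \<beta> u \<noteq> u" if u: "u \<in> coatoms U" for u
  proof -
    have "q u \<in> coatoms S" using u coatoms_S by blast
    then have "h (q u) \<noteq> q u" using swaps_moves[OF h(2)] by blast
    then have "\<beta> u \<noteq> u" using bspec[OF \<alpha>\<beta>(3), of u] u coatoms_U by (metis comp_apply subsetD)
    then show ?thesis using automorphism_coatoms[OF U.fin_lattice_axioms \<alpha>\<beta>(2) u] by blast
  qed
  ultimately have "swaps \<beta> (coatoms U)" by (intro swapsI) blast+
  then show "\<exists>\<alpha> \<beta>. automorphism L \<alpha> \<and> automorphism U \<beta> \<and> (\<forall>c\<in>coatoms L. \<beta> (\<mu> c) = \<mu> (\<alpha> c)) \<and> swaps \<beta> (coatoms U)"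
    using \<alpha>\<beta> by blast
next
  assume "\<exists>\<alpha> \<beta>. automorphism L \<alpha> \<and> automorphism U \<beta> \<and> (\<forall>c\<in>coatoms L. \<beta> (\<mu> c) = \<mu> (\<alpha> c)) \<and> swaps \<beta> (coatoms U)"
  then obtain \<alpha> \<beta> where \<alpha>\<beta>: "automorphism L \<alpha>" "automorphism U \<beta>"
    "\<forall>c\<in>coatoms L. \<beta> (\<mu> c) = \<mu> (\<alpha> c)" "swaps \<beta> (coatoms U)" by blast
  have "amalgam L U S \<mu> (p \<circ> \<alpha>) (q \<circ> \<beta>)"
    by (rule pullback[OF \<alpha>\<beta>(1,2) L.fin_lattice_axioms U.fin_lattice_axioms]) (simp add: \<mu>_atom \<alpha>\<beta>(3))
  then obtain h where h: "automorphism S h"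
    "\<forall>y\<in>carrier U - {\<bottom>\<^bsub>U\<^esub>}. h (q y) = (q \<circ> \<beta>) y"
    using unique by blast
  obtain u v where uv: "u \<noteq> v" "coatoms U = {u, v}" "\<beta> u = v" "\<beta> v = u"
    using \<alpha>\<beta>(4) by (auto simp: swaps_def)
  then have c: "u \<in> carrier U - {\<bottom>\<^bsub>U\<^esub>}" "v \<in> carrier U - {\<bottom>\<^bsub>U\<^esub>}" using coatoms_U by auto
  then have "coatoms S = {q u, q v}" "h (q u) = q v" "h (q v) = q u" "q u \<noteq> q v"
    using uv h(2) coatoms_S q_eq_iff[OF c] by auto
  then show "\<exists>h. automorphism S h \<and> swaps h (coatoms S)"
    using h(1) unfolding swaps_def by blast
qed

text \<open>Compatibility means that \<open>\<alpha>\<close> acts on the coatoms of L as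
  \<open>\<beta>\<close> acts on the atoms of U. On two elements this only says that both swap or
  both fix; in the latter case the identity can serve as \<open>\<alpha>\<close>.\<close>

lemma coatoms_symmetric_S:
  assumes "card (coatoms L) = 2"
  shows "coatoms_symmetric S \<longleftrightarrow> inherits_symmetry L U"
proof
  assume "coatoms_symmetric S"
  then obtain \<alpha> \<beta> where \<alpha>\<beta>: "automorphism L \<alpha>" "automorphism U \<beta>"
    "\<forall>c\<in>coatoms L. \<beta> (\<mu> c) = \<mu> (\<alpha> c)" "swaps \<beta> (coatoms U)"
    using automorphism_S_iff by (auto simp: coatoms_symmetric_def)
  show "inherits_symmetry L U"
  proof (cases "leaves_fixed \<beta> (atoms U)")
    case True
    then show ?thesis using \<alpha>\<beta> by (auto simp: inherits_symmetry_def)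
  next
    \<comment> \<open>Now \<open>\<beta>\<close> moves an atom, so \<open>\<alpha>\<close> must move
      the coatom matched with it.\<close>
    case False
    have "swaps \<alpha> (coatoms L)"
    proof (rule ccontr)
      assume "\<not> swaps \<alpha> (coatoms L)"
      then have fixed: "\<alpha> c = c" if "c \<in> coatoms L" for c
        using coatoms_swaps_or_fixes[OF L.fin_lattice_axioms assms \<alpha>\<beta>(1)] that by (auto simp: leaves_fixed_def)
      have "\<beta> a = a" if a: "a \<in> atoms U" for a
      proof -
        obtain c where "c \<in> coatoms L" "a = \<mu> c" using atom_\<mu>[OF a] by blast
        then show ?thesis using \<alpha>\<beta>(3) fixed by simp
      qed
      then show False using False by (simp add: leaves_fixed_def)
    qed
    then show ?thesis using \<alpha>\<beta> assms unfolding inherits_symmetry_def coatoms_symmetric_def by blast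
  qed
next
  assume "inherits_symmetry L U"
  then obtain \<beta> where \<beta>: "automorphism U \<beta>" "swaps \<beta> (coatoms U)"
    "leaves_fixed \<beta> (atoms U) \<or> coatoms_symmetric L"
    by (auto simp: inherits_symmetry_def)
  have "\<exists>\<alpha>. automorphism L \<alpha> \<and> (\<forall>c\<in>coatoms L. \<beta> (\<mu> c) = \<mu> (\<alpha> c))"
  proof (cases "leaves_fixed \<beta> (atoms U)")
    case True
    then show ?thesis
      using order_iso_id[OF L.weak_partial_order_axioms] \<mu>_atom
      by (intro exI[of _ id]) (simp add: leaves_fixed_def)
  next
    case False
    then have sw: "swaps \<beta> (atoms U)"
      using atoms_swaps_or_fixes[OF U.fin_lattice_axioms _ \<beta>(1)] assms card_coatoms_L by simp
    obtain \<alpha> where \<alpha>: "automorphism L \<alpha>" "swaps \<alpha> (coatoms L)"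
      using False \<beta>(3) by (auto simp: coatoms_symmetric_def)
    \<comment> \<open>Both sides are the atom different from the one matched with c.\<close>
    have "\<beta> (\<mu> c) = \<mu> (\<alpha> c)" if c: "c \<in> coatoms L" for c
    proof (rule swapsD[OF sw])
      have ac: "\<alpha> c \<in> coatoms L" "\<alpha> c \<noteq> c" using swaps_moves[OF \<alpha>(2) c] by auto
      then show "\<mu> c \<in> atoms U" "\<mu> (\<alpha> c) \<in> atoms U" "\<mu> c \<noteq> \<mu> (\<alpha> c)"
        using c \<mu>_atom \<mu> by (auto simp: bij_betw_def inj_on_eq_iff)
    qed
    then show ?thesis using \<alpha> by blast
  qed
  then have "\<exists>h. automorphism S h \<and> swaps h (coatoms S)"
    using \<beta> automorphism_S_iff by blast
  moreover have "card (coatoms S) = 2"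
    using \<beta>(2) card_coatoms_S by (auto simp: swaps_def)
  ultimately show "coatoms_symmetric S" by (simp add: coatoms_symmetric_def)
qed

text \<open>Two decompositions of the same \<open>S\<close> differ by automorphisms of \<open>L\<close> and \<open>U\<close>; if the
  matchings differ, one of these has to be a swap.\<close>

lemma both_matchings_iff:
  assumes card: "card (coatoms L) = 2"
    and \<mu>': "\<And>c. c \<in> coatoms L \<Longrightarrow> \<mu>' c \<in> atoms U \<and> \<mu>' c \<noteq> \<mu> c"
  shows "(\<exists>p' q'. amalgam L U S \<mu>' p' q') \<longleftrightarrow> coatoms_symmetric L \<or> atoms_symmetric U"
proof
  assume "\<exists>p' q'. amalgam L U S \<mu>' p' q'"
  then obtain p' q' where "amalgam L U S \<mu>' p' q'" by blast
  then have "graded_amalgam L U S \<mu>' p' q'"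
    using graded_amalgam_axioms by (simp add: graded_amalgam_def)
  then obtain \<alpha> \<beta> where \<alpha>\<beta>: "automorphism L \<alpha>" "automorphism U \<beta>"
    "\<forall>c\<in>coatoms L. \<beta> (\<mu> c) = \<mu>' (\<alpha> c)"
    using rigid by blast
  show "coatoms_symmetric L \<or> atoms_symmetric U"
  proof (rule ccontr)
    assume "\<not> (coatoms_symmetric L \<or> atoms_symmetric U)"
    then have "leaves_fixed \<alpha> (coatoms L)" "leaves_fixed \<beta> (atoms U)"
      using coatoms_swaps_or_fixes[OF L.fin_lattice_axioms card \<alpha>\<beta>(1)]
        atoms_swaps_or_fixes[OF U.fin_lattice_axioms _ \<alpha>\<beta>(2)] \<alpha>\<beta> card card_coatoms_L
      unfolding coatoms_symmetric_def atoms_symmetric_def by auto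
    moreover obtain c where "c \<in> coatoms L" using card by fastforce
    ultimately show False
      using \<alpha>\<beta>(3) \<mu>'[of c] \<mu>_atom by (simp add: leaves_fixed_def)
  qed
next
  assume "coatoms_symmetric L \<or> atoms_symmetric U"
  then show "\<exists>p' q'. amalgam L U S \<mu>' p' q'"
  proof
    assume "coatoms_symmetric L"
    then obtain \<alpha> where \<alpha>: "automorphism L \<alpha>" "swaps \<alpha> (coatoms L)"
      by (auto simp: coatoms_symmetric_def)
    have "amalgam L U S \<mu>' (p \<circ> \<alpha>) (q \<circ> id)"
    proof (rule pullback[OF \<alpha>(1) order_iso_id[OF U.weak_partial_order_axioms] L.fin_lattice_axioms U.fin_lattice_axioms])
      fix c assume c: "c \<in> coatoms L"
      then have ac: "\<alpha> c \<in> coatoms L" "\<alpha> c \<noteq> c" using swaps_moves[OF \<alpha>(2) c] by auto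
      have "card (atoms U) = 2" using card card_coatoms_L by simp
      moreover have "\<mu> (\<alpha> c) \<noteq> \<mu> c" using ac c \<mu> by (auto simp: bij_betw_def inj_on_eq_iff)
      \<comment> \<open>Of the two atoms only one differs from \<open>\<mu> c\<close>.\<close>
      ultimately have "\<mu>' c = \<mu> (\<alpha> c)"
        using \<mu>'[OF c] \<mu>_atom[OF c] \<mu>_atom[OF ac(1)] by (auto simp: card_2_iff)
      then show "\<mu>' c \<in> atoms U \<and> id (\<mu>' c) = \<mu> (\<alpha> c)" using \<mu>'[OF c] by simp
    qed
    then show ?thesis by blast
  next
    assume "atoms_symmetric U"
    then obtain \<beta> where \<beta>: "automorphism U \<beta>" "swaps \<beta> (atoms U)"
      by (auto simp: atoms_symmetric_def)
    have "amalgam L U S \<mu>' (p \<circ> id) (q \<circ> \<beta>)"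
    proof (rule pullback[OF order_iso_id[OF L.weak_partial_order_axioms] \<beta>(1) L.fin_lattice_axioms U.fin_lattice_axioms])
      fix c assume c: "c \<in> coatoms L"
      then show "\<mu>' c \<in> atoms U \<and> \<beta> (\<mu>' c) = \<mu> (id c)"
        using \<mu>'[OF c] \<mu>_atom[OF c] swapsD[OF \<beta>(2), of "\<mu>' c" "\<mu> c"] by simp
    qed
    then show ?thesis by blast
  qed
qed

end

section \<open>Invariance of the symmetry types\<close>

context lattice_iso
begin

text \<open>The conjugate of the automorphism by f; every notion of symmetry is carried along
  isomorphisms in this way.\<close>

lemma conjugate:
  assumes "automorphism L \<alpha>"
  shows "\<exists>\<beta>. automorphism M \<beta> \<and> (\<forall>x\<in>carrier L. \<beta> (f x) = f (\<alpha> x))"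
proof (intro exI conjI ballI)
  let ?\<beta> = "(f \<circ> \<alpha>) \<circ> iso_inv L f"
  show "automorphism M ?\<beta>"
    by (rule order_iso_comp[OF order_iso_inv[OF iso] order_iso_comp[OF assms iso]])
  show "?\<beta> (f x) = f (\<alpha> x)" if "x \<in> carrier L" for x
    using iso_inv_left[OF iso that] by simp
qed

lemma conjugate_swaps:
  assumes "A \<subseteq> carrier L" "\<forall>x\<in>carrier L. \<beta> (f x) = f (\<alpha> x)" "swaps \<alpha> A"
  shows "swaps \<beta> (f ` A)"
proof -
  obtain x y where "x \<noteq> y" "A = {x, y}" "\<alpha> x = y" "\<alpha> y = x"
    using assms(3) unfolding swaps_def by blast
  then show ?thesis
    using assms(1,2) f_eq_iff[of x y] unfolding swaps_def by (intro exI[of _ "f x"] exI[of _ "f y"]) simp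
qed

lemma conjugate_fixes:
  assumes "A \<subseteq> carrier L" "\<forall>x\<in>carrier L. \<beta> (f x) = f (\<alpha> x)" "leaves_fixed \<alpha> A"
  shows "leaves_fixed \<beta> (f ` A)"
  using assms unfolding leaves_fixed_def by (simp add: subset_iff)

lemma atoms_carrier: "atoms L \<subseteq> carrier L" and coatoms_carrier: "coatoms L \<subseteq> carrier L"
  by (auto simp: L.atom_iff L.coatom_iff)

lemma atoms_symmetric_mono: "atoms_symmetric L \<Longrightarrow> atoms_symmetric M"
proof -
  assume "atoms_symmetric L"
  then obtain \<alpha> where \<alpha>: "card (atoms L) = 2" "automorphism L \<alpha>" "swaps \<alpha> (atoms L)"
    unfolding atoms_symmetric_def by blast
  obtain \<beta> where "automorphism M \<beta>" "\<forall>x\<in>carrier L. \<beta> (f x) = f (\<alpha> x)"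
    using conjugate[OF \<alpha>(2)] by blast
  then show ?thesis
    using conjugate_swaps[OF atoms_carrier _ \<alpha>(3)] \<alpha>(1) card_atoms
    unfolding atoms_symmetric_def f_atoms by auto
qed

lemma coatoms_symmetric_mono: "coatoms_symmetric L \<Longrightarrow> coatoms_symmetric M"
proof -
  assume "coatoms_symmetric L"
  then obtain \<alpha> where \<alpha>: "card (coatoms L) = 2" "automorphism L \<alpha>" "swaps \<alpha> (coatoms L)"
    unfolding coatoms_symmetric_def by blast
  obtain \<beta> where "automorphism M \<beta>" "\<forall>x\<in>carrier L. \<beta> (f x) = f (\<alpha> x)"
    using conjugate[OF \<alpha>(2)] by blast
  then show ?thesis
    using conjugate_swaps[OF coatoms_carrier _ \<alpha>(3)] \<alpha>(1) card_coatoms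
    unfolding coatoms_symmetric_def f_coatoms by auto
qed

end

text \<open>One half of the definition of MX. Together with \<open>atoms_symmetric\<close> and
  \<open>coatoms_symmetric\<close> it suffices to tell the five types of middle pieces apart, which
  turns the counting into propositional case distinctions.\<close>

definition swaps_coatoms_only :: "'a gorder \<Rightarrow> bool" where
  "swaps_coatoms_only L \<longleftrightarrow> (\<exists>f. automorphism L f \<and> swaps f (coatoms L) \<and> leaves_fixed f (atoms L))"

lemma (in lattice_iso) swaps_coatoms_only_mono: "swaps_coatoms_only L \<Longrightarrow> swaps_coatoms_only M"
proof -
  assume "swaps_coatoms_only L"
  then obtain \<alpha> where \<alpha>: "automorphism L \<alpha>" "swaps \<alpha> (coatoms L)" "leaves_fixed \<alpha> (atoms L)"
    unfolding swaps_coatoms_only_def by blast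
  obtain \<beta> where "automorphism M \<beta>" "\<forall>x\<in>carrier L. \<beta> (f x) = f (\<alpha> x)"
    using conjugate[OF \<alpha>(1)] by blast
  then show ?thesis
    using conjugate_swaps[OF coatoms_carrier _ \<alpha>(2)] conjugate_fixes[OF atoms_carrier _ \<alpha>(3)]
    unfolding swaps_coatoms_only_def f_coatoms f_atoms by blast
qed

lemma swaps_coatoms_onlyD: "swaps_coatoms_only L \<Longrightarrow> coatoms_symmetric L"
  unfolding swaps_coatoms_only_def coatoms_symmetric_def using swaps_card by blast

text \<open>If no automorphism swaps the two atoms, then one that swaps the coatoms has to fix both
  atoms.\<close>

lemma fixed_atoms_swaps_coatoms_only:
  assumes "fin_lattice L" "card (atoms L) = 2" "coatoms_symmetric L" "\<not> atoms_symmetric L"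
  shows "swaps_coatoms_only L"
proof -
  obtain f where f: "automorphism L f" "swaps f (coatoms L)"
    using assms(3) unfolding coatoms_symmetric_def by blast
  then have "leaves_fixed f (atoms L)"
    using atoms_swaps_or_fixes[OF assms(1,2) f(1)] assms(2,4) unfolding atoms_symmetric_def by blast
  then show ?thesis using f unfolding swaps_coatoms_only_def by blast
qed

text \<open>If the automorphism that swaps the atoms also swaps the coatoms, composing it with one
  that swaps the coatoms alone undoes the latter swap.\<close>

lemma type_MX_iff:
  assumes L: "fin_lattice L"
  shows "type_MX L \<longleftrightarrow> middle_piece L \<and> atoms_symmetric L \<and> swaps_coatoms_only L"
proof
  assume "type_MX L"
  then show "middle_piece L \<and> atoms_symmetric L \<and> swaps_coatoms_only L"
    unfolding type_MX_def atoms_symmetric_def swaps_coatoms_only_def using swaps_card by blast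
next
  assume R: "middle_piece L \<and> atoms_symmetric L \<and> swaps_coatoms_only L"
  obtain f where f: "automorphism L f" "swaps f (atoms L)"
    using R unfolding atoms_symmetric_def by blast
  obtain g where g: "automorphism L g" "swaps g (coatoms L)" "leaves_fixed g (atoms L)"
    using R unfolding swaps_coatoms_only_def by blast
  have "\<exists>h. automorphism L h \<and> swaps h (atoms L) \<and> leaves_fixed h (coatoms L)"
  proof (cases "leaves_fixed f (coatoms L)")
    case True
    then show ?thesis using f by blast
  next
    case False
    then have "swaps f (coatoms L)"
      using coatoms_swaps_or_fixes[OF L swaps_card[OF g(2)] f(1)] by blast
    then have "leaves_fixed (f \<circ> g) (coatoms L)" using g(2) by (rule swaps_comp_swaps)
    moreover have "swaps (f \<circ> g) (atoms L)" using f(2) g(3) by (rule swaps_comp_fixes)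
    moreover have "automorphism L (f \<circ> g)" using order_iso_comp[OF g(1) f(1)] .
    ultimately show ?thesis by blast
  qed
  then show "type_MX L" using R g unfolding type_MX_def by blast
qed

text \<open>When the coatoms cannot be swapped alone, each automorphism swapping them swaps the
  atoms too.\<close>

lemma type_MH_iff:
  assumes L: "fin_lattice L"
  shows "type_MH L \<longleftrightarrow> middle_piece L \<and> atoms_symmetric L \<and> coatoms_symmetric L \<and> \<not> swaps_coatoms_only L"
proof
  assume "type_MH L"
  then obtain f where f: "middle_piece L" "\<not> type_MX L" "automorphism L f" "swaps f (atoms L)" "swaps f (coatoms L)"
    unfolding type_MH_def by blast
  then have "atoms_symmetric L" "coatoms_symmetric L"
    unfolding atoms_symmetric_def coatoms_symmetric_def using swaps_card by blast+
  then show "middle_piece L \<and> atoms_symmetric L \<and> coatoms_symmetric L \<and> \<not> swaps_coatoms_only L"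
    using f type_MX_iff[OF L] by blast
next
  assume R: "middle_piece L \<and> atoms_symmetric L \<and> coatoms_symmetric L \<and> \<not> swaps_coatoms_only L"
  obtain f where f: "automorphism L f" "swaps f (coatoms L)"
    using R unfolding coatoms_symmetric_def by blast
  then have "\<not> leaves_fixed f (atoms L)" using R unfolding swaps_coatoms_only_def by blast
  then have "swaps f (atoms L)"
    using atoms_swaps_or_fixes[OF L _ f(1)] R unfolding atoms_symmetric_def by blast
  then show "type_MH L"
    using R f type_MX_iff[OF L] unfolding type_MH_def by blast
qed

text \<open>With symmetric coatoms in L every swap of the coatoms of U can be compensated; otherwise
  it must fix the atoms of U. So L matters only through the symmetry of its coatoms, which is why
  its types are collected in \<open>LF\<close> and \<open>LS\<close>.\<close>

lemma inherits_symmetry_iff: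
  "inherits_symmetry L U \<longleftrightarrow> (if coatoms_symmetric L then coatoms_symmetric U else swaps_coatoms_only U)"
  unfolding inherits_symmetry_def swaps_coatoms_only_def coatoms_symmetric_def using swaps_card by auto

lemma order_iso_lattice_iso:
  "fin_lattice L \<Longrightarrow> fin_lattice M \<Longrightarrow> isomorphic L M \<Longrightarrow> \<exists>f. lattice_iso L M f"
  unfolding isomorphic_def using lattice_isoI by blast

lemma symmetric_iff:
  assumes "fin_lattice L" "fin_lattice M" "isomorphic L M"
  shows "atoms_symmetric L \<longleftrightarrow> atoms_symmetric M" "coatoms_symmetric L \<longleftrightarrow> coatoms_symmetric M"
    "swaps_coatoms_only L \<longleftrightarrow> swaps_coatoms_only M"
proof -
  obtain f g where "lattice_iso L M f" "lattice_iso M L g"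
    using order_iso_lattice_iso[OF assms] order_iso_lattice_iso[OF assms(2,1) isomorphic_sym[OF assms(3)]] by blast
  then show "atoms_symmetric L \<longleftrightarrow> atoms_symmetric M" "coatoms_symmetric L \<longleftrightarrow> coatoms_symmetric M"
    "swaps_coatoms_only L \<longleftrightarrow> swaps_coatoms_only M"
    by (blast intro: lattice_iso.atoms_symmetric_mono lattice_iso.coatoms_symmetric_mono lattice_iso.swaps_coatoms_only_mono)+
qed

lemma invariants:
  assumes "graded_lattice L" "graded_lattice M" "isomorphic L M"
  shows "rank L \<top>\<^bsub>L\<^esub> = rank M \<top>\<^bsub>M\<^esub>" "necks L = necks M"
    "card (atoms L) = card (atoms M)" "card (coatoms L) = card (coatoms M)"
proof -
  obtain f where f: "order_iso L M f" using assms(3) unfolding isomorphic_def by blast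
  interpret L: graded_lattice L by (rule assms(1))
  interpret M: graded_lattice M by (rule assms(2))
  interpret graded_iso L M f
    using lattice_isoI[OF L.fin_lattice_axioms M.fin_lattice_axioms f] assms(1,2)
    by (rule graded_iso.intro)
  show "rank L \<top>\<^bsub>L\<^esub> = rank M \<top>\<^bsub>M\<^esub>" "necks L = necks M"
    "card (atoms L) = card (atoms M)" "card (coatoms L) = card (coatoms M)"
    using rank_top necks_eq card_atoms card_coatoms by simp_all
qed

text \<open>Necks are allowed here, unlike in \<open>upper_summand\<close>, since cutting at the
  topmost neck leaves the others below. So within a family the lower summands are compositions,
  bottom pieces and middle pieces, the upper ones middle pieces and top pieces.\<close>

definition lower_summand :: "'a gorder \<Rightarrow> bool" where
  "lower_summand L \<longleftrightarrow> 3 \<le> rank L \<top>\<^bsub>L\<^esub> \<and> card (coatoms L) = 2"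

definition upper_summand :: "'a gorder \<Rightarrow> bool" where
  "upper_summand L \<longleftrightarrow> 3 \<le> rank L \<top>\<^bsub>L\<^esub> \<and> card (atoms L) = 2 \<and> necks L = {}"

lemma type_iffs:
  assumes "graded_vi_lattice L"
  shows "composition L \<longleftrightarrow> necks L \<noteq> {}"
    "middle_piece L \<longleftrightarrow> upper_summand L \<and> card (coatoms L) = 2"
    "bottom_piece L \<longleftrightarrow> lower_summand L \<and> necks L = {} \<and> 3 \<le> card (atoms L)"
    "top_piece L \<longleftrightarrow> upper_summand L \<and> 3 \<le> card (coatoms L)"
proof -
  interpret graded_lattice L by (rule graded_vi_lattice_graded_lattice[OF assms])
  show "composition L \<longleftrightarrow> necks L \<noteq> {}"
    using assms by (simp add: composition_def ex_neck_iff)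
  have piece: "piece L \<longleftrightarrow> necks L = {} \<and> 3 \<le> rank L \<top>\<^bsub>L\<^esub> \<and> (card (atoms L) = 2 \<or> card (coatoms L) = 2)"
    using assms unfolding piece_def ex_neck_iff by blast
  show "middle_piece L \<longleftrightarrow> upper_summand L \<and> card (coatoms L) = 2"
    "bottom_piece L \<longleftrightarrow> lower_summand L \<and> necks L = {} \<and> 3 \<le> card (atoms L)"
    "top_piece L \<longleftrightarrow> upper_summand L \<and> 3 \<le> card (coatoms L)"
    unfolding middle_piece_def bottom_piece_def top_piece_def piece lower_summand_def upper_summand_def by auto
qed

lemma types_invariant:
  assumes L: "graded_vi_lattice L" and M: "graded_vi_lattice M" and iso: "isomorphic L M"
  shows "type_CF L \<longleftrightarrow> type_CF M" "type_CS L \<longleftrightarrow> type_CS M" "type_CN L \<longleftrightarrow> type_CN M"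
    "type_BF L \<longleftrightarrow> type_BF M" "type_BS L \<longleftrightarrow> type_BS M" "type_TF L \<longleftrightarrow> type_TF M" "type_TS L \<longleftrightarrow> type_TS M"
    "type_MF L \<longleftrightarrow> type_MF M" "type_MA L \<longleftrightarrow> type_MA M" "type_MC L \<longleftrightarrow> type_MC M"
    "type_MX L \<longleftrightarrow> type_MX M" "type_MH L \<longleftrightarrow> type_MH M"
proof -
  interpret L: graded_lattice L by (rule graded_vi_lattice_graded_lattice[OF L])
  interpret M: graded_lattice M by (rule graded_vi_lattice_graded_lattice[OF M])
  note [simp] = type_iffs[OF L] type_iffs[OF M] lower_summand_def upper_summand_def
    invariants[OF L.graded_lattice_axioms M.graded_lattice_axioms iso]
    symmetric_iff[OF L.fin_lattice_axioms M.fin_lattice_axioms iso]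
    type_MX_iff[OF L.fin_lattice_axioms] type_MX_iff[OF M.fin_lattice_axioms]
    type_MH_iff[OF L.fin_lattice_axioms] type_MH_iff[OF M.fin_lattice_axioms]
    coatoms_fixed_def atoms_fixed_def
  show "type_CF L \<longleftrightarrow> type_CF M" "type_CS L \<longleftrightarrow> type_CS M" "type_CN L \<longleftrightarrow> type_CN M"
    "type_BF L \<longleftrightarrow> type_BF M" "type_BS L \<longleftrightarrow> type_BS M" "type_TF L \<longleftrightarrow> type_TF M" "type_TS L \<longleftrightarrow> type_TS M"
    "type_MF L \<longleftrightarrow> type_MF M" "type_MA L \<longleftrightarrow> type_MA M" "type_MC L \<longleftrightarrow> type_MC M"
    unfolding type_CF_def type_CS_def type_CN_def type_BF_def type_BS_def type_TF_def type_TS_def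
      type_MF_def type_MA_def type_MC_def
    by simp_all
  show "type_MX L \<longleftrightarrow> type_MX M" "type_MH L \<longleftrightarrow> type_MH M"
    by simp_all
qed

section \<open>Decomposition at the topmost neck\<close>

locale two_summable_family =
  fixes F :: "'a gorder set"
  assumes infinite_UNIV: "infinite (UNIV :: 'a set)" and two_summable: "two_summable F"
begin

lemma graded_vi: "L \<in> F \<Longrightarrow> graded_vi_lattice L"
proof -
  have "\<forall>L\<in>F. graded_vi_lattice L"
    using two_summable unfolding two_summable_def by (elim conjE)
  then show "L \<in> F \<Longrightarrow> graded_vi_lattice L" by (rule bspec)
qed

lemma graded_lattice: "L \<in> F \<Longrightarrow> graded_lattice L"
  using graded_vi graded_vi_lattice_graded_lattice by blast

lemma vi: "L \<in> F \<Longrightarrow> vi_lattice L"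
  using graded_vi by (simp add: graded_vi_lattice_def)

lemma card_atoms_coatoms_ge:
  assumes "L \<in> F" "3 \<le> rank L \<top>\<^bsub>L\<^esub>"
  shows "2 \<le> card (atoms L)" "2 \<le> card (coatoms L)"
proof -
  interpret graded_lattice L by (rule graded_lattice[OF assms(1)])
  show "2 \<le> card (atoms L)" "2 \<le> card (coatoms L)"
    using vi_card_atoms vi_card_coatoms vi[OF assms(1)] assms(2) by auto
qed

lemma sum_in_F:
  fixes S :: "'a gorder"
  assumes "L \<in> F" "U \<in> F" "is_vertical_2sum S L U"
  shows "S \<in> F"
proof -
  have "\<forall>L\<in>F. \<forall>U\<in>F. \<forall>S :: 'a gorder. is_vertical_2sum S L U \<longrightarrow> S \<in> F"
    using two_summable unfolding two_summable_def by (elim conjE)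
  from bspec[OF bspec[OF this assms(1)] assms(2)] show ?thesis
    using assms(3) by blast
qed

lemma summands_in_F:
  fixes L U :: "'a gorder"
  assumes "S \<in> F" "is_vertical_2sum S L U"
  shows "L \<in> F" "U \<in> F"
proof -
  have "\<forall>S\<in>F. \<forall>(L :: 'a gorder) (U :: 'a gorder). is_vertical_2sum S L U \<longrightarrow> L \<in> F \<and> U \<in> F"
    using two_summable unfolding two_summable_def by (elim conjE)
  from bspec[OF this assms(1)] show "L \<in> F" "U \<in> F"
    using assms(2) by blast+
qed

lemma ex_sum:
  assumes "L \<in> F" "U \<in> F" "lower_summand L" "upper_summand U"
    and \<mu>: "bij_betw \<mu> (coatoms L) (atoms U)"
  shows "\<exists>S\<in>F. \<exists>p q. amalgam L U S \<mu> p q"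
proof -
  interpret L: graded_lattice L by (rule graded_lattice[OF assms(1)])
  interpret U: graded_lattice U by (rule graded_lattice[OF assms(2)])
  obtain S :: "'a gorder" and p q where S: "amalgam L U S \<mu> p q"
    using ex_amalgam[OF infinite_UNIV L.fin_lattice_axioms U.fin_lattice_axioms \<mu>] by metis
  have "is_vertical_2sum S L U"
    using amalgam.vertical_2sum[OF S] L.length_ge_3 U.length_ge_3 assms(3,4)
    by (simp add: lower_summand_def upper_summand_def)
  then show ?thesis using S sum_in_F[OF assms(1,2)] by blast
qed

lemma graded_amalgamI:
  assumes "L \<in> F" "U \<in> F" "S \<in> F" "lower_summand L" "upper_summand U" "amalgam L U S \<mu> p q"
  shows "graded_amalgam L U S \<mu> p q"
proof (intro graded_amalgam.intro graded_amalgam_axioms.intro assms(6))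
  show "graded_lattice L" "graded_lattice U" "graded_lattice S"
    using assms(1,2,3) by (simp_all only: graded_lattice)
  show "2 \<le> rank L \<top>\<^bsub>L\<^esub>" "2 \<le> rank U \<top>\<^bsub>U\<^esub>"
    using assms(4,5) by (simp_all add: lower_summand_def upper_summand_def)
qed

text \<open>The order of the argument matters. The lengths demanded of summands are found from
  explicit chains; then (C2) makes the two parts graded, and only after that can the necks of
  \<open>up S\<close> be compared with those of S.\<close>

lemma decompose:
  assumes S: "S \<in> F" and neck: "necks S \<noteq> {}"
  shows "low S \<in> F" "up S \<in> F" "lower_summand (low S)" "upper_summand (up S)"
    "amalgam (low S) (up S) S id id id"
proof -
  interpret S: graded_lattice S by (rule graded_lattice[OF S])
  define k where "k = cut S"
  have "k \<in> necks S"
    unfolding k_def cut_def using neck by (intro Max_in) auto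
  then have k: "2 \<le> k" "k + 2 \<le> rank S \<top>\<^bsub>S\<^esub>" "card (level S k) = 2"
    by (auto simp: necks_def)
  have maximal: "j \<le> k" if "j \<in> necks S" for j
    unfolding k_def cut_def using that by (intro Max_ge) auto
  show am: "amalgam (low S) (up S) S id id id"
    using S.amalgam_low_up[of k] k unfolding k_def by simp
  interpret amalgam "low S" "up S" S id id id by (rule am)
  have low: "\<bottom>\<^bsub>low S\<^esub> = \<bottom>\<^bsub>S\<^esub>" "\<top>\<^bsub>low S\<^esub> = \<top>\<^bsub>S\<^esub>" "coatoms (low S) = level S k"
    using S.fin_lattice_low S.coatoms_low[of k] k unfolding k_def by auto
  have up: "\<bottom>\<^bsub>up S\<^esub> = \<bottom>\<^bsub>S\<^esub>" "\<top>\<^bsub>up S\<^esub> = \<top>\<^bsub>S\<^esub>" "atoms (up S) = level S k"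
    using S.fin_lattice_up[of k] S.atoms_up[of k] k unfolding k_def by auto
  \<comment> \<open>With c in the neck, b of rank 1 below it and d one rank above it, bottom, b, c,
    top is a chain in \<open>low S\<close>, and bottom, c, d, top is one in
    \<open>up S\<close>.\<close>
  obtain c where c: "c \<in> carrier S" "rank S c = k"
  proof -
    have "level S k \<noteq> {}" using k(3) by auto
    then show thesis using that by (auto simp: level_def)
  qed
  obtain b where b: "b \<in> carrier S" "b \<sqsubseteq>\<^bsub>S\<^esub> c" "rank S b = 1"
    using S.ex_between[of "\<bottom>\<^bsub>S\<^esub>" c 1] c k by auto
  obtain d where d: "d \<in> carrier S" "c \<sqsubseteq>\<^bsub>S\<^esub> d" "rank S d = k + 1"
    using S.ex_between[of c "\<top>\<^bsub>S\<^esub>" "k + 1"] c k by auto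
  have "b \<in> carrier (low S)" "c \<in> carrier (low S)" "\<bottom>\<^bsub>low S\<^esub> \<noteq> b" "b \<sqsubseteq>\<^bsub>low S\<^esub> c" "b \<noteq> c" "c \<noteq> \<top>\<^bsub>low S\<^esub>"
  proof -
    have "b \<noteq> \<bottom>\<^bsub>S\<^esub>" "b \<noteq> c" "c \<noteq> \<top>\<^bsub>S\<^esub>"
      using b(3) c(2) k by auto
    then show "b \<in> carrier (low S)" "c \<in> carrier (low S)" "\<bottom>\<^bsub>low S\<^esub> \<noteq> b" "b \<sqsubseteq>\<^bsub>low S\<^esub> c" "b \<noteq> c" "c \<noteq> \<top>\<^bsub>low S\<^esub>"
      using b c k(1) low unfolding k_def by auto
  qed
  note low_chain = this
  have "c \<in> carrier (up S)" "d \<in> carrier (up S)" "\<bottom>\<^bsub>up S\<^esub> \<noteq> c" "c \<sqsubseteq>\<^bsub>up S\<^esub> d" "c \<noteq> d" "d \<noteq> \<top>\<^bsub>up S\<^esub>"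
  proof -
    have "c \<noteq> \<bottom>\<^bsub>S\<^esub>" "c \<noteq> d" "d \<noteq> \<top>\<^bsub>S\<^esub>"
      using d(3) c(2) k by auto
    then show "c \<in> carrier (up S)" "d \<in> carrier (up S)" "\<bottom>\<^bsub>up S\<^esub> \<noteq> c" "c \<sqsubseteq>\<^bsub>up S\<^esub> d" "c \<noteq> d" "d \<noteq> \<top>\<^bsub>up S\<^esub>"
      using d c k(1) up unfolding k_def by auto
  qed
  note up_chain = this
  have "is_vertical_2sum S (low S) (up S)"
    using vertical_2sum L.chain_length[OF low_chain] U.chain_length[OF up_chain] low k by simp
  then show F: "low S \<in> F" "up S \<in> F"
    by (rule summands_in_F[OF S])+
  interpret L: graded_lattice "low S" by (rule graded_lattice[OF F(1)])
  interpret U: graded_lattice "up S" by (rule graded_lattice[OF F(2)])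
  have rank: "3 \<le> rank (low S) \<top>\<^bsub>low S\<^esub>" "3 \<le> rank (up S) \<top>\<^bsub>up S\<^esub>"
    using L.rank_top_ge_3[OF low_chain] U.rank_top_ge_3[OF up_chain] .
  then show "lower_summand (low S)"
    using low k by (simp add: lower_summand_def)
  have "2 \<le> rank (low S) \<top>\<^bsub>low S\<^esub>" "2 \<le> rank (up S) \<top>\<^bsub>up S\<^esub>"
    using rank by linarith+
  then interpret A: graded_amalgam "low S" "up S" S id id id
    by (intro graded_amalgam.intro graded_amalgam_axioms.intro am L.graded_lattice_axioms
        U.graded_lattice_axioms S.graded_lattice_axioms)
  \<comment> \<open>The embedding preserves ranks of the lower part, so the gluing level of this
    amalgam is the cut level.\<close>
  have "c \<in> coatoms (low S)" using c low by (simp add: level_def)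
  then have "A.k = k"
    using A.rank_p[of c] A.rank_coatom[of c] coatom_closed[of c] c by simp
  \<comment> \<open>A neck of \<open>up S\<close> at rank j, at least 2, would be a neck of S at k +
    j - 1, above the topmost one.\<close>
  then have "necks (up S) = {}"
    using A.necks_above maximal by (fastforce simp: necks_def)
  then show "upper_summand (up S)"
    using rank up k by (simp add: upper_summand_def)
qed

lemma amalgam_cut:
  assumes "L \<in> F" "U \<in> F" "S \<in> F" "lower_summand L" "upper_summand U" "amalgam L U S \<mu> p q"
  shows "necks S \<noteq> {}" "isomorphic L (low S)" "isomorphic U (up S)"
proof -
  interpret graded_amalgam L U S \<mu> p q using graded_amalgamI assms by blast
  have r: "card (coatoms L) = 2" "3 \<le> rank L \<top>\<^bsub>L\<^esub>" "3 \<le> rank U \<top>\<^bsub>U\<^esub>" "necks U = {}"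
    using assms(4,5) by (auto simp: lower_summand_def upper_summand_def)
  show "necks S \<noteq> {}" using k_neck[OF r(1-3)] by blast
  show "isomorphic L (low S)" "isomorphic U (up S)"
    unfolding cut_S[OF r] isomorphic_def using iso_low iso_up by blast+
qed

text \<open>The matching of L with U is the identity on the common level of \<open>low S\<close> and
  \<open>up S\<close>, carried over by the two isomorphisms.\<close>

lemma amalgam_of_isomorphic:
  assumes "S \<in> F" "necks S \<noteq> {}" "L \<in> F" "U \<in> F" "isomorphic L (low S)" "isomorphic U (up S)"
  shows "\<exists>\<mu> p q. amalgam L U S \<mu> p q"
proof -
  interpret amalgam "low S" "up S" S id id id by (rule decompose[OF assms(1,2)])
  interpret L': graded_lattice L by (rule graded_lattice[OF assms(3)])
  interpret U': graded_lattice U by (rule graded_lattice[OF assms(4)])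
  obtain f g where f: "order_iso L (low S) f" and g: "order_iso U (up S) g"
    using assms(5,6) unfolding isomorphic_def by blast
  interpret f: lattice_iso L "low S" f by (rule lattice_isoI[OF L'.fin_lattice_axioms L.fin_lattice_axioms f])
  interpret g: lattice_iso U "up S" g by (rule lattice_isoI[OF U'.fin_lattice_axioms U.fin_lattice_axioms g])
  have "amalgam L U S (\<lambda>c. iso_inv U g (f c)) (id \<circ> f) (id \<circ> g)"
  proof (rule pullback[OF f g L'.fin_lattice_axioms U'.fin_lattice_axioms])
    fix c assume "c \<in> coatoms L"
    then have "f c \<in> atoms (up S)"
      using f.f_coatoms \<mu>_atom by auto
    then obtain a where a: "a \<in> atoms U" "f c = g a" using g.f_atoms by blast
    then show "iso_inv U g (f c) \<in> atoms U \<and> g (iso_inv U g (f c)) = id (f c)"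
      using iso_inv_left[OF g, of a] g.atoms_carrier by auto
  qed
  then show ?thesis by blast
qed

section \<open>Representatives of the isomorphism classes\<close>

text \<open>One chosen member per isomorphism class, so that counting classes becomes counting
  elements of \<open>reps\<close>.\<close>

definition rep :: "'a gorder \<Rightarrow> 'a gorder" where
  "rep L = (SOME M. M \<in> F \<and> isomorphic L M)"

definition reps :: "'a gorder set" where
  "reps = rep ` F"

lemma iso_refl: "L \<in> F \<Longrightarrow> isomorphic L L"
proof -
  assume "L \<in> F"
  then interpret graded_lattice L by (rule graded_lattice)
  show ?thesis by (rule isomorphic_refl[OF weak_partial_order_axioms])
qed

lemma rep: "L \<in> F \<Longrightarrow> rep L \<in> F \<and> isomorphic L (rep L)"
proof -
  assume "L \<in> F"
  then have "\<exists>M. M \<in> F \<and> isomorphic L M" using iso_refl[of L] by blast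
  from someI_ex[OF this] show ?thesis by (simp only: rep_def)
qed

lemma rep_eq_iff:
  assumes "L \<in> F" "M \<in> F"
  shows "rep L = rep M \<longleftrightarrow> isomorphic L M"
proof
  assume "rep L = rep M"
  then show "isomorphic L M"
    using rep[OF assms(1)] isomorphic_trans[OF _ isomorphic_sym[OF conjunct2[OF rep[OF assms(2)]]], of L] by simp
next
  assume iso: "isomorphic L M"
  \<comment> \<open>Isomorphic lattices satisfy the same predicate under the choice operator, hence
    receive the same choice.\<close>
  show "rep L = rep M" by (simp add: rep_def isomorphic_cong[OF iso])
qed

lemma rep_in_reps: "L \<in> F \<Longrightarrow> rep L \<in> reps"
  by (simp add: reps_def)

lemma reps_subset: "L \<in> reps \<Longrightarrow> L \<in> F"
  unfolding reps_def by (erule imageE) (simp add: rep)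

lemma rep_reps: "L \<in> reps \<Longrightarrow> rep L = L"
proof -
  assume "L \<in> reps"
  then obtain M where M: "M \<in> F" "L = rep M" by (auto simp: reps_def)
  then have "rep M = rep L" using rep[OF M(1)] rep_eq_iff[OF M(1), of L] by simp
  then show ?thesis using M(2) by simp
qed

lemma reps_eq: "L \<in> reps \<Longrightarrow> M \<in> reps \<Longrightarrow> isomorphic L M \<Longrightarrow> L = M"
  using rep_eq_iff[of L M] rep_reps[of L] rep_reps[of M] reps_subset by simp

text \<open>Cardinalities and sums over infinite sets would be 0, so finiteness is essential.
  Numbering the carrier turns the order into a relation on \<open>{0..<n}\<close>; equal relations
  come from isomorphic lattices, and there are finitely many.\<close>

lemma finite_reps: "finite {L \<in> reps. card (carrier L) = n}"
proof -
  let ?reps = "{L \<in> reps. card (carrier L) = n}"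
  have "\<forall>L\<in>?reps. \<exists>e. bij_betw e (carrier L) {0..<n}"
  proof
    fix L assume L: "L \<in> ?reps"
    interpret graded_lattice L by (rule graded_lattice[OF reps_subset]) (use L in simp)
    show "\<exists>e. bij_betw e (carrier L) {0..<n}"
      using ex_bij_betw_finite_nat[OF finite_carrier] L by simp
  qed
  then obtain e where "\<forall>L\<in>?reps. bij_betw (e L) (carrier L) {0..<n}"
    by (rule bchoice[THEN exE])
  then have e: "bij_betw (e L) (carrier L) {0..<n}" if "L \<in> ?reps" for L
    using that by blast
  define code where "code L = {(i, j). i < n \<and> j < n \<and>
    inv_into (carrier L) (e L) i \<sqsubseteq>\<^bsub>L\<^esub> inv_into (carrier L) (e L) j}" for L
  have code: "(e L x, e L y) \<in> code L \<longleftrightarrow> x \<sqsubseteq>\<^bsub>L\<^esub> y"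
    if "L \<in> ?reps" "x \<in> carrier L" "y \<in> carrier L" for L x y
  proof -
    have "e L x < n" "e L y < n"
      using bij_betwE[OF e[OF that(1)]] that(2,3) by auto
    then show ?thesis
      using bij_betw_inv_into_left[OF e[OF that(1)] that(2)] bij_betw_inv_into_left[OF e[OF that(1)] that(3)]
      by (simp add: code_def)
  qed
  have "inj_on code ?reps"
  proof (rule inj_onI)
    fix L M assume LM: "L \<in> ?reps" "M \<in> ?reps" "code L = code M"
    interpret L: graded_lattice L by (rule graded_lattice[OF reps_subset]) (use LM in simp)
    interpret M: graded_lattice M by (rule graded_lattice[OF reps_subset]) (use LM in simp)
    let ?h = "inv_into (carrier M) (e M) \<circ> e L"
    have h: "?h x \<in> carrier M \<and> e M (?h x) = e L x" if "x \<in> carrier L" for x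
      using that bij_betwE[OF e[OF LM(1)]] bij_betwE[OF bij_betw_inv_into[OF e[OF LM(2)]]]
        bij_betw_inv_into_right[OF e[OF LM(2)]] by simp
    have "order_iso L M ?h"
    proof (rule order_isoI[OF L.weak_partial_order_axioms M.weak_partial_order_axioms])
      show "bij_betw ?h (carrier L) (carrier M)"
        by (rule bij_betw_trans[OF e[OF LM(1)] bij_betw_inv_into[OF e[OF LM(2)]]])
      fix x y assume xy: "x \<in> carrier L" "y \<in> carrier L"
      have "?h x \<sqsubseteq>\<^bsub>M\<^esub> ?h y \<longleftrightarrow> (e M (?h x), e M (?h y)) \<in> code M"
        by (rule code[OF LM(2), symmetric]) (use h[OF xy(1)] h[OF xy(2)] in simp_all)
      also have "\<dots> \<longleftrightarrow> (e L x, e L y) \<in> code L"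
        using h[OF xy(1)] h[OF xy(2)] LM(3) by simp
      also have "\<dots> \<longleftrightarrow> x \<sqsubseteq>\<^bsub>L\<^esub> y"
        using code[OF LM(1) xy] .
      finally show "?h x \<sqsubseteq>\<^bsub>M\<^esub> ?h y \<longleftrightarrow> x \<sqsubseteq>\<^bsub>L\<^esub> y" .
    qed
    then have "isomorphic L M" unfolding isomorphic_def by blast
    then show "L = M" using reps_eq[of L M] LM(1,2) by simp
  qed
  moreover have "code ` ?reps \<subseteq> Pow ({0..<n} \<times> {0..<n})"
    by (auto simp: code_def)
  then have "finite (code ` ?reps)"
    by (rule finite_subset) simp
  ultimately show ?thesis
    by (intro finite_imageD[of code ?reps])
qed

text \<open>The classes in \<open>num\<close> may reach outside the family, as
  \<open>isomorphic\<close> relates arbitrary orders on the type. Only the class of each member of F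
  is looked at, and it is determined by its representative.\<close>

lemma num_eq_card:
  assumes "\<And>L M. L \<in> F \<Longrightarrow> M \<in> F \<Longrightarrow> isomorphic L M \<Longrightarrow> T L \<longleftrightarrow> T M"
  shows "num F T n = card {L \<in> reps. card (carrier L) = n \<and> T L}"
proof -
  let ?A = "{L \<in> F. card (carrier L) = n \<and> T L}" and ?B = "{L \<in> reps. card (carrier L) = n \<and> T L}"
  let ?r = "{(L, M). isomorphic L M} :: ('a gorder \<times> 'a gorder) set"
  have cls: "?r `` {L} = ?r `` {M} \<longleftrightarrow> isomorphic L M" if "L \<in> F" "M \<in> F" for L M
  proof
    assume "?r `` {L} = ?r `` {M}"
    moreover have "M \<in> ?r `` {M}" using iso_refl[OF that(2)] by simp
    ultimately show "isomorphic L M" by (simp add: set_eq_iff)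
  next
    assume iso: "isomorphic L M"
    show "?r `` {L} = ?r `` {M}"
      by (simp add: Image_def isomorphic_cong[OF iso])
  qed
  have "bij_betw (\<lambda>L. ?r `` {L}) ?B (?A // ?r)"
  proof (rule bij_betw_imageI)
    show "inj_on (\<lambda>L. ?r `` {L}) ?B"
      using cls reps_subset reps_eq by (intro inj_onI) blast
    show "(\<lambda>L. ?r `` {L}) ` ?B = ?A // ?r"
    proof (intro equalityI subsetI)
      fix X assume "X \<in> (\<lambda>L. ?r `` {L}) ` ?B"
      then obtain L where L: "L \<in> ?B" "X = ?r `` {L}" by blast
      then have "L \<in> ?A" using reps_subset[of L] by simp
      then show "X \<in> ?A // ?r" unfolding L(2) by (rule quotientI)
    next
      fix X assume "X \<in> ?A // ?r"
      then obtain L where L: "L \<in> ?A" "X = ?r `` {L}" by (auto elim: quotientE)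
      then have "rep L \<in> ?B" "X = ?r `` {rep L}"
        using rep[of L] rep_in_reps isomorphic_card[of L "rep L"] assms[of L "rep L"] cls[of L "rep L"] by auto
      then show "X \<in> (\<lambda>L. ?r `` {L}) ` ?B" by blast
    qed
  qed
  then show ?thesis unfolding num_def by (simp add: bij_betw_same_card)
qed

end

section \<open>Counting compositions\<close>

context two_summable_family
begin

definition lowers :: "nat \<Rightarrow> 'a gorder set" where
  "lowers j = {L \<in> reps. card (carrier L) = j \<and> lower_summand L}"

definition uppers :: "nat \<Rightarrow> 'a gorder set" where
  "uppers k = {U \<in> reps. card (carrier U) = k \<and> upper_summand U}"

definition sums :: "'a gorder \<Rightarrow> 'a gorder \<Rightarrow> 'a gorder set" where
  "sums L U = {S \<in> reps. \<exists>\<mu> p q. amalgam L U S \<mu> p q}"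

lemma finite_lowers: "finite (lowers j)"
  by (rule finite_subset[OF _ finite_reps[of j]]) (auto simp: lowers_def)

lemma finite_uppers: "finite (uppers j)"
  by (rule finite_subset[OF _ finite_reps[of j]]) (auto simp: uppers_def)

lemma amalgam_rep:
  assumes "S \<in> F" "amalgam L U S \<mu> p q"
  shows "\<exists>p q. amalgam L U (rep S) \<mu> p q"
proof -
  have r: "rep S \<in> F" "isomorphic S (rep S)" using rep[OF assms(1)] by auto
  interpret S': graded_lattice "rep S" by (rule graded_lattice[OF r(1)])
  obtain h where "order_iso S (rep S) h" using r(2) unfolding isomorphic_def by blast
  then show ?thesis
    using amalgam.pushforward[OF assms(2) _ S'.partial_order_axioms] by blast
qed

text \<open>Two pairs admit two matchings, and by \<open>unique\<close> each gives one
  representative. These coincide exactly if the first sum also arises from the second matching,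
  which \<open>both_matchings_iff\<close> decides.\<close>

lemma card_sums:
  assumes L: "L \<in> F" "lower_summand L" and U: "U \<in> F" "upper_summand U"
  shows "card (sums L U) = (if coatoms_symmetric L \<or> atoms_symmetric U then 1 else 2)"
proof -
  have card: "card (coatoms L) = 2" "card (atoms U) = 2"
    using L U by (auto simp: lower_summand_def upper_summand_def)
  obtain c1 c2 where c: "coatoms L = {c1, c2}" "c1 \<noteq> c2" using card(1) by (meson card_2_iff)
  obtain a1 a2 where a: "atoms U = {a1, a2}" "a1 \<noteq> a2" using card(2) by (meson card_2_iff)
  define \<mu>1 where "\<mu>1 c = (if c = c1 then a1 else a2)" for c
  define \<mu>2 where "\<mu>2 c = (if c = c1 then a2 else a1)" for c
  let ?G = "\<lambda>\<mu> S. \<exists>p q. amalgam L U S \<mu> p q"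
  have ex: "\<exists>S\<in>reps. ?G \<mu> S" if \<mu>: "bij_betw \<mu> (coatoms L) (atoms U)" for \<mu>
  proof -
    obtain S p q where "S \<in> F" "amalgam L U S \<mu> p q"
      using ex_sum[OF L(1) U(1) L(2) U(2) \<mu>] by blast
    then show ?thesis using amalgam_rep rep_in_reps by blast
  qed
  have "bij_betw \<mu>1 (coatoms L) (atoms U)" "bij_betw \<mu>2 (coatoms L) (atoms U)"
    using c a by (auto simp: bij_betw_def inj_on_def \<mu>1_def \<mu>2_def)
  then obtain S1 S2 where S1: "S1 \<in> reps" "?G \<mu>1 S1" and S2: "S2 \<in> reps" "?G \<mu>2 S2"
    using ex[of \<mu>1] ex[of \<mu>2] by blast
  have uniq: "S = S'" if S: "S \<in> reps" "?G \<mu> S" and S': "S' \<in> reps" "?G \<mu> S'" for S S' \<mu>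
  proof -
    obtain p q p' q' where "amalgam L U S \<mu> p q" "amalgam L U S' \<mu> p' q'"
      using S(2) S'(2) by blast
    then obtain h where "order_iso S S' h" using amalgam.unique by blast
    then have "isomorphic S S'" unfolding isomorphic_def by blast
    then show ?thesis by (rule reps_eq[OF S(1) S'(1)])
  qed
  have two: "?G \<mu>1 S \<or> ?G \<mu>2 S" if am: "amalgam L U S \<mu> p q" for S \<mu> p q
  proof -
    interpret amalgam L U S \<mu> p q by (rule am)
    have "\<mu> c1 \<in> {a1, a2}" "\<mu> c2 \<in> {a1, a2}" using \<mu>_atom[of c1] \<mu>_atom[of c2] c a by auto
    moreover have "\<mu> c1 \<noteq> \<mu> c2" using \<mu> c by (auto simp: bij_betw_def)
    ultimately have "(\<forall>x\<in>coatoms L. \<mu>1 x = \<mu> x) \<or> (\<forall>x\<in>coatoms L. \<mu>2 x = \<mu> x)"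
      unfolding c \<mu>1_def \<mu>2_def using c(2) by auto
    then show ?thesis using reindex[of \<mu>1] reindex[of \<mu>2] by blast
  qed
  have sums: "sums L U = {S1, S2}"
  proof (intro equalityI subsetI)
    fix S assume "S \<in> sums L U"
    then obtain \<mu> p q where S: "S \<in> reps" "amalgam L U S \<mu> p q" by (auto simp: sums_def)
    from two[OF S(2)] show "S \<in> {S1, S2}"
    proof
      assume "?G \<mu>1 S"
      then have "S = S1" by (rule uniq[OF S(1) _ S1])
      then show ?thesis by simp
    next
      assume "?G \<mu>2 S"
      then have "S = S2" by (rule uniq[OF S(1) _ S2])
      then show ?thesis by simp
    qed
  next
    fix S assume "S \<in> {S1, S2}"
    then show "S \<in> sums L U" using S1 S2 unfolding sums_def by blast
  qed
  obtain p q where am: "amalgam L U S1 \<mu>1 p q" using S1(2) by blast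
  interpret graded_amalgam L U S1 \<mu>1 p q
    by (rule graded_amalgamI[OF L(1) U(1) reps_subset[OF S1(1)] L(2) U(2) am])
  \<comment> \<open>If S1 admits the second matching too, it equals S2 by uniqueness along that
    matching.\<close>
  have "S1 = S2 \<longleftrightarrow> ?G \<mu>2 S1"
    using S2 uniq[OF S1(1) _ S2] by blast
  also have "\<dots> \<longleftrightarrow> coatoms_symmetric L \<or> atoms_symmetric U"
    by (rule both_matchings_iff[OF card(1)]) (use a in \<open>auto simp: \<mu>1_def \<mu>2_def\<close>)
  finally show ?thesis
    unfolding sums by (cases "S1 = S2") auto
qed

text \<open>Size and type of a sum are functions of the pair of summands, and the pair is recovered
  by cutting. Hence different pairs of representatives have disjoint sets of sums.\<close>

lemma sums_properties:
  assumes LR: "L \<in> reps" "lower_summand L" and UR: "U \<in> reps" "upper_summand U" and S: "S \<in> sums L U"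
  shows "composition S" "card (coatoms S) = card (coatoms U)"
    "coatoms_symmetric S \<longleftrightarrow> inherits_symmetry L U"
    "card (carrier S) + 4 = card (carrier L) + card (carrier U)"
    "rep (low S) = L" "rep (up S) = U"
proof -
  note L = reps_subset[OF LR(1)] LR(2) and U = reps_subset[OF UR(1)] UR(2)
  have SF: "S \<in> F" using S reps_subset by (simp add: sums_def)
  obtain \<mu> p q where am: "amalgam L U S \<mu> p q" using S by (auto simp: sums_def)
  interpret graded_amalgam L U S \<mu> p q
    by (rule graded_amalgamI[OF L(1) U(1) SF L(2) U(2) am])
  have card: "card (coatoms L) = 2" using L by (simp add: lower_summand_def)
  note cut = amalgam_cut[OF L(1) U(1) SF L(2) U(2) am]
  show "composition S" using type_iffs(1)[OF graded_vi[OF SF]] cut(1) by blast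
  show "card (coatoms S) = card (coatoms U)" by (rule card_coatoms_S)
  show "coatoms_symmetric S \<longleftrightarrow> inherits_symmetry L U" by (rule coatoms_symmetric_S[OF card])
  show "card (carrier S) + 4 = card (carrier L) + card (carrier U)"
    using card_carrier_S card by simp
  note low_up = decompose(1,2)[OF SF cut(1)]
  show "rep (low S) = L"
    using rep_eq_iff[OF L(1) low_up(1)] cut(2) rep_reps[OF LR(1)] by simp
  show "rep (up S) = U"
    using rep_eq_iff[OF U(1) low_up(2)] cut(3) rep_reps[OF UR(1)] by simp
qed

lemma decompose_rep:
  assumes S: "S \<in> reps" "composition S"
  shows "rep (low S) \<in> reps" "lower_summand (rep (low S))" "rep (up S) \<in> reps" "upper_summand (rep (up S))"
    "S \<in> sums (rep (low S)) (rep (up S))"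
proof -
  have SF: "S \<in> F" by (rule reps_subset[OF S(1)])
  have neck: "necks S \<noteq> {}" using type_iffs(1)[OF graded_vi[OF SF]] S(2) by blast
  note d = decompose[OF SF neck]
  note l = conjunct1[OF rep[OF d(1)]] conjunct2[OF rep[OF d(1)]]
  note u = conjunct1[OF rep[OF d(2)]] conjunct2[OF rep[OF d(2)]]
  show "rep (low S) \<in> reps" "rep (up S) \<in> reps" using d rep_in_reps by blast+
  show "lower_summand (rep (low S))"
    using d(3) invariants[OF graded_lattice[OF d(1)] graded_lattice[OF l(1)] l(2)]
    by (simp add: lower_summand_def)
  show "upper_summand (rep (up S))"
    using d(4) invariants[OF graded_lattice[OF d(2)] graded_lattice[OF u(1)] u(2)]
    by (simp add: upper_summand_def)
  show "S \<in> sums (rep (low S)) (rep (up S))"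
    unfolding sums_def
    using amalgam_of_isomorphic[OF SF neck l(1) u(1) isomorphic_sym[OF l(2)] isomorphic_sym[OF u(2)]] S(1)
    by simp
qed

lemma card_summand_ge_6:
  assumes "L \<in> F" "3 \<le> rank L \<top>\<^bsub>L\<^esub>"
  shows "6 \<le> card (carrier L)"
  using graded_lattice.card_carrier_ge_6[OF graded_lattice[OF assms(1)] assms(2) card_atoms_coatoms_ge[OF assms]] .

lemma decompose_card:
  assumes S: "S \<in> reps" "composition S"
  shows "6 \<le> card (carrier (rep (low S)))" "6 \<le> card (carrier (rep (up S)))"
    "card (carrier S) + 4 = card (carrier (rep (low S))) + card (carrier (rep (up S)))"
proof -
  note d = decompose_rep[OF S]
  note F = reps_subset[OF d(1)] reps_subset[OF d(3)]
  show "6 \<le> card (carrier (rep (low S)))" "6 \<le> card (carrier (rep (up S)))"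
    using card_summand_ge_6 F d(2,4) by (auto simp: lower_summand_def upper_summand_def)
  show "card (carrier S) + 4 = card (carrier (rep (low S))) + card (carrier (rep (up S)))"
    by (rule sums_properties(4)[OF d])
qed

text \<open>Compositions are grouped by size of the lower part and by the representatives of both
  parts; each group is the set of sums of one pair.\<close>

lemma count:
  assumes T: "\<And>S. S \<in> reps \<Longrightarrow> T S \<Longrightarrow> composition S"
  shows "card {S \<in> reps. card (carrier S) = n \<and> T S} =
    (\<Sum>j=6..n-2. \<Sum>L\<in>lowers j. \<Sum>U\<in>uppers (n - j + 4). card {S \<in> sums L U. T S})"
proof -
  let ?X = "{S \<in> reps. card (carrier S) = n \<and> T S}"
  let ?I = "SIGMA j:{6..n-2}. lowers j \<times> uppers (n - j + 4)"
  let ?g = "\<lambda>S. (card (carrier (rep (low S))), rep (low S), rep (up S))"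
  have fin: "finite ?X"
    by (rule finite_subset[OF _ finite_reps[of n]]) auto
  have finI: "finite ?I"
    using finite_lowers finite_uppers by (intro finite_SigmaI finite_cartesian_product) auto
  have sub: "?g ` ?X \<subseteq> ?I"
  proof (rule image_subsetI)
    fix S assume "S \<in> ?X"
    then have S: "S \<in> reps" "card (carrier S) = n" "composition S" using T by auto
    \<comment> \<open>The upper limit n - 2 for j says that the upper part, of size n - j + 4, has
      at least 6 elements too.\<close>
    have "card (carrier (rep (low S))) \<in> {6..n-2}"
      "card (carrier (rep (up S))) = n - card (carrier (rep (low S))) + 4"
      using decompose_card[OF S(1,3)] S(2) by auto
    then show "?g S \<in> ?I"
      using decompose_rep[OF S(1,3)] by (simp add: lowers_def uppers_def)
  qed
  have fibre: "{S \<in> ?X. ?g S = (j, L, U)} = {S \<in> sums L U. T S}" if I: "(j, L, U) \<in> ?I" for j L U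
  proof -
    have LU: "L \<in> reps" "lower_summand L" "card (carrier L) = j" "U \<in> reps" "upper_summand U"
      "card (carrier U) = n - j + 4" "j \<le> n - 2" "6 \<le> j"
      using I by (auto simp: lowers_def uppers_def)
    show ?thesis
    proof (intro equalityI subsetI)
      fix S assume "S \<in> {S \<in> ?X. ?g S = (j, L, U)}"
      then have S: "S \<in> reps" "T S" "rep (low S) = L" "rep (up S) = U" by auto
      then show "S \<in> {S \<in> sums L U. T S}" using decompose_rep(5)[OF S(1) T[OF S(1,2)]] by simp
    next
      fix S assume "S \<in> {S \<in> sums L U. T S}"
      then have S: "S \<in> sums L U" "T S" by auto
      note p = sums_properties[OF LU(1,2,4,5) S(1)]
      have "S \<in> reps" using S(1) by (simp add: sums_def)
      \<comment> \<open>Here j is at most n, so the subtraction in \<open>n - j + 4\<close> is not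
        truncated.\<close>
      moreover have "card (carrier S) = n" using p(4) LU by simp
      moreover have "rep (low S) = L" "rep (up S) = U" using p(5,6) .
      ultimately show "S \<in> {S \<in> ?X. ?g S = (j, L, U)}" using S(2) LU(3) by simp
    qed
  qed
  have "card ?X = (\<Sum>y\<in>?I. \<Sum>S | S \<in> ?X \<and> ?g S = y. 1)"
    using sum.group[OF fin finI sub, of "\<lambda>_. 1 :: nat"] by simp
  also have "\<dots> = (\<Sum>(j, L, U)\<in>?I. card {S \<in> sums L U. T S})"
  proof (rule sum.cong[OF refl])
    fix y assume y: "y \<in> ?I"
    obtain j L U where yy: "y = (j, L, U)" by (cases y)
    show "(\<Sum>S | S \<in> ?X \<and> ?g S = y. 1) = (case y of (j, L, U) \<Rightarrow> card {S \<in> sums L U. T S})"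
      using fibre[of j L U] y unfolding yy by simp
  qed
  also have "\<dots> = (\<Sum>j=6..n-2. \<Sum>(L, U)\<in>lowers j \<times> uppers (n - j + 4). card {S \<in> sums L U. T S})"
    by (rule sum.Sigma[symmetric]) (auto intro: finite_lowers finite_uppers)
  also have "\<dots> = (\<Sum>j=6..n-2. \<Sum>L\<in>lowers j. \<Sum>U\<in>uppers (n - j + 4). card {S \<in> sums L U. T S})"
    by (simp only: sum.cartesian_product)
  finally show ?thesis .
qed

lemma no_small_compositions:
  assumes "n < 8" and T: "\<And>S. S \<in> reps \<Longrightarrow> T S \<Longrightarrow> composition S"
  shows "card {S \<in> reps. card (carrier S) = n \<and> T S} = 0"
proof -
  have "{S \<in> reps. card (carrier S) = n \<and> T S} = {}"
  proof (rule equals0I)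
    fix S assume "S \<in> {S \<in> reps. card (carrier S) = n \<and> T S}"
    then have "S \<in> reps" "composition S" "card (carrier S) = n" using T by auto
    then show False using decompose_card[of S] assms(1) by linarith
  qed
  then show ?thesis by (simp only: card.empty)
qed

section \<open>Numbers of lattices of a type as sums of indicators\<close>

lemma num_lowers:
  assumes "\<And>L M. L \<in> F \<Longrightarrow> M \<in> F \<Longrightarrow> isomorphic L M \<Longrightarrow> T L \<longleftrightarrow> T M"
    and "\<And>L. L \<in> F \<Longrightarrow> T L \<Longrightarrow> lower_summand L"
  shows "num F T j = (\<Sum>L\<in>lowers j. of_bool (T L))"
proof -
  have "{L \<in> reps. card (carrier L) = j \<and> T L} = lowers j \<inter> {L. T L}"
    using assms(2) reps_subset by (auto simp: lowers_def)
  moreover have "num F T j = card {L \<in> reps. card (carrier L) = j \<and> T L}"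
    using assms(1) by (rule num_eq_card)
  ultimately show ?thesis
    using finite_lowers[of j] by (simp add: of_bool_def sum.If_cases)
qed

lemma num_uppers:
  assumes "\<And>L M. L \<in> F \<Longrightarrow> M \<in> F \<Longrightarrow> isomorphic L M \<Longrightarrow> T L \<longleftrightarrow> T M"
    and "\<And>L. L \<in> F \<Longrightarrow> T L \<Longrightarrow> upper_summand L"
  shows "num F T j = (\<Sum>L\<in>uppers j. of_bool (T L))"
proof -
  have "{L \<in> reps. card (carrier L) = j \<and> T L} = uppers j \<inter> {L. T L}"
    using assms(2) reps_subset by (auto simp: uppers_def)
  moreover have "num F T j = card {L \<in> reps. card (carrier L) = j \<and> T L}"
    using assms(1) by (rule num_eq_card)
  ultimately show ?thesis
    using finite_uppers[of j] by (simp add: of_bool_def sum.If_cases)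
qed

lemma lower_types:
  assumes "L \<in> F"
  shows "type_CS L \<Longrightarrow> lower_summand L"
    "type_BF L \<Longrightarrow> lower_summand L" "type_BS L \<Longrightarrow> lower_summand L"
    "type_MF L \<Longrightarrow> lower_summand L" "type_MA L \<Longrightarrow> lower_summand L" "type_MC L \<Longrightarrow> lower_summand L"
    "type_MX L \<Longrightarrow> lower_summand L" "type_MH L \<Longrightarrow> lower_summand L"
    "type_CF L \<Longrightarrow> lower_summand L"
proof -
  have "3 \<le> rank L \<top>\<^bsub>L\<^esub>" if "necks L \<noteq> {}"
    using that by (auto simp: necks_def)
  then show "type_CS L \<Longrightarrow> lower_summand L"
    "type_BF L \<Longrightarrow> lower_summand L" "type_BS L \<Longrightarrow> lower_summand L"
    "type_MF L \<Longrightarrow> lower_summand L" "type_MA L \<Longrightarrow> lower_summand L" "type_MC L \<Longrightarrow> lower_summand L"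
    "type_MX L \<Longrightarrow> lower_summand L" "type_MH L \<Longrightarrow> lower_summand L"
    "type_CF L \<Longrightarrow> lower_summand L"
    unfolding type_CF_def type_CS_def type_BF_def type_BS_def type_MF_def type_MA_def type_MC_def
      type_MX_def type_MH_def type_iffs[OF graded_vi[OF assms]] coatoms_fixed_def coatoms_symmetric_def
      lower_summand_def upper_summand_def
    by auto
qed

lemma upper_types:
  assumes "U \<in> F"
  shows "type_MF U \<Longrightarrow> upper_summand U" "type_MA U \<Longrightarrow> upper_summand U" "type_MC U \<Longrightarrow> upper_summand U"
    "type_MX U \<Longrightarrow> upper_summand U" "type_MH U \<Longrightarrow> upper_summand U"
    "type_TF U \<Longrightarrow> upper_summand U" "type_TS U \<Longrightarrow> upper_summand U"
  unfolding type_MF_def type_MA_def type_MC_def type_MX_def type_MH_def type_TF_def type_TS_def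
    type_iffs[OF graded_vi[OF assms]]
  by auto

text \<open>Each lower summand has exactly one of the nine types. A neck makes it a composition;
  otherwise it is a bottom or a middle piece according to the number of atoms, and symmetry settles
  the rest.\<close>

lemma lower_cases:
  assumes L: "L \<in> F" "lower_summand L"
  shows "of_bool (type_CF L) + of_bool (type_BF L) + of_bool (type_MF L) + of_bool (type_MA L) =
      (of_bool (\<not> coatoms_symmetric L) :: nat)"
    and "of_bool (type_CS L) + of_bool (type_BS L) + of_bool (type_MC L) + of_bool (type_MX L) + of_bool (type_MH L) =
      (of_bool (coatoms_symmetric L) :: nat)"
proof -
  have fin: "fin_lattice L" using graded_lattice[OF L(1)] by (simp add: graded_lattice_def)
  have card: "3 \<le> rank L \<top>\<^bsub>L\<^esub>" "card (coatoms L) = 2" using L(2) by (auto simp: lower_summand_def)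
  have atoms: "2 \<le> card (atoms L)" using card_atoms_coatoms_ge[OF L(1) card(1)] by simp
  have sym: "card (atoms L) \<noteq> 2 \<or> \<not> coatoms_symmetric L \<or> atoms_symmetric L \<or> swaps_coatoms_only L"
    "\<not> swaps_coatoms_only L \<or> coatoms_symmetric L"
    using fixed_atoms_swaps_coatoms_only[OF fin] swaps_coatoms_onlyD by blast+
  note defs = type_CF_def type_CS_def type_BF_def type_BS_def type_MF_def type_MA_def type_MC_def
    type_MX_iff[OF fin] type_MH_iff[OF fin] type_iffs[OF graded_vi[OF L(1)]] coatoms_fixed_def atoms_fixed_def
    upper_summand_def
  have a: "atoms_symmetric L \<Longrightarrow> card (atoms L) = 2" by (simp add: atoms_symmetric_def)
  have three: "card (atoms L) \<noteq> 2 \<Longrightarrow> 3 \<le> card (atoms L)" using atoms by linarith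
  show "of_bool (type_CF L) + of_bool (type_BF L) + of_bool (type_MF L) + of_bool (type_MA L) =
      (of_bool (\<not> coatoms_symmetric L) :: nat)"
    unfolding defs using L(2) card three a
    by (cases "necks L = {}"; cases "card (atoms L) = 2"; cases "coatoms_symmetric L"; cases "atoms_symmetric L"; simp)
  show "of_bool (type_CS L) + of_bool (type_BS L) + of_bool (type_MC L) + of_bool (type_MX L) + of_bool (type_MH L) =
      (of_bool (coatoms_symmetric L) :: nat)"
    unfolding defs using L(2) card three sym a
    by (cases "necks L = {}"; cases "card (atoms L) = 2"; cases "coatoms_symmetric L"; cases "atoms_symmetric L";
        cases "swaps_coatoms_only L"; simp)
qed

lemma LF_eq: "LF F j = (\<Sum>L\<in>lowers j. of_bool (\<not> coatoms_symmetric L))"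
proof -
  have "LF F j = (\<Sum>L\<in>lowers j. of_bool (type_CF L) + of_bool (type_BF L) + of_bool (type_MF L) + of_bool (type_MA L))"
    unfolding LF_def sum.distrib
    by (intro arg_cong2[where f = "(+)"] num_lowers types_invariant graded_vi lower_types; assumption)
  also have "\<dots> = (\<Sum>L\<in>lowers j. of_bool (\<not> coatoms_symmetric L))"
    by (intro sum.cong refl lower_cases) (auto simp: lowers_def reps_subset)
  finally show ?thesis .
qed

lemma LS_eq: "LS F j = (\<Sum>L\<in>lowers j. of_bool (coatoms_symmetric L))"
proof -
  have "LS F j = (\<Sum>L\<in>lowers j. of_bool (type_CS L) + of_bool (type_BS L) + of_bool (type_MC L)
      + of_bool (type_MX L) + of_bool (type_MH L))"
    unfolding LS_def sum.distrib
    by (intro arg_cong2[where f = "(+)"] num_lowers types_invariant graded_vi lower_types; assumption)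
  also have "\<dots> = (\<Sum>L\<in>lowers j. of_bool (coatoms_symmetric L))"
    by (intro sum.cong refl lower_cases) (auto simp: lowers_def reps_subset)
  finally show ?thesis .
qed

lemma num_types:
  "num F type_MF k = (\<Sum>U\<in>uppers k. of_bool (type_MF U))"
  "num F type_MA k = (\<Sum>U\<in>uppers k. of_bool (type_MA U))"
  "num F type_MC k = (\<Sum>U\<in>uppers k. of_bool (type_MC U))"
  "num F type_MX k = (\<Sum>U\<in>uppers k. of_bool (type_MX U))"
  "num F type_MH k = (\<Sum>U\<in>uppers k. of_bool (type_MH U))"
  "num F type_TF k = (\<Sum>U\<in>uppers k. of_bool (type_TF U))"
  "num F type_TS k = (\<Sum>U\<in>uppers k. of_bool (type_TS U))"
proof -
  show "num F type_MF k = (\<Sum>U\<in>uppers k. of_bool (type_MF U))"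
    by (rule num_uppers, erule (2) types_invariant(8)[OF graded_vi graded_vi], erule (1) upper_types(1))
  show "num F type_MA k = (\<Sum>U\<in>uppers k. of_bool (type_MA U))"
    by (rule num_uppers, erule (2) types_invariant(9)[OF graded_vi graded_vi], erule (1) upper_types(2))
  show "num F type_MC k = (\<Sum>U\<in>uppers k. of_bool (type_MC U))"
    by (rule num_uppers, erule (2) types_invariant(10)[OF graded_vi graded_vi], erule (1) upper_types(3))
  show "num F type_MX k = (\<Sum>U\<in>uppers k. of_bool (type_MX U))"
    by (rule num_uppers, erule (2) types_invariant(11)[OF graded_vi graded_vi], erule (1) upper_types(4))
  show "num F type_MH k = (\<Sum>U\<in>uppers k. of_bool (type_MH U))"
    by (rule num_uppers, erule (2) types_invariant(12)[OF graded_vi graded_vi], erule (1) upper_types(5))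
  show "num F type_TF k = (\<Sum>U\<in>uppers k. of_bool (type_TF U))"
    by (rule num_uppers, erule (2) types_invariant(6)[OF graded_vi graded_vi], erule (1) upper_types(6))
  show "num F type_TS k = (\<Sum>U\<in>uppers k. of_bool (type_TS U))"
    by (rule num_uppers, erule (2) types_invariant(7)[OF graded_vi graded_vi], erule (1) upper_types(7))
qed

lemma num_compositions:
  "num F type_CF n = card {S \<in> reps. card (carrier S) = n \<and> type_CF S}"
  "num F type_CS n = card {S \<in> reps. card (carrier S) = n \<and> type_CS S}"
  "num F type_CN n = card {S \<in> reps. card (carrier S) = n \<and> type_CN S}"
proof -
  show "num F type_CF n = card {S \<in> reps. card (carrier S) = n \<and> type_CF S}"
    by (rule num_eq_card, erule (2) types_invariant(1)[OF graded_vi graded_vi])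
  show "num F type_CS n = card {S \<in> reps. card (carrier S) = n \<and> type_CS S}"
    by (rule num_eq_card, erule (2) types_invariant(2)[OF graded_vi graded_vi])
  show "num F type_CN n = card {S \<in> reps. card (carrier S) = n \<and> type_CN S}"
    by (rule num_eq_card, erule (2) types_invariant(3)[OF graded_vi graded_vi])
qed

text \<open>All sums of L and U have the same type, so each count is \<open>card (sums L U)\<close>
  or 0. The factor 2 occurs where the coatoms of L and the atoms of U are both fixed: next to MF, MC
  and TF. A piece of type MH swaps its coatoms only together with its atoms; with fixed coatoms in L
  this is blocked and gives CF, with symmetric ones it is compensated and gives CS.\<close>

lemma card_sums_type:
  assumes L: "L \<in> lowers j" and U: "U \<in> uppers k"
  shows "card {S \<in> sums L U. type_CF S} =
      of_bool (\<not> coatoms_symmetric L) * (2 * of_bool (type_MF U) + of_bool (type_MA U) + of_bool (type_MH U))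
      + of_bool (coatoms_symmetric L) * (of_bool (type_MF U) + of_bool (type_MA U))"
    "card {S \<in> sums L U. type_CS S} =
      of_bool (\<not> coatoms_symmetric L) * (2 * of_bool (type_MC U) + of_bool (type_MX U))
      + of_bool (coatoms_symmetric L) * (of_bool (type_MC U) + of_bool (type_MX U) + of_bool (type_MH U))"
    "card {S \<in> sums L U. type_CN S} =
      of_bool (\<not> coatoms_symmetric L) * (2 * of_bool (type_TF U) + of_bool (type_TS U))
      + of_bool (coatoms_symmetric L) * (of_bool (type_TF U) + of_bool (type_TS U))"
proof -
  have LR: "L \<in> reps" "lower_summand L" and UR: "U \<in> reps" "upper_summand U"
    using L U by (auto simp: lowers_def uppers_def)
  have UF: "U \<in> F" by (rule reps_subset[OF UR(1)])
  have fin: "fin_lattice U" using graded_lattice[OF UF] by (simp add: graded_lattice_def)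
  have u: "card (atoms U) = 2" "2 \<le> card (coatoms U)"
    using UR(2) card_atoms_coatoms_ge[OF UF] by (auto simp: upper_summand_def)
  have inherit: "inherits_symmetry L U \<longleftrightarrow> (if coatoms_symmetric L then coatoms_symmetric U else swaps_coatoms_only U)"
    by (rule inherits_symmetry_iff)
  have sums: "composition S \<and> card (coatoms S) = card (coatoms U) \<and> (coatoms_symmetric S \<longleftrightarrow> inherits_symmetry L U)"
    if "S \<in> sums L U" for S
    using sums_properties(1-3)[OF LR UR that] by blast
  have card: "card (sums L U) = (if coatoms_symmetric L \<or> atoms_symmetric U then 1 else 2)"
    by (rule card_sums[OF reps_subset[OF LR(1)] LR(2) UF UR(2)])
  \<comment> \<open>Membership in a type is constant on the sums of one pair, so filtering keeps all
    of them or none.\<close>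
  have filter: "{S \<in> sums L U. T S} = (if P then sums L U else {})"
    if "\<And>S. S \<in> sums L U \<Longrightarrow> T S \<longleftrightarrow> P" for T P
    using that by auto
  have CF: "{S \<in> sums L U. type_CF S} = (if card (coatoms U) = 2 \<and> \<not> inherits_symmetry L U then sums L U else {})"
    by (rule filter) (use sums in \<open>simp add: type_CF_def coatoms_fixed_def\<close>)
  have CS: "{S \<in> sums L U. type_CS S} = (if inherits_symmetry L U then sums L U else {})"
    by (rule filter) (use sums in \<open>simp add: type_CS_def\<close>)
  have CN: "{S \<in> sums L U. type_CN S} = (if 3 \<le> card (coatoms U) then sums L U else {})"
    by (rule filter) (use sums in \<open>simp add: type_CN_def\<close>)
  have s: "coatoms_symmetric U \<Longrightarrow> card (coatoms U) = 2" by (simp add: coatoms_symmetric_def)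
  have sym: "\<not> coatoms_symmetric U \<or> atoms_symmetric U \<or> swaps_coatoms_only U"
    "\<not> swaps_coatoms_only U \<or> coatoms_symmetric U" "\<not> coatoms_symmetric U \<or> card (coatoms U) = 2"
    using fixed_atoms_swaps_coatoms_only[OF fin u(1)] swaps_coatoms_onlyD[of U] s by blast+
  note defs = type_MF_def type_MA_def type_MC_def type_MX_iff[OF fin] type_MH_iff[OF fin] type_TF_def type_TS_def
    type_iffs(2,4)[OF graded_vi[OF UF]] coatoms_fixed_def atoms_fixed_def
  have cases: "card (coatoms U) = 2 \<or> 3 \<le> card (coatoms U)" using u(2) by linarith
  show "card {S \<in> sums L U. type_CF S} =
      of_bool (\<not> coatoms_symmetric L) * (2 * of_bool (type_MF U) + of_bool (type_MA U) + of_bool (type_MH U))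
      + of_bool (coatoms_symmetric L) * (of_bool (type_MF U) + of_bool (type_MA U))"
    unfolding CF inherit defs using card UR(2) u(1) sym
    by (cases "coatoms_symmetric L"; cases "coatoms_symmetric U"; cases "atoms_symmetric U";
        cases "swaps_coatoms_only U"; simp)
  show "card {S \<in> sums L U. type_CS S} =
      of_bool (\<not> coatoms_symmetric L) * (2 * of_bool (type_MC U) + of_bool (type_MX U))
      + of_bool (coatoms_symmetric L) * (of_bool (type_MC U) + of_bool (type_MX U) + of_bool (type_MH U))"
    unfolding CS inherit defs using card UR(2) u(1) sym
    by (cases "coatoms_symmetric L"; cases "coatoms_symmetric U"; cases "atoms_symmetric U";
        cases "swaps_coatoms_only U"; simp)
  show "card {S \<in> sums L U. type_CN S} =
      of_bool (\<not> coatoms_symmetric L) * (2 * of_bool (type_TF U) + of_bool (type_TS U))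
      + of_bool (coatoms_symmetric L) * (of_bool (type_TF U) + of_bool (type_TS U))"
    unfolding CN defs using card UR(2) u(1)
    by (cases "coatoms_symmetric L"; cases "atoms_symmetric U"; simp)
qed

lemma composition_types:
  "type_CF S \<Longrightarrow> composition S" "type_CS S \<Longrightarrow> composition S" "type_CN S \<Longrightarrow> composition S"
  by (simp_all add: type_CF_def type_CS_def type_CN_def)

lemma num_small:
  assumes "n < 8"
  shows "num F type_CF n = 0" "num F type_CS n = 0" "num F type_CN n = 0"
proof -
  show "num F type_CF n = 0"
    unfolding num_compositions
    by (rule no_small_compositions[OF assms composition_types(1)])
  show "num F type_CS n = 0"
    unfolding num_compositions
    by (rule no_small_compositions[OF assms composition_types(2)])
  show "num F type_CN n = 0"
    unfolding num_compositions
    by (rule no_small_compositions[OF assms composition_types(3)])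
qed

text \<open>Each term of \<open>card_sums_type\<close> is a factor for L times a factor for U. The
  double sum therefore becomes products of \<open>LF\<close> or \<open>LS\<close> with numbers of
  pieces.\<close>

lemma sum_split:
  "(\<Sum>L\<in>A. \<Sum>U\<in>B. f L * g U + f' L * g' U) =
    sum f A * sum g B + sum f' A * (sum g' B :: nat)"
  by (simp only: sum.distrib sum_product)

section \<open>The three recurrences\<close>

lemma num_CF:
  "num F type_CF n = (\<Sum>j=6..n-2. LF F j * (2 * num F type_MF (n-j+4) + num F type_MA (n-j+4) + num F type_MH (n-j+4))
     + LS F j * (num F type_MF (n-j+4) + num F type_MA (n-j+4)))"
proof -
  have "num F type_CF n = (\<Sum>j=6..n-2. \<Sum>L\<in>lowers j. \<Sum>U\<in>uppers (n-j+4). card {S \<in> sums L U. type_CF S})"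
    unfolding num_compositions
    by (rule count[OF composition_types(1)])
  also have "\<dots> = (\<Sum>j=6..n-2. \<Sum>L\<in>lowers j. \<Sum>U\<in>uppers (n-j+4).
      of_bool (\<not> coatoms_symmetric L) * (2 * of_bool (type_MF U) + of_bool (type_MA U) + of_bool (type_MH U))
      + of_bool (coatoms_symmetric L) * (of_bool (type_MF U) + of_bool (type_MA U)))"
    by (intro sum.cong refl card_sums_type(1))
  also have "\<dots> = (\<Sum>j=6..n-2. LF F j * (2 * num F type_MF (n-j+4) + num F type_MA (n-j+4) + num F type_MH (n-j+4))
     + LS F j * (num F type_MF (n-j+4) + num F type_MA (n-j+4)))"
    unfolding sum_split LF_eq LS_eq num_types by (simp only: sum.distrib sum_distrib_left)
  finally show ?thesis .
qed

lemma num_CS: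
  "num F type_CS n = (\<Sum>j=6..n-2. LF F j * (2 * num F type_MC (n-j+4) + num F type_MX (n-j+4))
     + LS F j * (num F type_MC (n-j+4) + num F type_MX (n-j+4) + num F type_MH (n-j+4)))"
proof -
  have "num F type_CS n = (\<Sum>j=6..n-2. \<Sum>L\<in>lowers j. \<Sum>U\<in>uppers (n-j+4). card {S \<in> sums L U. type_CS S})"
    unfolding num_compositions
    by (rule count[OF composition_types(2)])
  also have "\<dots> = (\<Sum>j=6..n-2. \<Sum>L\<in>lowers j. \<Sum>U\<in>uppers (n-j+4).
      of_bool (\<not> coatoms_symmetric L) * (2 * of_bool (type_MC U) + of_bool (type_MX U))
      + of_bool (coatoms_symmetric L) * (of_bool (type_MC U) + of_bool (type_MX U) + of_bool (type_MH U)))"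
    by (intro sum.cong refl card_sums_type(2))
  also have "\<dots> = (\<Sum>j=6..n-2. LF F j * (2 * num F type_MC (n-j+4) + num F type_MX (n-j+4))
     + LS F j * (num F type_MC (n-j+4) + num F type_MX (n-j+4) + num F type_MH (n-j+4)))"
    unfolding sum_split LF_eq LS_eq num_types by (simp only: sum.distrib sum_distrib_left)
  finally show ?thesis .
qed

lemma num_CN:
  "num F type_CN n = (\<Sum>j=6..n-2. LF F j * (2 * num F type_TF (n-j+4) + num F type_TS (n-j+4))
     + LS F j * (num F type_TF (n-j+4) + num F type_TS (n-j+4)))"
proof -
  have "num F type_CN n = (\<Sum>j=6..n-2. \<Sum>L\<in>lowers j. \<Sum>U\<in>uppers (n-j+4). card {S \<in> sums L U. type_CN S})"
    unfolding num_compositions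
    by (rule count[OF composition_types(3)])
  also have "\<dots> = (\<Sum>j=6..n-2. \<Sum>L\<in>lowers j. \<Sum>U\<in>uppers (n-j+4).
      of_bool (\<not> coatoms_symmetric L) * (2 * of_bool (type_TF U) + of_bool (type_TS U))
      + of_bool (coatoms_symmetric L) * (of_bool (type_TF U) + of_bool (type_TS U)))"
    by (intro sum.cong refl card_sums_type(3))
  also have "\<dots> = (\<Sum>j=6..n-2. LF F j * (2 * num F type_TF (n-j+4) + num F type_TS (n-j+4))
     + LS F j * (num F type_TF (n-j+4) + num F type_TS (n-j+4)))"
    unfolding sum_split LF_eq LS_eq num_types by (simp only: sum.distrib sum_distrib_left)
  finally show ?thesis .
qed

end

theorem theorem1:
  fixes F :: "'a gorder set" and n :: nat
  assumes "infinite (UNIV :: 'a set)"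
    and "two_summable F"
  shows "(n < 8 \<longrightarrow> num F type_CF n = 0 \<and> num F type_CS n = 0 \<and> num F type_CN n = 0) \<and>
    (n \<ge> 8 \<longrightarrow>
      num F type_CF n =
        (\<Sum>j=6..n-2. let k = n - j + 4 in
           LF F j * (2 * num F type_MF k + num F type_MA k + num F type_MH k)
           + LS F j * (num F type_MF k + num F type_MA k)) \<and>
      num F type_CS n =
        (\<Sum>j=6..n-2. let k = n - j + 4 in
           LF F j * (2 * num F type_MC k + num F type_MX k)
           + LS F j * (num F type_MC k + num F type_MX k + num F type_MH k)) \<and>
      num F type_CN n =
        (\<Sum>j=6..n-2. let k = n - j + 4 in
           LF F j * (2 * num F type_TF k + num F type_TS k)
           + LS F j * (num F type_TF k + num F type_TS k)))"
proof -
  interpret two_summable_family F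
    by (rule two_summable_family.intro[OF assms])
  show ?thesis
    unfolding Let_def using num_small num_CF num_CS num_CN by blast
qed

end
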